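(* Let $\lambda/\mu$ be a basic skew diagram with $\delta(\lambda/\mu)=n\ge 2$. Then $[\lambda/\mu]=\sum_\nu c(\lambda;\mu,\nu)[\nu]$ contains at least $g_n$ pairs of characters $([\nu^1],[\nu^2])$ whose corresponding diagrams differ only by one box; i.e. there are at least $g_n$ unordered pairs $\{\nu^1,\nu^2\}$ of partitions with $|\nu^1\cap\nu^2|=|\nu^1|-1=|\nu^2|-1$ and $c(\lambda;\mu,\nu^1)\neq0$, $c(\lambda;\mu,\nu^2)\ne0$. Furthermore, write $\lambda=(\lambda_1,\ldots,\lambda_l)$ and $\mu=(\mu_1,\ldots,\mu_m)$ with $\lambda_l,\mu_m\ge1$, and set $\mathcal A=(\lambda_1-2,\lambda_l-1)/(\mu_1-1)$ and $\mathcal B=(\lambda_2,\lambda_3,\ldots,\lambda_{l-1})/(\mu_2,\mu_3,\ldots,\mu_m)$. If $[\mathcal A]$ has $a$ components and $[\mathcal B]$ has $b$ components, then there are at least $\max(a,b)$ such pairs $\nu^1,\nu^2$.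
   Context: For a partition $\lambda$, $l(\lambda)$ is the number of positive parts, $|\lambda|$ the sum of the parts, and $dp(\lambda)$ the number of different (positive) parts of $\lambda$. Partitions are identified with their diagrams ($\lambda_i$ left-justified boxes in row $i$), and $\nu^1\cap\nu^2$ is the intersection of diagrams. For $\mu\subseteq\lambda$ the skew diagram $\lambda/\mu$ is the set of boxes of $\lambda$ not in $\mu$; it is basic if $\mu_i<\lambda_i$ and $\mu_i\le\lambda_{i+1}$ for each $1\le i\le l(\lambda)$ (no empty rows or columns). The $\delta$ value of a basic skew diagram is $\delta(\lambda/\mu)=\min\big(dp(\mu)+1,\,dp(\lambda)\big)$. $c(\lambda;\mu,\nu)$ is the Littlewood-Richardson coefficient (the number of semistandard tableaux of shape $\lambda/\mu$ and content $\nu$ whose reverse row word is a lattice word). The skew character is $[\lambda/\mu]=\sum_\nu c(\lambda;\mu,\nu)[\nu]$, with $[\nu]$ the irreducible character of the symmetric group labeled by $\nu$; its number of components is $\#\{\nu: c(\lambda;\mu,\nu)\neq0\}$ (the empty skew diagram has exactly one component, $\nu=\emptyset$). $g_n$ is the number of unordered pairs $(\nu^1,\nu^2)$ of partitions of $n$ with $|\nu^1\cap\nu^2|=n-1$. *)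

theory Defs
  imports "HOL-Library.FuncSet" "HOL-Library.More_List"
begin

text \<open>
  A partition is the list of its positive parts in weakly decreasing order. Rows and columns of
  diagrams are numbered from 0, so \<open>nth_default 0 lam i\<close> is \<open>\<lambda>\<^sub>i\<^sub>+\<^sub>1\<close>, with value 0 beyond the last part.
\<close>

definition is_partition :: "nat list \<Rightarrow> bool" where
  "is_partition lam \<longleftrightarrow> sorted_wrt (\<ge>) lam \<and> (\<forall>x\<in>set lam. 0 < x)"

definition diagram :: "nat list \<Rightarrow> (nat \<times> nat) set" where
  "diagram lam = {(i, j). j < nth_default 0 lam i}"

definition skew_diagram :: "nat list \<Rightarrow> nat list \<Rightarrow> (nat \<times> nat) set" where
  "skew_diagram lam mu = diagram lam - diagram mu"

definition dp :: "nat list \<Rightarrow> nat" where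
  "dp lam = card (set lam)"

definition basic :: "nat list \<Rightarrow> nat list \<Rightarrow> bool" where
  "basic lam mu \<longleftrightarrow> diagram mu \<subseteq> diagram lam \<and>
     (\<forall>i<length lam. nth_default 0 mu i < nth_default 0 lam i \<and>
                     nth_default 0 mu i \<le> nth_default 0 lam (Suc i))"

definition delta :: "nat list \<Rightarrow> nat list \<Rightarrow> nat" where
  "delta lam mu = min (dp mu + 1) (dp lam)"

text \<open>Entries of tableaux are positive integers; a tableau is \<open>undefined\<close> outside its shape.\<close>

definition semistandard :: "nat list \<Rightarrow> nat list \<Rightarrow> (nat \<times> nat \<Rightarrow> nat) \<Rightarrow> bool" where
  "semistandard lam mu T \<longleftrightarrow>
     T \<in> skew_diagram lam mu \<rightarrow>\<^sub>E {1..} \<and>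
     (\<forall>i j j'. (i, j) \<in> skew_diagram lam mu \<and> (i, j') \<in> skew_diagram lam mu \<and> j < j'
        \<longrightarrow> T (i, j) \<le> T (i, j')) \<and>
     (\<forall>i i' j. (i, j) \<in> skew_diagram lam mu \<and> (i', j) \<in> skew_diagram lam mu \<and> i < i'
        \<longrightarrow> T (i, j) < T (i', j))"

definition has_content :: "nat list \<Rightarrow> nat list \<Rightarrow> (nat \<times> nat \<Rightarrow> nat) \<Rightarrow> nat list \<Rightarrow> bool" where
  "has_content lam mu T nu \<longleftrightarrow>
     (\<forall>k. card {x \<in> skew_diagram lam mu. T x = Suc k} = nth_default 0 nu k)"

text \<open>Rows are read from top to bottom, each one from right to left.\<close>

definition reverse_row_word :: "nat list \<Rightarrow> nat list \<Rightarrow> (nat \<times> nat \<Rightarrow> nat) \<Rightarrow> nat list" where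
  "reverse_row_word lam mu T =
     concat (map (\<lambda>i. map (\<lambda>j. T (i, j)) (rev [nth_default 0 mu i..<nth_default 0 lam i]))
                 [0..<length lam])"

definition lattice_word :: "nat list \<Rightarrow> bool" where
  "lattice_word w \<longleftrightarrow>
     (\<forall>p k. 1 \<le> k \<longrightarrow> count_list (take p w) (Suc k) \<le> count_list (take p w) k)"

definition lr_coeff :: "nat list \<Rightarrow> nat list \<Rightarrow> nat list \<Rightarrow> nat" where
  "lr_coeff lam mu nu =
     card {T. semistandard lam mu T \<and> has_content lam mu T nu \<and>
              lattice_word (reverse_row_word lam mu T)}"

text \<open>The labels of the irreducible characters that occur in the skew character
  \<open>[\<lambda>/\<mu>] = \<Sum>\<nu>. c(\<lambda>;\<mu>,\<nu>) [\<nu>]\<close>, counted without multiplicity.\<close>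

definition components :: "nat list \<Rightarrow> nat list \<Rightarrow> nat list set" where
  "components lam mu = {nu. is_partition nu \<and> lr_coeff lam mu nu \<noteq> 0}"

definition differ_by_one_box :: "nat list \<Rightarrow> nat list \<Rightarrow> bool" where
  "differ_by_one_box nu1 nu2 \<longleftrightarrow>
     card (diagram nu1 \<inter> diagram nu2) + 1 = sum_list nu1 \<and>
     card (diagram nu1 \<inter> diagram nu2) + 1 = sum_list nu2"

definition neighbour_pairs :: "nat list set \<Rightarrow> nat list set set" where
  "neighbour_pairs P = {{nu1, nu2} | nu1 nu2. nu1 \<in> P \<and> nu2 \<in> P \<and> differ_by_one_box nu1 nu2}"

definition g :: "nat \<Rightarrow> nat" where
  "g n = card (neighbour_pairs {nu. is_partition nu \<and> sum_list nu = n})"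

text \<open>\<open>\<A> = (\<lambda>\<^sub>1 - 2, \<lambda>\<^sub>l - 1)/(\<mu>\<^sub>1 - 1)\<close> and \<open>\<B> = (\<lambda>\<^sub>2, \<dots>, \<lambda>\<^sub>l\<^sub>-\<^sub>1)/(\<mu>\<^sub>2, \<dots>, \<mu>\<^sub>m)\<close>. The subtractions in
  \<open>\<A>\<close> may produce trailing zeros, which are stripped. If \<open>delta lam mu \<ge> 2\<close> and \<open>basic lam mu\<close>, then
  \<open>mu\<close> is nonempty, \<open>lam\<close> has at least two parts and its first part is at least 2, so no subtraction
  truncates.\<close>

definition A_outer :: "nat list \<Rightarrow> nat list" where
  "A_outer lam = strip_while ((=) 0) [hd lam - 2, last lam - 1]"

definition A_inner :: "nat list \<Rightarrow> nat list" where
  "A_inner mu = strip_while ((=) 0) [hd mu - 1]"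

definition B_outer :: "nat list \<Rightarrow> nat list" where
  "B_outer lam = butlast (tl lam)"

definition B_inner :: "nat list \<Rightarrow> nat list" where
  "B_inner mu = tl mu"

end

theory Submission
  imports Defs
begin

text \<open>
  Counting the entries \<open>k + 1\<close> in the first \<open>i\<close> rows turns Littlewood-Richardson tableaux into integer
  points of a cone, so the triples \<open>(\<lambda>, \<mu>, \<nu>)\<close> with \<open>c(\<lambda>;\<mu>,\<nu>) \<noteq> 0\<close> are closed under addition of
  partitions. They are also closed under union of the multisets of parts: an array is a hive, hives
  are the M-concave functions on a planar lattice, these are closed under sup-convolution, and on the
  boundary sup-convolution merges the parts.

  Consequently a column of \<open>\<lambda>\<close> together with a column of \<open>\<mu>\<close> that is not longer, or a row of \<open>\<lambda>\<close>
  together with a possibly empty row of \<open>\<mu>\<close> that is not longer, may be deleted: every \<open>\<nu>\<close> that occurs in the smaller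
  skew character yields one that occurs in the larger one, by adding a fixed column or by inserting a
  fixed part. Moreover, if a box is alone in its row and its column, then adding any box to a \<open>\<nu>\<close> that
  occurs without this box gives one that occurs with it. A basic skew diagram with \<open>\<delta> = n\<close> can be
  dismantled by these steps, removing \<open>n\<close> isolated boxes in all; running them backwards embeds the
  partitions of \<open>n\<close> into the components and preserves the relation of differing by one box.

  For the second bound, split off the first and the last row:
  \<open>(\<lambda>\<^sub>1, \<lambda>\<^sub>l)/(\<mu>\<^sub>1)\<close> is the sum of \<open>\<A>\<close> and \<open>(2, 1)/(1)\<close>, whose two components differ by one box, and
  \<open>\<lambda>/\<mu>\<close> is its union with \<open>\<B>\<close>.
\<close>

section \<open>Littlewood-Richardson arrays and hives\<close>

text \<open>Partitions are antitone functions on all of \<open>nat\<close> that vanish eventually,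
  so an empty row of \<mu> can be deleted like any other row.

  In the dismantling, the obstacle is that \<open>min (dp mu + 1) (dp lam)\<close> may fall only
  when an isolated box is removed. Deleting a repeated part of \<lambda> and a repeated part of
  \<mu> loses nothing, but can leave an empty row or column. The summand 1 in \<delta> stands for
  the empty row of \<mu>: in a basic diagram with \<open>l\<close> rows the last row of \<mu> is
  empty, so \<open>l - dp lam\<close> rows of \<lambda> and \<open>l - 1 - dp mu\<close> rows of
  \<mu> equal the next row. If \<open>dp lam = dp mu + 1\<close>, both partitions therefore have
  equally many repeated rows and, as numbers of distinct parts are invariant under conjugation,
  equally many repeated columns. A diagram that admits no step would have its repetitions so far
  apart that the lengths contradict each other, or none at all; in the latter case it is bounded by
  staircases, and its first row is an isolated box.\<close>

definition young :: "(nat \<Rightarrow> nat) \<Rightarrow> bool" where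
  "young f \<longleftrightarrow> antimono f \<and> (\<exists>n. f n = 0)"

text \<open>\<open>a i k\<close> stands for the number of entries \<open>k + 1\<close> in the first \<open>i\<close> rows of a tableau. The last
  condition says that the columns are strictly increasing: the entries up to \<open>k + 1\<close> in row \<open>i + 1\<close>
  do not reach beyond the entries up to \<open>k\<close> in row \<open>i\<close>.\<close>

definition lr_array :: "(nat \<Rightarrow> nat) \<Rightarrow> (nat \<Rightarrow> nat \<Rightarrow> nat) \<Rightarrow> bool" where
  "lr_array mu a \<longleftrightarrow>
     (\<forall>k. a 0 k = 0) \<and>
     (\<forall>i k. a i k \<le> a (Suc i) k) \<and>
     (\<forall>i k. a (Suc i) (Suc k) \<le> a i k) \<and>
     (\<forall>i k. mu (Suc i) + sum (a (Suc (Suc i))) {..<Suc k} + sum (a i) {..<k}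
        \<le> mu i + sum (a (Suc i)) {..<k} + sum (a (Suc i)) {..<Suc k})"

text \<open>Row \<open>i\<close> has \<open>lam i - mu i\<close> boxes, written additively because
  subtraction on \<open>nat\<close> truncates. The sums up to \<open>i\<close> are full sums since
  \<open>a i k = 0\<close> for \<open>k >= i\<close>. The content is the eventual value of the rows
  \<open>a i\<close>, so no number of rows has to be carried along.\<close>

definition LR :: "(nat \<Rightarrow> nat) \<Rightarrow> (nat \<Rightarrow> nat) \<Rightarrow> (nat \<Rightarrow> nat) \<Rightarrow> bool" where
  "LR lam mu nu \<longleftrightarrow> (\<exists>a. lr_array mu a \<and>
     (\<forall>i. sum (a (Suc i)) {..<Suc i} + mu i = sum (a i) {..<i} + lam i) \<and>
     (\<exists>N. \<forall>i\<ge>N. a i = nu))"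

text \<open>Descending a diagonal by the lattice condition ends at \<open>a 0 _ = 0\<close>: the
  first \<open>i\<close> rows contain only entries up to \<open>i\<close>.\<close>

lemma lr_array_zero: "lr_array mu a \<Longrightarrow> i \<le> k \<Longrightarrow> a i k = 0"
proof (induction i arbitrary: k)
  case (Suc i)
  then obtain k' where "k = Suc k'" by (cases k) auto
  then show ?case using Suc unfolding lr_array_def
    by (metis Suc_le_mono le_zero_eq)
qed (simp add: lr_array_def)

lemma lr_array_mono: "lr_array mu a \<Longrightarrow> i \<le> j \<Longrightarrow> a i k \<le> a j k"
  using lift_Suc_mono_le[of "\<lambda>i. a i k" i j] unfolding lr_array_def by blast

lemma lr_array_antimono: "lr_array mu a \<Longrightarrow> antimono (a i)"
proof -
  assume a: "lr_array mu a"
  have "a i (Suc k) \<le> a i k" for k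
  proof (cases i)
    case 0 then show ?thesis using a by (simp add: lr_array_def)
  next
    case (Suc i') then show ?thesis using a unfolding lr_array_def by (meson le_trans)
  qed
  then show ?thesis by (metis antimonoI lift_Suc_antimono_le)
qed

lemma LR_young: "LR lam mu nu \<Longrightarrow> young nu"
  unfolding LR_def young_def using lr_array_antimono lr_array_zero
  by (metis order_refl)

lemma LR_plus:
  assumes "LR lam1 mu1 nu1" "LR lam2 mu2 nu2"
  shows "LR (\<lambda>i. lam1 i + lam2 i) (\<lambda>i. mu1 i + mu2 i) (\<lambda>i. nu1 i + nu2 i)"
proof -
  obtain a N where a: "lr_array mu1 a" "\<And>i. sum (a (Suc i)) {..<Suc i} + mu1 i = sum (a i) {..<i} + lam1 i"
    and N: "\<And>i. i \<ge> N \<Longrightarrow> a i = nu1"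
    using assms(1) unfolding LR_def by blast
  obtain b K where b: "lr_array mu2 b" "\<And>i. sum (b (Suc i)) {..<Suc i} + mu2 i = sum (b i) {..<i} + lam2 i"
    and K: "\<And>i. i \<ge> K \<Longrightarrow> b i = nu2"
    using assms(2) unfolding LR_def by blast
  have "\<forall>i k. mu1 (Suc i) + mu2 (Suc i) +
        (sum (a (Suc (Suc i))) {..<Suc k} + sum (b (Suc (Suc i))) {..<Suc k}) +
        (sum (a i) {..<k} + sum (b i) {..<k})
        \<le> mu1 i + mu2 i + (sum (a (Suc i)) {..<k} + sum (b (Suc i)) {..<k}) +
           (sum (a (Suc i)) {..<Suc k} + sum (b (Suc i)) {..<Suc k})"
  proof (intro allI)
    fix i k
    have "mu1 (Suc i) + sum (a (Suc (Suc i))) {..<Suc k} + sum (a i) {..<k}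
        \<le> mu1 i + sum (a (Suc i)) {..<k} + sum (a (Suc i)) {..<Suc k}"
      "mu2 (Suc i) + sum (b (Suc (Suc i))) {..<Suc k} + sum (b i) {..<k}
        \<le> mu2 i + sum (b (Suc i)) {..<k} + sum (b (Suc i)) {..<Suc k}"
      using a(1) b(1) unfolding lr_array_def by blast+
    then show "mu1 (Suc i) + mu2 (Suc i) +
        (sum (a (Suc (Suc i))) {..<Suc k} + sum (b (Suc (Suc i))) {..<Suc k}) +
        (sum (a i) {..<k} + sum (b i) {..<k})
        \<le> mu1 i + mu2 i + (sum (a (Suc i)) {..<k} + sum (b (Suc i)) {..<k}) +
           (sum (a (Suc i)) {..<Suc k} + sum (b (Suc i)) {..<Suc k})" by linarith
  qed
  then have "lr_array (\<lambda>i. mu1 i + mu2 i) (\<lambda>i k. a i k + b i k)"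
    using a(1) b(1) unfolding lr_array_def sum.distrib by (simp add: add_mono)
  moreover have "sum (\<lambda>k. a (Suc i) k + b (Suc i) k) {..<Suc i} + (mu1 i + mu2 i)
      = sum (\<lambda>k. a i k + b i k) {..<i} + (lam1 i + lam2 i)" for i
    using a(2)[of i] b(2)[of i] unfolding sum.distrib by linarith
  moreover have "\<forall>i\<ge>max N K. (\<lambda>k. a i k + b i k) = (\<lambda>k. nu1 k + nu2 k)"
    using N K by auto
  ultimately show ?thesis unfolding LR_def by blast
qed

text \<open>The hive of an array \<open>a\<close> is \<open>f x y = (\<Sum>j<x + y. mu j) + (\<Sum>k<x. a (x + y) k)\<close>. In these coordinates
  its domain is the whole quadrant, and the rhombus inequalities take the following form.\<close>

definition hive :: "(nat \<Rightarrow> nat \<Rightarrow> int) \<Rightarrow> bool" where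
  "hive f \<longleftrightarrow> (\<forall>x y.
     f x (y + 2) + f (x + 1) y \<le> f (x + 1) (y + 1) + f x (y + 1) \<and>
     f (x + 2) y + f x (y + 1) \<le> f (x + 1) y + f (x + 1) (y + 1) \<and>
     f (x + 1) (y + 1) + f x y \<le> f x (y + 1) + f (x + 1) y)"

lemma hive_swap: "hive f \<Longrightarrow> hive (\<lambda>x y. f y x)"
  unfolding hive_def by (simp add: algebra_simps)

text \<open>Two of the rhombus inequalities say that the slope in x weakly decreases under the steps
  \<open>(0, 1)\<close> and \<open>(1, -1)\<close>, hence also under their sum
  \<open>(1, 0)\<close>. The side conditions say that \<open>(a, b) - (c, d)\<close> lies in the
  cone spanned by these steps.\<close>

lemma hive_slope_x:
  assumes "hive f" "c \<le> a" "c + d \<le> a + b"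
  shows "f (Suc a) b - f a b \<le> f (Suc c) d - f c d"
proof -
  have s1: "f (Suc x) (Suc y) - f x (Suc y) \<le> f (Suc x) y - f x y" for x y
    using assms(1) unfolding hive_def by (smt (verit) Suc_eq_plus1)
  have s2: "f (Suc (Suc x)) y - f (Suc x) y \<le> f (Suc x) (Suc y) - f x (Suc y)" for x y
    using assms(1) unfolding hive_def by (smt (verit) Suc_eq_plus1 add_2_eq_Suc')
  have s3: "f (Suc (Suc x)) y - f (Suc x) y \<le> f (Suc x) y - f x y" for x y
    using s1[of x y] s2[of x y] by linarith
  have t1: "f (Suc x) (y + t) - f x (y + t) \<le> f (Suc x) y - f x y" for x y t
    using s1 by (induction t) (auto intro: order_trans)
  have t2: "f (Suc (x + t)) y - f (x + t) y \<le> f (Suc x) (y + t) - f x (y + t)" for x y t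
  proof (induction t arbitrary: y)
    case (Suc t)
    have "f (Suc (x + Suc t)) y - f (x + Suc t) y \<le> f (Suc (x + t)) (Suc y) - f (x + t) (Suc y)"
      using s2[of "x + t" y] by simp
    also have "\<dots> \<le> f (Suc x) (Suc y + t) - f x (Suc y + t)" by (rule Suc.IH)
    finally show ?case by simp
  qed simp
  have t3: "f (Suc (x + t)) y - f (x + t) y \<le> f (Suc x) y - f x y" for x y t
  proof (induction t)
    case (Suc t)
    then show ?case using s3[of "x + t" y] by simp
  qed simp
  show ?thesis
  proof (cases "d \<le> b")
    case True
    then show ?thesis using t1[of a d "b - d"] t3[of c "a - c" d] assms(2) by simp
  next
    case False
    define t where "t = d - b"
    have t: "t \<le> a" "c \<le> a - t" "b + t = d" using False assms(3) unfolding t_def by auto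
    have "f (Suc a) b - f a b \<le> f (Suc (a - t)) d - f (a - t) d"
      using t2[of "a - t" t b] t by simp
    also have "\<dots> \<le> f (Suc c) d - f c d"
      using t3[of c "a - t - c" d] t by simp
    finally show ?thesis .
  qed
qed

lemma hive_slope_diag:
  assumes "hive f" "c \<le> a" "b \<le> d"
  shows "f (Suc a) b - f a (Suc b) \<le> f (Suc c) d - f c (Suc d)"
proof -
  have s1: "f (Suc (Suc x)) y - f (Suc x) (Suc y) \<le> f (Suc x) y - f x (Suc y)" for x y
    using assms(1) unfolding hive_def by (smt (verit) Suc_eq_plus1 add_2_eq_Suc')
  have s2: "f (Suc x) y - f x (Suc y) \<le> f (Suc x) (Suc y) - f x (Suc (Suc y))" for x y
    using assms(1) unfolding hive_def by (smt (verit) Suc_eq_plus1 add_2_eq_Suc')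
  have t1: "f (Suc (x + t)) y - f (x + t) (Suc y) \<le> f (Suc x) y - f x (Suc y)" for x y t
    using s1 by (induction t) (auto intro: order_trans)
  have t2: "f (Suc x) y - f x (Suc y) \<le> f (Suc x) (y + t) - f x (Suc (y + t))" for x y t
    using s2 by (induction t) (auto intro: order_trans)
  show ?thesis using t1[of c "a - c" b] t2[of c b "d - b"] assms(2,3) by simp
qed

text \<open>The exchange property of M-concave functions. Give \<open>(x, y)\<close> the third
  coordinate \<open>-(x + y)\<close>. If \<open>p\<close> exceeds \<open>q\<close> in x, then
  \<open>q\<close> exceeds \<open>p\<close> in another coordinate, and moving one unit of
  \<open>p\<close> from x to that coordinate, with the opposite move for \<open>q\<close>, does not
  decrease the sum of the two values.\<close>

lemma hive_exchange_x:
  assumes "hive f" "qx < px"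
  shows "px + py > qx + qy \<and> f px py + f qx qy \<le> f (px - 1) py + f (qx + 1) qy \<or>
         py < qy \<and> f px py + f qx qy \<le> f (px - 1) (py + 1) + f (qx + 1) (qy - 1)"
proof -
  obtain p where p: "px = Suc p" "qx \<le> p" using assms(2) by (cases px) auto
  show ?thesis
  proof (cases "px + py > qx + qy")
    case True
    then have "f (Suc p) py - f p py \<le> f (Suc qx) qy - f qx qy"
      using hive_slope_x[OF assms(1) p(2), of qy py] p by simp
    then show ?thesis using True p by simp
  next
    case False
    then obtain q where q: "qy = Suc q" "py \<le> q" using assms(2) by (cases qy) auto
    have "f (Suc p) py - f p (Suc py) \<le> f (Suc qx) q - f qx (Suc q)"
      using hive_slope_diag[OF assms(1) p(2) q(2)] .
    then show ?thesis using p q by simp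
  qed
qed

text \<open>The same exchange when \<open>q\<close> exceeds \<open>p\<close> in the third
  coordinate: \<open>p\<close> gives up a unit of x or of y, and \<open>q\<close> receives
  it.\<close>

lemma hive_exchange_z:
  assumes "hive f" "px + py > qx + qy"
  shows "px > qx \<and> f px py + f qx qy \<le> f (px - 1) py + f (qx + 1) qy \<or>
         py > qy \<and> f px py + f qx qy \<le> f px (py - 1) + f qx (qy + 1)"
proof (cases "px > qx")
  case True
  then show ?thesis using hive_exchange_x[OF assms(1) True, where py = py and qy = qy] 
      hive_slope_x[OF assms(1), of qx "px - 1" qy py] assms(2) by (cases px) auto
next
  case False
  then obtain p where p: "py = Suc p" "qy \<le> p" "qy + qx \<le> p + px" using assms(2) by (cases py) auto
  have "f px (Suc p) - f px p \<le> f qx (Suc qy) - f qx qy"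
    using hive_slope_x[OF hive_swap[OF assms(1)] p(2,3)] .
  then show ?thesis using p by simp
qed

section \<open>Sup-convolution of hives\<close>

definition sup_conv :: "(nat \<Rightarrow> nat \<Rightarrow> int) \<Rightarrow> (nat \<Rightarrow> nat \<Rightarrow> int) \<Rightarrow> nat \<Rightarrow> nat \<Rightarrow> int" where
  "sup_conv f w x y = Max {f a b + w c d | a b c d. a + c = x \<and> b + d = y}"

lemma finite_sup_conv: "finite {f a b + w c d | a b c d. a + c = x \<and> b + d = (y::nat)}" for x :: nat
proof (rule finite_subset)
  show "{f a b + w c d | a b c d. a + c = x \<and> b + d = y} \<subseteq>
    (\<lambda>(a, b). f a b + w (x - a) (y - b)) ` ({..x} \<times> {..y})"
  proof
    fix v
    assume "v \<in> {f a b + w c d | a b c d. a + c = x \<and> b + d = y}"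
    then obtain a b c d where "v = f a b + w c d" "a + c = x" "b + d = y" by blast
    then show "v \<in> (\<lambda>(a, b). f a b + w (x - a) (y - b)) ` ({..x} \<times> {..y})"
      by (intro image_eqI[where x = "(a, b)"]) auto
  qed
qed auto

lemma sup_conv_ge: "f a b + w c d \<le> sup_conv f w (a + c) (b + d)"
  unfolding sup_conv_def by (intro Max_ge finite_sup_conv) blast

lemma sup_conv_ge': "a + c = x \<Longrightarrow> b + d = y \<Longrightarrow> f a b + w c d \<le> sup_conv f w x y"
  using sup_conv_ge by blast

lemma sup_conv_attained:
  obtains a b c d where "sup_conv f w x y = f a b + w c d" "a + c = x" "b + d = y"
proof -
  have "f 0 0 + w x y \<in> {f a b + w c d | a b c d. a + c = x \<and> b + d = y}" by force
  then have "sup_conv f w x y \<in> {f a b + w c d | a b c d. a + c = x \<and> b + d = y}"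
    unfolding sup_conv_def using Max_in[OF finite_sup_conv] by blast
  then show ?thesis using that by blast
qed

lemma sup_conv_commute: "sup_conv f w = sup_conv w f"
proof -
  have "sup_conv f w x y \<le> sup_conv w f x y" for f w x y
    by (rule sup_conv_attained[of f w x y]) (metis add.commute sup_conv_ge)
  then show ?thesis by (intro ext antisym)
qed

lemma hive_sup_conv:
  assumes "hive f" "hive w"
  shows "hive (sup_conv f w)"
proof -
  let ?h = "sup_conv f w"
  have R2: "sup_conv f w (x + 2) y + sup_conv f w x (y + 1) \<le> sup_conv f w (x + 1) y + sup_conv f w (x + 1) (y + 1)"
    if fg: "hive f" "hive w" for f w x y
  proof -
    let ?h = "sup_conv f w"
    obtain a b c d where 1: "?h (x + 2) y = f a b + w c d" "a + c = x + 2" "b + d = y"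
      by (rule sup_conv_attained)
    obtain a' b' c' d' where 2: "?h x (y + 1) = f a' b' + w c' d'" "a' + c' = x" "b' + d' = y + 1"
      by (rule sup_conv_attained)
    have key: "f a b + w c d + (f a' b' + w c' d') \<le> sup_conv f w (x + 1) y + sup_conv f w (x + 1) (y + 1)"
      if "a' < a" "hive f" "hive w" "a + c = x + 2" "b + d = y" "a' + c' = x" "b' + d' = y + 1"
      for f w a b c d a' b' c' d'
      using hive_exchange_x[OF that(2) that(1), where py = b and qy = b']
    proof
      assume "a + b > a' + b' \<and> f a b + f a' b' \<le> f (a - 1) b + f (a' + 1) b'"
      moreover have "f (a - 1) b + w c d \<le> sup_conv f w (x + 1) y"
        by (rule sup_conv_ge'[where f = f and w = w]) (use that in auto)
      moreover have "f (a' + 1) b' + w c' d' \<le> sup_conv f w (x + 1) (y + 1)"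
        by (rule sup_conv_ge'[where f = f and w = w]) (use that in auto)
      ultimately show ?thesis by linarith
    next
      assume *: "b < b' \<and> f a b + f a' b' \<le> f (a - 1) (b + 1) + f (a' + 1) (b' - 1)"
      moreover have "f (a - 1) (b + 1) + w c d \<le> sup_conv f w (x + 1) (y + 1)"
        by (rule sup_conv_ge'[where f = f and w = w]) (use that in auto)
      moreover have "f (a' + 1) (b' - 1) + w c' d' \<le> sup_conv f w (x + 1) y"
        by (rule sup_conv_ge'[where f = f and w = w]) (use that * in auto)
      ultimately show ?thesis by linarith
    qed
    \<comment> \<open>The two vertices differ by 2 in x, so in one summand the first point exceeds
      the second in x. Either outcome of the exchange in this summand turns the optimal
      decompositions of these vertices into decompositions of the other two vertices of the
      rhombus.\<close>
    have "a' < a \<or> c' < c" using 1 2 by linarith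
    then show ?thesis
    proof
      assume "a' < a"
      then show ?thesis using key[OF _ fg 1(2,3) 2(2,3)] 1(1) 2(1) by simp
    next
      assume "c' < c"
      moreover have "c + a = x + 2" "d + b = y" "c' + a' = x" "d' + b' = y + 1" using 1 2 by auto
      ultimately show ?thesis using key[OF _ fg(2,1)] 1(1) 2(1)
        by (fastforce simp: sup_conv_commute[of w f])
    qed
  qed
  have R3: "?h (x + 1) (y + 1) + ?h x y \<le> ?h x (y + 1) + ?h (x + 1) y" for x y
  proof -
    obtain a b c d where 1: "?h (x + 1) (y + 1) = f a b + w c d" "a + c = x + 1" "b + d = y + 1"
      by (rule sup_conv_attained)
    obtain a' b' c' d' where 2: "?h x y = f a' b' + w c' d'" "a' + c' = x" "b' + d' = y"
      by (rule sup_conv_attained)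
    have key: "f a b + w c d + (f a' b' + w c' d') \<le> sup_conv f w x (y + 1) + sup_conv f w (x + 1) y"
      if "a' + b' < a + b" "hive f" "hive w" "a + c = x + 1" "b + d = y + 1" "a' + c' = x" "b' + d' = y"
      for f w a b c d a' b' c' d'
      using hive_exchange_z[OF that(2) that(1)]
    proof
      assume *: "a > a' \<and> f a b + f a' b' \<le> f (a - 1) b + f (a' + 1) b'"
      moreover have "f (a - 1) b + w c d \<le> sup_conv f w x (y + 1)"
        by (rule sup_conv_ge'[where f = f and w = w]) (use that * in auto)
      moreover have "f (a' + 1) b' + w c' d' \<le> sup_conv f w (x + 1) y"
        by (rule sup_conv_ge'[where f = f and w = w]) (use that in auto)
      ultimately show ?thesis by linarith
    next
      assume *: "b > b' \<and> f a b + f a' b' \<le> f a (b - 1) + f a' (b' + 1)"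
      moreover have "f a (b - 1) + w c d \<le> sup_conv f w (x + 1) y"
        by (rule sup_conv_ge'[where f = f and w = w]) (use that * in auto)
      moreover have "f a' (b' + 1) + w c' d' \<le> sup_conv f w x (y + 1)"
        by (rule sup_conv_ge'[where f = f and w = w]) (use that * in auto)
      ultimately show ?thesis by linarith
    qed
    \<comment> \<open>Here the vertices agree up to a difference of 2 in the third coordinate, and
      the exchange starts from that one.\<close>
    have "a' + b' < a + b \<or> c' + d' < c + d" using 1 2 by linarith
    then show ?thesis
    proof
      assume "a' + b' < a + b"
      then show ?thesis using key[OF _ assms 1(2,3) 2(2,3)] 1(1) 2(1) by simp
    next
      assume "c' + d' < c + d"
      moreover have "c + a = x + 1" "d + b = y + 1" "c' + a' = x" "d' + b' = y" using 1 2 by auto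
      ultimately show ?thesis using key[OF _ assms(2,1)] 1(1) 2(1)
        by (fastforce simp: sup_conv_commute[of w f])
    qed
  qed
  have sw: "sup_conv f w x y = sup_conv (\<lambda>x y. f y x) (\<lambda>x y. w y x) y x" for x y
    unfolding sup_conv_def by (rule arg_cong[where f = Max]) blast
  have R1: "?h x (y + 2) + ?h (x + 1) y \<le> ?h (x + 1) (y + 1) + ?h x (y + 1)" for x y
    using R2[OF hive_swap[OF assms(1)] hive_swap[OF assms(2)], of y x]
    unfolding sw by linarith
  show ?thesis unfolding hive_def using R1 R2[OF assms] R3 by blast
qed

section \<open>Unions of rows\<close>

text \<open>The sides of the hive: \<open>mu\<close> along \<open>x = 0\<close>, \<open>lam\<close>
  along \<open>y = 0\<close>, and \<open>nu\<close> at infinity in the direction of y, where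
  \<open>C\<close> is the size of \<open>mu\<close> if the hive comes from an array. The
  antidiagonal inequality is the nonnegativity of the array. The upper bound by the limit is stated
  explicitly because it is what carries the limit over to sup-convolutions.\<close>

definition hive_for :: "(nat \<Rightarrow> nat) \<Rightarrow> (nat \<Rightarrow> nat) \<Rightarrow> (nat \<Rightarrow> nat) \<Rightarrow> (nat \<Rightarrow> nat \<Rightarrow> int) \<Rightarrow> bool" where
  "hive_for lam mu nu f \<longleftrightarrow> hive f \<and> (\<forall>x y. f x (Suc y) \<le> f (Suc x) y) \<and>
     (\<forall>y. f 0 y = int (sum mu {..<y})) \<and> (\<forall>x. f x 0 = int (sum lam {..<x})) \<and>
     (\<exists>C. (\<forall>x y. f x y \<le> C + int (sum nu {..<x})) \<and>
          (\<forall>x. \<exists>Y. \<forall>y\<ge>Y. f x y = C + int (sum nu {..<x})))"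

lemma hive_for_of_LR:
  assumes "LR lam mu nu" "young mu"
  shows "\<exists>f. hive_for lam mu nu f"
proof -
  obtain a N where a: "lr_array mu a" and s: "\<And>i. sum (a (Suc i)) {..<Suc i} + mu i = sum (a i) {..<i} + lam i"
    and N: "\<And>i. i \<ge> N \<Longrightarrow> a i = nu"
    using assms(1) unfolding LR_def by blast
  obtain M where M: "mu M = 0" "antimono mu" using assms(2) unfolding young_def by blast
  define f where "f x y = int (sum mu {..<x + y}) + int (sum (a (x + y)) {..<x})" for x y
  have m1: "a i k \<le> a (Suc i) k" and m2: "a (Suc i) (Suc k) \<le> a i k"
    and m3: "mu (Suc i) + sum (a (Suc (Suc i))) {..<Suc k} + sum (a i) {..<k}
        \<le> mu i + sum (a (Suc i)) {..<k} + sum (a (Suc i)) {..<Suc k}" for i k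
    using a unfolding lr_array_def by blast+
  have "hive f"
    unfolding hive_def
  proof (intro allI conjI)
    fix x y
    show "f x (y + 2) + f (x + 1) y \<le> f (x + 1) (y + 1) + f x (y + 1)"
      using m1[of "Suc (x + y)" x] unfolding f_def by (simp del: of_nat_sum)
    show "f (x + 2) y + f x (y + 1) \<le> f (x + 1) y + f (x + 1) (y + 1)"
      using m2[of "Suc (x + y)" x] unfolding f_def by (simp del: of_nat_sum)
    show "f (x + 1) (y + 1) + f x y \<le> f x (y + 1) + f (x + 1) y"
      using m3[of "x + y" x] unfolding f_def by (simp del: of_nat_sum)
  qed
  moreover have "f x (Suc y) \<le> f (Suc x) y" for x y
    unfolding f_def by (simp del: of_nat_sum)
  moreover have "f 0 y = int (sum mu {..<y})" for y unfolding f_def by (simp del: of_nat_sum)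
  moreover have "f x 0 = int (sum lam {..<x})" for x
  proof (induction x)
    case (Suc x)
    then show ?case using s[of x] unfolding f_def by (simp del: of_nat_sum)
  qed (simp add: f_def)
  moreover have "f x y \<le> f x (y + t)" for x y t
  proof -
    have "sum mu {..<x + y} \<le> sum mu {..<x + (y + t)}" by (rule sum_mono2) auto
    moreover have "sum (a (x + y)) {..<x} \<le> sum (a (x + (y + t))) {..<x}"
      by (rule sum_mono) (rule lr_array_mono[OF a], simp)
    ultimately show ?thesis unfolding f_def by linarith
  qed
  then have mono: "y \<le> z \<Longrightarrow> f x y \<le> f x z" for x y z
    by (metis le_iff_add)
  have mu: "sum mu {..<i} = sum mu {..<M}" if "i \<ge> M" for i
  proof (rule sum.mono_neutral_right)
    show "\<forall>i\<in>{..<i} - {..<M}. mu i = 0"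
      using M(1) antimonoD[OF M(2)] by (metis DiffE le_zero_eq lessThan_iff not_less)
  qed (use that in auto)
  have lim: "f x y = int (sum mu {..<M}) + int (sum nu {..<x})" if "y \<ge> max M N" for x y
    using that mu[of "x + y"] N[of "x + y"] unfolding f_def by (simp del: of_nat_sum)
  moreover have "f x y \<le> int (sum mu {..<M}) + int (sum nu {..<x})" for x y
    using mono[of y "max y (max M N)" x] lim[of "max y (max M N)" x] by simp
  ultimately show ?thesis unfolding hive_for_def by blast
qed

lemma LR_of_hive_for:
  assumes "hive_for lam mu nu f" "young lam" "young nu"
  shows "LR lam mu nu"
proof -
  have f: "hive f" and diag: "\<And>x y. f x (Suc y) \<le> f (Suc x) y"
    and fmu: "\<And>y. f 0 y = int (sum mu {..<y})" and flam: "\<And>x. f x 0 = int (sum lam {..<x})"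
    using assms(1) unfolding hive_for_def by blast+
  obtain C Y where lim: "\<And>x y. y \<ge> Y x \<Longrightarrow> f x y = C + int (sum nu {..<x})"
    using assms(1) unfolding hive_for_def by metis
  have R1: "f x (Suc (Suc y)) + f (Suc x) y \<le> f (Suc x) (Suc y) + f x (Suc y)"
    and R2: "f (Suc (Suc x)) y + f x (Suc y) \<le> f (Suc x) y + f (Suc x) (Suc y)"
    and R3: "f (Suc x) (Suc y) + f x y \<le> f x (Suc y) + f (Suc x) y" for x y
    using f unfolding hive_def by simp_all
  \<comment> \<open>The array is recovered from antidiagonal differences: \<open>a i k\<close>
    belongs to the edge between \<open>(k, i - k)\<close> and
    \<open>(k + 1, i - k - 1)\<close>.\<close>
  define a where "a i k = (if k < i then nat (f (Suc k) (i - Suc k) - f k (i - k)) else 0)" for i k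
  have a: "int (a (Suc (x + y)) x) = f (Suc x) y - f x (Suc y)" for x y
    using diag[of x y] unfolding a_def by (simp add: Suc_diff_le)
  have psum: "int (sum (a (x + y)) {..<x}) = f x y - f 0 (x + y)" for x y
  proof (induction x arbitrary: y)
    case (Suc x)
    show ?case using Suc.IH[of "Suc y"] a[of x y] by (simp del: of_nat_sum)
  qed simp
  have psum': "sum (a i) {..<k} = sum (a i) {..<i}" if "i \<le> k" for i k
    by (rule sum.mono_neutral_right) (use that in \<open>auto simp: a_def\<close>)
  have tot: "int (sum (a i) {..<i}) = int (sum lam {..<i}) - int (sum mu {..<i})" for i
    using psum[of i 0] flam fmu by (simp del: of_nat_sum)
  have arr: "lr_array mu a"
    unfolding lr_array_def
  proof (intro conjI allI)
    fix k show "a 0 k = 0" unfolding a_def by (simp del: of_nat_sum)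
  next
    fix i k
    show "a i k \<le> a (Suc i) k"
    proof (cases "k < i")
      case True
      define y where "y = i - Suc k"
      have y: "i = Suc (k + y)" using True unfolding y_def by (simp del: of_nat_sum)
      have "int (a i k) \<le> int (a (Suc i) k)"
        using a[of k y] a[of k "Suc y"] R1[of k y] unfolding y by (simp del: of_nat_sum)
      then show ?thesis by (simp del: of_nat_sum)
    qed (simp add: a_def)
    show "a (Suc i) (Suc k) \<le> a i k"
    proof (cases "k < i")
      case True
      define y where "y = i - Suc k"
      have y: "i = Suc (k + y)" using True unfolding y_def by (simp del: of_nat_sum)
      have "int (a (Suc i) (Suc k)) \<le> int (a i k)"
        using a[of k y] a[of "Suc k" y] R2[of k y] unfolding y by (simp del: of_nat_sum)
      then show ?thesis by (simp del: of_nat_sum)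
    qed (simp add: a_def)
    show "mu (Suc i) + sum (a (Suc (Suc i))) {..<Suc k} + sum (a i) {..<k}
      \<le> mu i + sum (a (Suc i)) {..<k} + sum (a (Suc i)) {..<Suc k}"
    proof (cases "k \<le> i")
      case True
      define y where "y = i - k"
      have y: "i = k + y" using True unfolding y_def by (simp del: of_nat_sum)
      have "int (mu (Suc i)) + int (sum (a (Suc (Suc i))) {..<Suc k}) + int (sum (a i) {..<k})
        \<le> int (mu i) + int (sum (a (Suc i)) {..<k}) + int (sum (a (Suc i)) {..<Suc k})"
        using psum[of "Suc k" "Suc y"] psum[of k y] psum[of k "Suc y"] psum[of "Suc k" y] R3[of k y]
          fmu[of i] fmu[of "Suc i"] fmu[of "Suc (Suc i)"]
        unfolding y by (simp del: of_nat_sum)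
      then show ?thesis by linarith
    next
      case False
      \<comment> \<open>For \<open>k > i\<close> no rhombus of the quadrant corresponds to the
        inequality. All sums are then complete, and it reduces to
        \<open>lam (i + 1) <= lam i\<close>.\<close>
      have "lam (Suc i) \<le> lam i" using assms(2) unfolding young_def by (simp add: antimonoD)
      then show ?thesis
        using tot[of i] tot[of "Suc i"] tot[of "Suc (Suc i)"] psum'[of i k] psum'[of "Suc i" k]
          psum'[of "Suc i" "Suc k"] psum'[of "Suc (Suc i)" "Suc k"] False by (simp del: of_nat_sum)
    qed
  qed
  have "sum (a (Suc i)) {..<Suc i} + mu i = sum (a i) {..<i} + lam i" for i
    using tot[of i] tot[of "Suc i"] by (simp del: of_nat_sum)
  moreover have "\<exists>N. \<forall>i\<ge>N. a i = nu"
  proof -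
    obtain K where K: "nu K = 0" "antimono nu" using assms(3) unfolding young_def by blast
    have K': "nu k = 0" if "k \<ge> K" for k using K(1) antimonoD[OF K(2) that] by (simp del: of_nat_sum)
    \<comment> \<open>The limit in y need not be uniform in x, but finitely many columns suffice:
      \<open>nu\<close> vanishes from \<open>K\<close> on, and since \<open>a i\<close> is antitone,
      \<open>a i K = 0\<close> makes it vanish there, too.\<close>
    define N where "N = Suc K + Max (Y ` {..Suc K})"
    have "a i = nu" if i: "i \<ge> N" for i
    proof
      fix k
      have le: "a i k = nu k" if k: "k \<le> K" for k
      proof -
        define y where "y = i - Suc k"
        have y: "i = Suc (k + y)" using i k unfolding y_def N_def by (simp del: of_nat_sum)
        have "Y k \<le> Max (Y ` {..Suc K})" "Y (Suc k) \<le> Max (Y ` {..Suc K})" using k by auto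
        then have "Y k \<le> y" "Y (Suc k) \<le> y" using i k y unfolding N_def by linarith+
        then show ?thesis using a[of k y] lim[of k "Suc y"] lim[of "Suc k" y] unfolding y by (simp del: of_nat_sum)
      qed
      show "a i k = nu k"
      proof (cases "k \<le> K")
        case False
        then have "a i k \<le> a i K" using antimonoD[OF lr_array_antimono[OF arr]] by (simp del: of_nat_sum)
        then show ?thesis using le[of K] K(1) K'[of k] False by (simp del: of_nat_sum)
      qed (rule le)
    qed
    then show ?thesis by blast
  qed
  ultimately show ?thesis using arr unfolding LR_def by blast
qed

text \<open>For decreasing sequences, the first \<open>k\<close> parts of the merged sequence have
  as their sum the maximum, over all \<open>m + n = k\<close>, of the first \<open>m\<close> parts
  of \<open>u\<close> plus the first \<open>n\<close> parts of \<open>v\<close>. Merging is thus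
  sup-convolution of partial sums, which are the boundary values of hives.\<close>

definition is_union :: "(nat \<Rightarrow> nat) \<Rightarrow> (nat \<Rightarrow> nat) \<Rightarrow> (nat \<Rightarrow> nat) \<Rightarrow> bool" where
  "is_union u v w \<longleftrightarrow> (\<forall>m n. sum u {..<m} + sum v {..<n} \<le> sum w {..<m + n}) \<and>
     (\<forall>k. \<exists>m n. m + n = k \<and> sum w {..<k} = sum u {..<m} + sum v {..<n})"

lemma hive_for_sup_conv:
  assumes f: "hive_for lam1 mu1 nu1 f" and h: "hive_for lam2 mu2 nu2 h"
    and lam: "is_union lam1 lam2 lam" and mu: "is_union mu1 mu2 mu" and nu: "is_union nu1 nu2 nu"
  shows "hive_for lam mu nu (sup_conv f h)"
proof -
  let ?s = "sup_conv f h"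
  obtain C Y where C: "\<And>x y. f x y \<le> C + int (sum nu1 {..<x})"
    and Y: "\<And>x y. y \<ge> Y x \<Longrightarrow> f x y = C + int (sum nu1 {..<x})"
    using f unfolding hive_for_def by metis
  obtain D Z where D: "\<And>x y. h x y \<le> D + int (sum nu2 {..<x})"
    and Z: "\<And>x y. y \<ge> Z x \<Longrightarrow> h x y = D + int (sum nu2 {..<x})"
    using h unfolding hive_for_def by metis
  have "hive ?s" using hive_sup_conv f h unfolding hive_for_def by blast
  moreover have "?s x (Suc y) \<le> ?s (Suc x) y" for x y
  proof (rule sup_conv_attained[of f h x "Suc y"])
    fix a b c d
    assume *: "?s x (Suc y) = f a b + h c d" "a + c = x" "b + d = Suc y"
    show ?thesis
    proof (cases b)
      case 0
      then obtain d' where d: "d = Suc d'" using * by simp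
      have "h c d \<le> h (Suc c) d'" using h unfolding hive_for_def d by blast
      moreover have "f a b + h (Suc c) d' \<le> ?s (Suc x) y"
        by (rule sup_conv_ge') (use * 0 d in auto)
      ultimately show ?thesis using *(1) by linarith
    next
      case (Suc b')
      have "f a b \<le> f (Suc a) b'" using f unfolding hive_for_def Suc by blast
      moreover have "f (Suc a) b' + h c d \<le> ?s (Suc x) y"
        by (rule sup_conv_ge'[where f = f]) (use * Suc in auto)
      ultimately show ?thesis using *(1) by linarith
    qed
  qed
  moreover have "?s 0 y = int (sum mu {..<y})" for y
  proof (rule antisym)
    show "?s 0 y \<le> int (sum mu {..<y})"
    proof (rule sup_conv_attained[of f h 0 y])
      fix a b c d
      assume *: "?s 0 y = f a b + h c d" "a + c = 0" "b + d = y"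
      then have "?s 0 y = int (sum mu1 {..<b} + sum mu2 {..<d})"
        using f h unfolding hive_for_def by (simp del: of_nat_sum)
      moreover have "sum mu1 {..<b} + sum mu2 {..<d} \<le> sum mu {..<y}"
        using mu * unfolding is_union_def by blast
      ultimately show ?thesis by linarith
    qed
    obtain m n where mn: "m + n = y" "sum mu {..<y} = sum mu1 {..<m} + sum mu2 {..<n}"
      using mu unfolding is_union_def by blast
    then show "int (sum mu {..<y}) \<le> ?s 0 y"
      using sup_conv_ge'[of 0 0 0 m n y f h] f h unfolding hive_for_def by simp
  qed
  moreover have "?s x 0 = int (sum lam {..<x})" for x
  proof (rule antisym)
    show "?s x 0 \<le> int (sum lam {..<x})"
    proof (rule sup_conv_attained[of f h x 0])
      fix a b c d
      assume *: "?s x 0 = f a b + h c d" "a + c = x" "b + d = 0"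
      then have "?s x 0 = int (sum lam1 {..<a} + sum lam2 {..<c})"
        using f h unfolding hive_for_def by (simp del: of_nat_sum)
      moreover have "sum lam1 {..<a} + sum lam2 {..<c} \<le> sum lam {..<x}"
        using lam * unfolding is_union_def by blast
      ultimately show ?thesis by linarith
    qed
    obtain m n where mn: "m + n = x" "sum lam {..<x} = sum lam1 {..<m} + sum lam2 {..<n}"
      using lam unfolding is_union_def by blast
    then show "int (sum lam {..<x}) \<le> ?s x 0"
      using sup_conv_ge'[of m n x 0 0 0 f h] f h unfolding hive_for_def by simp
  qed
  moreover have up: "?s x y \<le> C + D + int (sum nu {..<x})" for x y
  proof (rule sup_conv_attained[of f h x y])
    fix a b c d
    assume *: "?s x y = f a b + h c d" "a + c = x" "b + d = y"
    have "sum nu1 {..<a} + sum nu2 {..<c} \<le> sum nu {..<x}"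
      using nu *(2) unfolding is_union_def by blast
    then show ?thesis using *(1) C[of a b] D[of c d] by linarith
  qed
  moreover have "\<exists>Y. \<forall>y\<ge>Y. ?s x y = C + D + int (sum nu {..<x})" for x
  proof -
    obtain m n where mn: "m + n = x" "sum nu {..<x} = sum nu1 {..<m} + sum nu2 {..<n}"
      using nu unfolding is_union_def by blast
    have "?s x y = C + D + int (sum nu {..<x})" if "y \<ge> Y m + Z n" for y
    proof (rule antisym[OF up])
      have "f m (Y m) + h n (y - Y m) \<le> ?s x y"
        by (rule sup_conv_ge') (use that mn in auto)
      then show "C + D + int (sum nu {..<x}) \<le> ?s x y"
        using Y[of m "Y m"] Z[of n "y - Y m"] that mn(2) by simp
    qed
    then show ?thesis by blast
  qed
  ultimately show ?thesis unfolding hive_for_def by blast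
qed

theorem LR_union:
  assumes "LR lam1 mu1 nu1" "LR lam2 mu2 nu2" "young mu1" "young mu2" "young lam" "young nu"
    and "is_union lam1 lam2 lam" "is_union mu1 mu2 mu" "is_union nu1 nu2 nu"
  shows "LR lam mu nu"
  using hive_for_of_LR[OF assms(1,3)] hive_for_of_LR[OF assms(2,4)] hive_for_sup_conv[OF _ _ assms(7-9)]
    LR_of_hive_for[OF _ assms(5,6)] by blast

text \<open>Insertion of a part \<open>c\<close> into a decreasing sequence: the value at
  \<open>i + 1\<close> is the median of \<open>c\<close>, \<open>f i\<close> and
  \<open>f (i + 1)\<close>, which is \<open>f (i + 1)\<close> before the place of \<open>c\<close>,
  \<open>c\<close> at this place and \<open>f i\<close> after it.\<close>

definition ins :: "nat \<Rightarrow> (nat \<Rightarrow> nat) \<Rightarrow> nat \<Rightarrow> nat" where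
  "ins c f k = (case k of 0 \<Rightarrow> max c (f 0) | Suc i \<Rightarrow> max (min c (f i)) (f (Suc i)))"

lemma ins_0 [simp]: "ins c f 0 = max c (f 0)"
  and ins_Suc [simp]: "ins c f (Suc i) = max (min c (f i)) (f (Suc i))"
  by (simp_all add: ins_def)

definition two_rows :: "nat \<Rightarrow> nat \<Rightarrow> nat \<Rightarrow> nat" where
  "two_rows a b k = (if k = 0 then a else if k = 1 then b else 0)"

lemma sum_two_rows: "sum (two_rows a b) {..<n} = (if n = 0 then 0 else if n = 1 then a else a + b)"
proof (cases "n \<le> 1")
  case False
  then have "sum (two_rows a b) {..<n} = sum (two_rows a b) {..<2}"
    by (intro sum.mono_neutral_right) (auto simp: two_rows_def)
  then show ?thesis using False by (simp add: two_rows_def numeral_2_eq_2)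
qed (auto simp: two_rows_def le_Suc_eq)

lemma antimono_SucI: "(\<And>i. f (Suc i) \<le> f i) \<Longrightarrow> antimono (f :: nat \<Rightarrow> nat)"
  by (metis antimonoI lift_Suc_antimono_le)

lemma young_two_rows: "b \<le> a \<Longrightarrow> young (two_rows a b)"
  unfolding young_def by (auto intro!: antimono_SucI exI[of _ 2] simp: two_rows_def)

lemma youngD: "young f \<Longrightarrow> i \<le> j \<Longrightarrow> f j \<le> f i"
  unfolding young_def by (simp add: antimonoD)

lemma young_ins: assumes "young f" shows "young (ins c f)"
proof -
  obtain n where "f n = 0" using assms unfolding young_def by blast
  then have "ins c f (Suc n) = 0" using youngD[OF assms, of n "Suc n"] by simp
  moreover have "ins c f (Suc i) \<le> ins c f i" for i
  proof (cases i)
    case 0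
    then show ?thesis using youngD[OF assms, of 0 1] by auto
  next
    case (Suc j)
    then show ?thesis using youngD[OF assms, of j "Suc j"] youngD[OF assms, of "Suc j" "Suc (Suc j)"] by auto
  qed
  ultimately show ?thesis unfolding young_def using antimono_SucI by blast
qed

lemma sum_ins: "young f \<Longrightarrow> sum (ins c f) {..<Suc n} = sum f {..<n} + max c (f n)"
proof (induction n)
  case (Suc n)
  then show ?case using youngD[OF Suc.prems, of n "Suc n"] by (auto simp: max_def min_def)
qed simp

lemma is_union_row: 
  assumes "young f"
  shows "is_union f (two_rows c 0) (ins c f)"
  unfolding is_union_def
proof (intro conjI allI)
  fix m n
  have "sum f {..<m} \<le> sum (ins c f) {..<m}" 
    using sum_ins[OF assms, of c "m - 1"] by (cases m) auto
  also have "\<dots> \<le> sum (ins c f) {..<m + n}" by (rule sum_mono2) auto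
  finally have 1: "sum f {..<m} \<le> sum (ins c f) {..<m + n}" .
  have 2: "sum (ins c f) {..<Suc m} \<le> sum (ins c f) {..<m + n}" if "n \<noteq> 0"
    by (rule sum_mono2) (use that in auto)
  show "sum f {..<m} + sum (two_rows c 0) {..<n} \<le> sum (ins c f) {..<m + n}"
    using 1 2 sum_ins[OF assms, of c m] by (auto simp: sum_two_rows)
next
  fix k
  show "\<exists>m n. m + n = k \<and> sum (ins c f) {..<k} = sum f {..<m} + sum (two_rows c 0) {..<n}"
  proof (cases k)
    case 0
    then show ?thesis by auto
  next
    case (Suc k')
    show ?thesis
    proof (cases "c \<le> f k'")
      case True
      then show ?thesis using sum_ins[OF assms, of c k'] Suc
        by (intro exI[of _ k] exI[of _ 0]) (auto simp: max_def)
    next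
      case False
      then show ?thesis using sum_ins[OF assms, of c k'] Suc
        by (intro exI[of _ k'] exI[of _ 1]) (auto simp: max_def two_rows_def)
    qed
  qed
qed

lemma is_union_two_rows:
  assumes "young f" "b \<le> a"
  shows "is_union f (two_rows a b) (ins a (ins b f))"
proof -
  let ?u = "ins b f" let ?w = "ins a (ins b f)"
  have u: "is_union f (two_rows b 0) ?u" using is_union_row assms by blast
  have w: "is_union ?u (two_rows a 0) ?w" using is_union_row young_ins assms by blast
  have le: "sum f {..<m} + sum (two_rows a b) {..<n} \<le> sum ?w {..<m + n}" for m n
  proof -
    have "sum f {..<m} + sum (two_rows b 0) {..<0} \<le> sum ?u {..<m + 0}"
      using u unfolding is_union_def by blast
    moreover have "sum ?u {..<m} + sum (two_rows a 0) {..<n} \<le> sum ?w {..<m + n}"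
      using w unfolding is_union_def by blast
    moreover have "sum f {..<m} + sum (two_rows b 0) {..<1} \<le> sum ?u {..<m + 1}"
      using u unfolding is_union_def by blast
    moreover have "sum ?u {..<m + 1} + sum (two_rows a 0) {..<n - 1} \<le> sum ?w {..<m + 1 + (n - 1)}"
      using w unfolding is_union_def by blast
    ultimately show ?thesis unfolding sum_two_rows by (cases n) (auto split: if_splits)
  qed
  moreover have "\<exists>m n. m + n = k \<and> sum ?w {..<k} = sum f {..<m} + sum (two_rows a b) {..<n}" for k
  proof -
    obtain m n where 1: "m + n = k" "sum ?w {..<k} = sum ?u {..<m} + sum (two_rows a 0) {..<n}"
      using w unfolding is_union_def by blast
    obtain m' n' where 2: "m' + n' = m" "sum ?u {..<m} = sum f {..<m'} + sum (two_rows b 0) {..<n'}"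
      using u unfolding is_union_def by blast
    \<comment> \<open>If the optimal choice takes only one of the two rows and this is
      \<open>b\<close>, then taking \<open>a\<close> instead is at least as good.\<close>
    have "sum ?w {..<k} \<le> sum f {..<m'} + sum (two_rows a b) {..<n' + n}"
      using 1 2 assms(2) by (auto simp: sum_two_rows split: if_splits)
    moreover have "m' + (n' + n) = k" using 1 2 by simp
    ultimately show ?thesis using le[of m' "n' + n"] by (metis antisym)
  qed
  ultimately show ?thesis unfolding is_union_def by blast
qed

section \<open>Conjugation, deletion of rows and columns, insertion of a box\<close>

text \<open>The column lengths. Everything below rests on the Galois connection between
  \<open>i < conjugate f j\<close> and \<open>j < f i\<close>, which is symmetric in rows and
  columns.\<close>

definition conjugate :: "(nat \<Rightarrow> nat) \<Rightarrow> nat \<Rightarrow> nat" where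
  "conjugate f j = (LEAST i. f i \<le> j)"

lemma less_conjugate_iff:
  assumes "young f"
  shows "i < conjugate f j \<longleftrightarrow> j < f i"
proof
  assume "i < conjugate f j"
  then show "j < f i" unfolding conjugate_def using not_less_Least by (metis not_le)
next
  assume j: "j < f i"
  obtain n where "f n = 0" using assms unfolding young_def by blast
  then have "f (conjugate f j) \<le> j" unfolding conjugate_def by (metis LeastI le0)
  then show "i < conjugate f j" using youngD[OF assms, of "conjugate f j" i] j by (meson leD leI le_trans)
qed

lemma conjugate_le_iff: "young f \<Longrightarrow> conjugate f j \<le> i \<longleftrightarrow> f i \<le> j"
  using less_conjugate_iff by (metis not_le)

lemma conjugate_mono:
  assumes "young mu" "young lam" "\<And>i. mu i \<le> lam i"
  shows "conjugate mu j \<le> conjugate lam j"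
proof -
  have "lam (conjugate lam j) \<le> j" using conjugate_le_iff[OF assms(2)] by blast
  then show ?thesis using conjugate_le_iff[OF assms(1)] assms(3) order_trans by blast
qed

lemma eq_if_less_iff: "(\<And>i. i < m \<longleftrightarrow> i < n) \<Longrightarrow> m = (n :: nat)"
  by (metis linorder_neqE_nat less_irrefl)

lemma young_conjugate: assumes "young f" shows "young (conjugate f)"
proof -
  have "antimono (conjugate f)"
  proof (rule antimonoI, rule ccontr)
    fix i j assume "i \<le> j" "\<not> conjugate f j \<le> conjugate f i"
    then have "i < f (conjugate f i)" using less_conjugate_iff[OF assms] by (meson le_less_trans not_le)
    then show False using less_conjugate_iff[OF assms] by blast
  qed
  moreover have "conjugate f (f 0) = 0" using less_conjugate_iff[OF assms] by (metis less_irrefl neq0_conv)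
  ultimately show ?thesis unfolding young_def by blast
qed

lemma conjugate_conjugate [simp]: "young f \<Longrightarrow> conjugate (conjugate f) = f"
  by (intro ext eq_if_less_iff) (simp add: less_conjugate_iff young_conjugate)

lemma conjugate_eqI: "young f \<Longrightarrow> (\<And>i. j < f i \<longleftrightarrow> i < n) \<Longrightarrow> conjugate f j = n"
  by (rule eq_if_less_iff) (simp add: less_conjugate_iff)

lemma conjugate_inject: "young f \<Longrightarrow> young f' \<Longrightarrow> conjugate f = conjugate f' \<longleftrightarrow> f = f'"
  by (metis conjugate_conjugate)

lemma conjugate_ins:
  assumes "young f"
  shows "conjugate (ins c f) j = conjugate f j + (if j < c then 1 else 0)"
proof (rule conjugate_eqI[OF young_ins[OF assms]])
  fix i
  show "j < ins c f i \<longleftrightarrow> i < conjugate f j + (if j < c then 1 else 0)"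
  proof (cases i)
    case 0
    then show ?thesis using less_conjugate_iff[OF assms, of 0 j] by auto
  next
    case (Suc k)
    then show ?thesis
      using less_conjugate_iff[OF assms, of k j] less_conjugate_iff[OF assms, of "Suc k" j] youngD[OF assms, of k "Suc k"]
      by (auto simp: less_max_iff_disj)
  qed
qed

lemma ins_zero: "young f \<Longrightarrow> ins 0 f = f"
  using conjugate_inject[OF young_ins] conjugate_ins by (metis add.right_neutral ext not_less_zero)

text \<open>Inserting \<open>c\<close> lengthens exactly the first \<open>c\<close> columns by one,
  whatever \<open>f\<close> is, so the column lengths of \<open>f\<close> can be read off from the
  result.\<close>

lemma inj_ins: assumes "young f" "young f'" "ins c f = ins c f'" shows "f = f'"
proof -
  have "conjugate f j = conjugate f' j" for j
    using conjugate_ins[OF assms(1), of c j] conjugate_ins[OF assms(2), of c j] assms(3) by auto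
  then show ?thesis using conjugate_inject assms by blast
qed

section \<open>Deletion of rows and columns\<close>

definition del :: "nat \<Rightarrow> (nat \<Rightarrow> nat) \<Rightarrow> nat \<Rightarrow> nat" where
  "del i f k = (if k < i then f k else f (Suc k))"

definition cdel :: "nat \<Rightarrow> (nat \<Rightarrow> nat) \<Rightarrow> nat \<Rightarrow> nat" where
  "cdel j f i = (if j < f i then f i - 1 else f i)"

lemma young_del: assumes "young f" shows "young (del i f)"
  unfolding young_def
proof
  show "antimono (del i f)"
    by (rule antimonoI) (auto simp: del_def intro: youngD[OF assms])
  obtain n where "f n = 0" using assms unfolding young_def by blast
  then have "f (Suc (n + i)) = 0" using youngD[OF assms, of n "Suc (n + i)"] by simp
  then show "\<exists>n. del i f n = 0" by (intro exI[of _ "n + i"]) (simp add: del_def)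
qed

lemma young_cdel: assumes "young f" shows "young (cdel j f)"
  unfolding young_def
proof
  show "antimono (cdel j f)"
  proof (rule antimonoI)
    fix i k :: nat assume "i \<le> k"
    then show "cdel j f k \<le> cdel j f i" using youngD[OF assms, of i k] by (auto simp: cdel_def)
  qed
  obtain n where "f n = 0" using assms unfolding young_def by blast
  then show "\<exists>n. cdel j f n = 0" by (intro exI[of _ n]) (simp add: cdel_def)
qed

lemma conjugate_del: assumes "young f" shows "conjugate (del i f) = cdel i (conjugate f)"
proof
  fix j show "conjugate (del i f) j = cdel i (conjugate f) j"
  proof (rule conjugate_eqI[OF young_del[OF assms]])
    fix k
    have "k < conjugate f j \<longleftrightarrow> j < f k" "Suc k < conjugate f j \<longleftrightarrow> j < f (Suc k)" "i < conjugate f j \<longleftrightarrow> j < f i"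
      using less_conjugate_iff[OF assms] by blast+
    then show "j < del i f k \<longleftrightarrow> k < cdel i (conjugate f) j"
      by (auto simp: del_def cdel_def)
  qed
qed

lemma conjugate_cdel: "young f \<Longrightarrow> conjugate (cdel j f) = del j (conjugate f)"
  using conjugate_del[of "conjugate f" j] by (metis conjugate_conjugate young_conjugate young_del)

lemma ins_del: assumes "young f" shows "ins (f i) (del i f) = f"
proof -
  have "conjugate (ins (f i) (del i f)) j = conjugate f j" for j
    using less_conjugate_iff[OF assms, of i j]
    by (auto simp: conjugate_ins young_del conjugate_del cdel_def assms)
  then have "conjugate (ins (f i) (del i f)) = conjugate f" ..
  then show ?thesis by (simp add: conjugate_inject young_ins young_del assms)
qed

definition column :: "nat \<Rightarrow> nat \<Rightarrow> nat" where
  "column a i = (if i < a then 1 else 0)"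

lemma young_column: "young (column a)"
  unfolding young_def by (auto intro!: antimonoI exI[of _ a] simp: column_def)

lemma cdel_plus_column:
  assumes "young f"
  shows "cdel j f i + column (conjugate f j) i = f i"
  using less_conjugate_iff[OF assms, of i j] by (auto simp: cdel_def column_def)

lemma LR_zero: "LR (\<lambda>_. 0) (\<lambda>_. 0) (\<lambda>_. 0)"
  unfolding LR_def by (rule exI[of _ "\<lambda>_ _. 0"]) (simp add: lr_array_def)

lemma LR_row:
  assumes "b \<le> a"
  shows "LR (two_rows a 0) (two_rows b 0) (two_rows (a - b) 0)"
  unfolding LR_def
proof (intro exI conjI allI impI)
  let ?a = "\<lambda>i. if i = 0 then (\<lambda>_. 0) else two_rows (a - b) 0"
  show "lr_array (two_rows b 0) ?a"
    unfolding lr_array_def by (auto simp: two_rows_def sum_two_rows)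
  show "sum (?a (Suc i)) {..<Suc i} + two_rows b 0 i = sum (?a i) {..<i} + two_rows a 0 i" for i
    using assms by (auto simp: sum_two_rows two_rows_def)
  fix i :: nat assume "1 \<le> i"
  then show "?a i = two_rows (a - b) 0" by simp
qed

lemma sum_column: "sum (column a) {..<n} = min a n"
proof (induction n)
  case (Suc n)
  then show ?case by (auto simp: column_def)
qed simp

lemma LR_column:
  assumes "b \<le> a"
  shows "LR (column a) (column b) (column (a - b))"
  unfolding LR_def
proof (intro exI conjI allI impI)
  let ?a = "\<lambda>i. column (min i a - b)"
  show "lr_array (column b) ?a"
    unfolding lr_array_def sum_column using assms by (auto simp: column_def min_def)
  show "sum (?a (Suc i)) {..<Suc i} + column b i = sum (?a i) {..<i} + column a i" for i
    unfolding sum_column using assms by (auto simp: column_def min_def)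
  show "?a i = column (a - b)" if "i \<ge> a" for i using that by (simp add: min_def)
qed

lemma LR_add_column:
  assumes "LR (cdel i lam) (cdel j mu) nu" "young lam" "young mu" "conjugate mu j \<le> conjugate lam i"
  shows "LR lam mu (\<lambda>k. nu k + column (conjugate lam i - conjugate mu j) k)"
  using LR_plus[OF assms(1) LR_column[OF assms(4)]] assms(2,3) by (simp add: cdel_plus_column)

lemma LR_add_row:
  assumes "LR (del i lam) (del j mu) nu" "young lam" "young mu" "mu j \<le> lam i"
  shows "LR lam mu (ins (lam i - mu j) nu)"
proof -
  have nu: "young nu" using LR_young assms(1) .
  have "is_union (del i lam) (two_rows (lam i) 0) lam"
    using is_union_row[OF young_del[OF assms(2), of i], of "lam i"] by (simp add: ins_del assms(2))
  moreover have "is_union (del j mu) (two_rows (mu j) 0) mu"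
    using is_union_row[OF young_del[OF assms(3), of j], of "mu j"] by (simp add: ins_del assms(3))
  ultimately show ?thesis
    using LR_union[OF assms(1) LR_row[OF assms(4)] young_del[OF assms(3)] young_two_rows assms(2) young_ins[OF nu]]
      is_union_row[OF nu] by simp
qed

lemma young_eq_zero: "young f \<Longrightarrow> f 0 = 0 \<Longrightarrow> f = (\<lambda>_. 0)"
  using youngD by (metis ext le0 le_zero_eq)

text \<open>Peeling off first columns reduces everything to the empty diagram. The result supplies
  the component of one factor that is held fixed while the components of the other factor are
  counted.\<close>

lemma ex_LR:
  assumes "young lam" "young mu" "\<And>i. mu i \<le> lam i"
  shows "\<exists>nu. LR lam mu nu"
  using assms
proof (induction "lam 0" arbitrary: lam mu)
  case 0
  then have "lam = (\<lambda>_. 0)" "mu = (\<lambda>_. 0)" using young_eq_zero by (metis le_zero_eq)+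
  then show ?case using LR_zero by blast
next
  case (Suc m)
  have "cdel 0 mu i \<le> cdel 0 lam i" for i using Suc.prems(3)[of i] by (auto simp: cdel_def)
  moreover have "m = cdel 0 lam 0" using Suc.hyps(2) by (simp add: cdel_def flip: Suc.hyps(2))
  ultimately obtain nu where "LR (cdel 0 lam) (cdel 0 mu) nu"
    using Suc.hyps(1) young_cdel Suc.prems(1,2) by blast
  moreover have "conjugate mu 0 \<le> conjugate lam 0" by (rule conjugate_mono) (use Suc.prems in auto)
  ultimately show ?case using LR_add_column Suc.prems by blast
qed

text \<open>The pointer \<open>r i\<close> is the row in which the extra box sits after the first \<open>i\<close> rows of the
  skew diagram have been read; it is traced backwards from its final position.\<close>

theorem LR_insert_box:
  assumes LR: "LR lam mu nu" and young: "young lam"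
    and nu': "r = 0 \<or> nu r < nu (r - 1)"
    and mu_top: "\<And>i. i < t \<Longrightarrow> h \<le> mu i" and lam_bot: "lam t \<le> h"
  shows "LR (\<lambda>i. if i < t then Suc (lam i) else if i = t then Suc h else lam (i - 1))
            (\<lambda>i. if i < t then Suc (mu i) else if i = t then h else mu (i - 1))
            (nu(r := Suc (nu r)))" (is "LR ?lam ?mu _")
proof -
  obtain a N where a: "lr_array mu a" and s: "\<And>i. sum (a (Suc i)) {..<Suc i} + mu i = sum (a i) {..<i} + lam i"
    and N: "\<And>i. i \<ge> N \<Longrightarrow> a i = nu"
    using LR unfolding LR_def by blast
  have m1: "a i k \<le> a (Suc i) k" and m2: "a (Suc i) (Suc k) \<le> a i k"
    and m3: "mu (Suc i) + sum (a (Suc (Suc i))) {..<Suc k} + sum (a i) {..<k}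
        \<le> mu i + sum (a (Suc i)) {..<k} + sum (a (Suc i)) {..<Suc k}" and a0: "a 0 k = 0" for i k
    using a unfolding lr_array_def by blast+
  \<comment> \<open>If the extra box is in row \<open>p\<close> after \<open>i + 1\<close> rows, the
    lattice condition asks for \<open>a (Suc i) p + 1\<close> boxes in row \<open>p - 1\<close>
    after \<open>i\<close> rows. When \<open>a (Suc i) p = a i (p - 1)\<close>, this forces the
    extra box to have been in row \<open>p - 1\<close>; otherwise the pointer can stay.\<close>
  define step where "step i p = (if p \<noteq> 0 \<and> a (Suc i) p = a i (p - 1) then p - 1 else p)" for i p
  define rr where "rr = rec_nat r (\<lambda>j p. step (N - Suc j) p)"
  define R where "R i = rr (N - i)" for i
  have R_lt: "R i = step i (R (Suc i))" if "i < N" for i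
  proof -
    have "N - i = Suc (N - Suc i)" "N - Suc (N - Suc i) = i" using that by simp_all
    then show ?thesis unfolding R_def rr_def by simp
  qed
  have R_ge: "R i = r" if "i \<ge> N" for i using that unfolding R_def rr_def by simp
  have step: "R i = step i (R (Suc i))" for i
  proof (cases "i < N")
    case False
    then show ?thesis using R_ge[of i] R_ge[of "Suc i"] N[of i] N[of "Suc i"] nu' by (auto simp: step_def)
  qed (rule R_lt)
  have inv: "R i = 0 \<or> a i (R i) < a i (R i - 1)" for i
  proof (cases "i < N")
    case False
    then show ?thesis using R_ge[of i] N[of i] nu' by simp
  next
    case True
    then have "i \<le> N" by simp
    then show ?thesis
    proof (induction rule: inc_induct)
      case base
      then show ?case using R_ge[of N] N[of N] nu' by simp
    next
      case (step i)
      let ?p = "R (Suc i)"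
      show ?case
      proof (cases "?p \<noteq> 0 \<and> a (Suc i) ?p = a i (?p - 1)")
        case True
        then have R: "R i = ?p - 1" using \<open>\<And>i. R i = step i (R (Suc i))\<close>[of i] by (simp add: step_def)
        show ?thesis
        proof (cases "?p - 1")
          case (Suc q)
          then have "?p = Suc (Suc q)" by simp
          then show ?thesis using True R step.IH m2[of i q] by auto
        qed (use R in simp)
      next
        case False
        then have R: "R i = ?p" using \<open>\<And>i. R i = step i (R (Suc i))\<close>[of i] by (auto simp: step_def)
        show ?thesis
        proof (cases ?p)
          case (Suc q)
          then show ?thesis using False R m1[of i ?p] m2[of i q] by auto
        qed (use R in simp)
      qed
    qed
  qed
  have R_cases: "R i = R (Suc i) \<and> (R i = 0 \<or> a (Suc i) (R i) < a i (R i - 1)) \<or>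
      R (Suc i) = Suc (R i) \<and> a (Suc i) (Suc (R i)) = a i (R i)" for i
    using step[of i] m2[of i "R (Suc i) - 1"] unfolding step_def
    by (cases "R (Suc i)") (auto split: if_splits)
  have zero: "a i k = 0" if "i \<le> k" for i k using lr_array_zero[OF a that] .
  have R_le: "R i \<le> i" for i
  proof (rule ccontr)
    assume "\<not> R i \<le> i"
    then have "R i \<noteq> 0" "i \<le> R i - 1" by simp_all
    then show False using inv[of i] zero[of i "R i - 1"] by simp
  qed
  \<comment> \<open>Rows above \<open>t\<close> are unchanged and row \<open>t\<close> holds one new
    entry. The later rows are the old ones, one place further down, except that one entry is raised
    by one wherever the pointer moves.\<close>
  define b where "b i k = (if i \<le> t then a i k else a (i - 1) k + (if k = R (i - 1) then 1 else 0))" for i k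
  have b_le: "b i = a i" if "i \<le> t" for i using that by (auto simp: b_def)
  have sum_b: "sum (b (Suc i)) {..<k} = sum (a i) {..<k} + (if R i < k then 1 else 0)" if "i \<ge> t" for i k
    using that by (simp add: b_def sum.distrib)
  have anti: "a i (Suc k) \<le> a i k" for i k
    using antimonoD[OF lr_array_antimono[OF a]] by simp
  have arr: "lr_array ?mu b"
    unfolding lr_array_def
  proof (intro conjI allI)
    show "b 0 k = 0" for k by (simp add: b_def a0)
    show "b i k \<le> b (Suc i) k" for i k
    proof -
      consider "Suc i \<le> t" | "i = t" | j where "i = Suc j" "j \<ge> t" by (cases i) fastforce+
      then show ?thesis
      proof cases
        case (3 j)
        then have "b i k = a j k + (if k = R j then 1 else 0)"
          "b (Suc i) k = a (Suc j) k + (if k = R (Suc j) then 1 else 0)" by (simp_all add: b_def)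
        moreover have "a j (R j) < a (Suc j) (R j)" if "R (Suc j) = Suc (R j)"
        proof -
          have "a (Suc j) (Suc (R j)) = a j (R j)" using R_cases[of j] that by simp
          then show ?thesis using inv[of "Suc j"] that by simp
        qed
        moreover have "R j = R (Suc j) \<or> R (Suc j) = Suc (R j)" using R_cases[of j] by blast
        ultimately show ?thesis using m1[of j k] by (elim disjE; cases "k = R j"; simp)
      qed (auto simp: b_def m1)
    qed
    show "b (Suc i) (Suc k) \<le> b i k" for i k
    proof -
      consider "Suc i \<le> t" | "i = t" | j where "i = Suc j" "j \<ge> t" by (cases i) fastforce+
      then show ?thesis
      proof cases
        case 2
        show ?thesis
        proof (cases "R t = Suc k")
          case True
          then show ?thesis using inv[of t] 2 by (simp add: b_def)
        next
          case False
          then show ?thesis using anti[of t k] 2 by (simp add: b_def)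
        qed
      next
        case (3 j)
        then have "b i k = a j k + (if k = R j then 1 else 0)"
          "b (Suc i) (Suc k) = a (Suc j) (Suc k) + (if Suc k = R (Suc j) then 1 else 0)"
          by (simp_all add: b_def)
        moreover have "k \<noteq> R j \<Longrightarrow> R (Suc j) = Suc k \<Longrightarrow> a (Suc j) (Suc k) < a j k"
          using R_cases[of j] by (elim disjE conjE) simp_all
        ultimately show ?thesis using m2[of j k] by (cases "k = R j"; cases "R (Suc j) = Suc k"; simp)
      qed (auto simp: b_def m2)
    qed
    show "?mu (Suc i) + sum (b (Suc (Suc i))) {..<Suc k} + sum (b i) {..<k}
        \<le> ?mu i + sum (b (Suc i)) {..<k} + sum (b (Suc i)) {..<Suc k}" for i k
    proof -
      consider "Suc i < t" | "Suc i = t" | "i = t" | j where "i = Suc j" "j \<ge> t" by (cases i) fastforce+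
      then show ?thesis
      proof cases
        case 1
        then show ?thesis using m3[of i k] by (simp add: b_le del: sum.lessThan_Suc)
      next
        case 2
        have "sum (a i) {..<k} \<le> sum (a (Suc i)) {..<k}" by (rule sum_mono) (rule m1)
        then show ?thesis using 2 mu_top[of i] sum_b[of "Suc i" "Suc k"]
          by (auto simp: b_le simp del: sum.lessThan_Suc)
      next
        case 3
        \<comment> \<open>Below the new box comes the old row \<open>t\<close>, which ends before
          column \<open>h\<close>. So the two rows share no column, and it is enough to bound the
          small entries of the old row by its length.\<close>
        have "sum (a (Suc t)) {..<Suc k} + mu t \<le> sum (a t) {..<Suc k} + lam t"
        proof -
          have "sum (a (Suc t)) {..<max (Suc k) (Suc t)} + mu t = sum (a t) {..<max (Suc k) (Suc t)} + lam t"
          proof -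
            have "sum (a (Suc t)) {..<max (Suc k) (Suc t)} = sum (a (Suc t)) {..<Suc t}"
              by (rule sum.mono_neutral_right) (auto simp: zero)
            moreover have "sum (a t) {..<max (Suc k) (Suc t)} = sum (a t) {..<t}"
              by (rule sum.mono_neutral_right) (auto simp: zero)
            ultimately show ?thesis using s[of t] by simp
          qed
          moreover have "sum (a (Suc t)) {..<Suc k} + sum (a t) {Suc k..<max (Suc k) (Suc t)}
             \<le> sum (a (Suc t)) {..<Suc k} + sum (a (Suc t)) {Suc k..<max (Suc k) (Suc t)}"
            by (intro add_left_mono sum_mono m1)
          moreover have split: "sum c {..<Suc k} + sum c {Suc k..<max (Suc k) (Suc t)} = sum c {..<max (Suc k) (Suc t)}"
            for c :: "nat \<Rightarrow> nat"
          proof -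
            have "{..<max (Suc k) (Suc t)} = {..<Suc k} \<union> {Suc k..<max (Suc k) (Suc t)}" by auto
            moreover have "sum c ({..<Suc k} \<union> {Suc k..<max (Suc k) (Suc t)}) =
                sum c {..<Suc k} + sum c {Suc k..<max (Suc k) (Suc t)}"
              by (rule sum.union_disjoint) auto
            ultimately show ?thesis by presburger
          qed
          ultimately show ?thesis using split[of "a t"] split[of "a (Suc t)"] by linarith
        qed
        then show ?thesis using 3 lam_bot R_cases[of t] sum_b[of "Suc t" "Suc k"] sum_b[of t k] sum_b[of t "Suc k"]
          by (auto simp: b_le simp del: sum.lessThan_Suc)
      next
        case (4 j)
        have old: "mu (Suc j) + sum (a (Suc (Suc j))) {..<Suc k} + sum (a j) {..<k}
          \<le> mu j + sum (a (Suc j)) {..<k} + sum (a (Suc j)) {..<Suc k}" by (rule m3)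
        have eqs: "sum (b (Suc (Suc i))) {..<Suc k} = sum (a (Suc (Suc j))) {..<Suc k} + (if R (Suc (Suc j)) < Suc k then 1 else 0)"
          "sum (b (Suc i)) {..<k} = sum (a (Suc j)) {..<k} + (if R (Suc j) < k then 1 else 0)"
          "sum (b (Suc i)) {..<Suc k} = sum (a (Suc j)) {..<Suc k} + (if R (Suc j) < Suc k then 1 else 0)"
          "sum (b i) {..<k} = sum (a j) {..<k} + (if R j < k then 1 else 0)"
          "?mu (Suc i) = mu (Suc j)" "?mu i = mu j"
          using 4 sum_b[of "Suc (Suc j)"] sum_b[of "Suc j"] sum_b[of j] by (simp_all del: sum.lessThan_Suc)
        \<comment> \<open>In one case only do the pointers tighten the column inequality: the box
          moves from \<open>k - 1\<close> to \<open>k\<close> and then stays. Staying means that a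
          lattice inequality is strict; added to the column inequality for \<open>k - 1\<close>,
          this makes the one for \<open>k\<close> strict as well.\<close>
        show ?thesis
        proof (cases "R (Suc j) = k \<and> R (Suc (Suc j)) = k \<and> Suc (R j) = k")
          case True
          define l where "l = R j"
          have k: "k = Suc l" "R j = l" "R (Suc j) = Suc l" "R (Suc (Suc j)) = Suc l"
            using True unfolding l_def by simp_all
          have "mu (Suc j) + sum (a (Suc (Suc j))) {..<Suc l} + sum (a j) {..<l}
            \<le> mu j + sum (a (Suc j)) {..<l} + sum (a (Suc j)) {..<Suc l}" by (rule m3)
          moreover have "a (Suc j) (Suc l) = a j l" "a (Suc (Suc j)) (Suc l) < a (Suc j) l"
            using R_cases[of j] R_cases[of "Suc j"] k by auto
          ultimately have "mu (Suc j) + sum (a (Suc (Suc j))) {..<Suc k} + sum (a j) {..<k}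
            < mu j + sum (a (Suc j)) {..<k} + sum (a (Suc j)) {..<Suc k}"
            unfolding k(1) by simp
          then show ?thesis unfolding eqs using k by (simp del: sum.lessThan_Suc)
        next
          case False
          moreover have "R (Suc j) = R j \<or> R (Suc j) = Suc (R j)"
            "R (Suc (Suc j)) = R (Suc j) \<or> R (Suc (Suc j)) = Suc (R (Suc j))"
            using R_cases[of j] R_cases[of "Suc j"] by metis+
          ultimately show ?thesis unfolding eqs using old by (auto simp del: sum.lessThan_Suc)
        qed
      qed
    qed
  qed
  moreover have "sum (b (Suc i)) {..<Suc i} + ?mu i = sum (b i) {..<i} + ?lam i" for i
  proof -
    consider "i < t" | "i = t" | j where "i = Suc j" "j \<ge> t" by (cases i) fastforce+
    then show ?thesis
    proof cases
      case 1
      then show ?thesis using s[of i] by (simp add: b_le del: sum.lessThan_Suc)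
    next
      case 2
      then show ?thesis using sum_b[of t "Suc t"] R_le[of t] zero[of t t] by (simp add: b_le)
    next
      case (3 j)
      have "sum (a (Suc j)) {..<Suc (Suc j)} = sum (a (Suc j)) {..<Suc j}"
        "sum (a j) {..<Suc j} = sum (a j) {..<j}" by (simp_all add: zero)
      then show ?thesis using 3 s[of j] sum_b[of "Suc j" "Suc (Suc j)"] sum_b[of j "Suc j"] R_le[of j] R_le[of "Suc j"]
        by (simp del: sum.lessThan_Suc)
    qed
  qed
  moreover have "b i = nu(r := Suc (nu r))" if "i \<ge> Suc (max N t)" for i
    using that N[of "i - 1"] R_ge[of "i - 1"] by (auto simp: b_def fun_eq_iff)
  ultimately show ?thesis unfolding LR_def by blast
qed

section \<open>Littlewood-Richardson tableaux as arrays\<close>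

abbreviation fn :: "nat list \<Rightarrow> nat \<Rightarrow> nat" where
  "fn \<equiv> nth_default 0"

lemma young_fn: assumes "is_partition lam" shows "young (fn lam)"
  unfolding young_def
proof
  have "fn lam j \<le> fn lam i" if "i \<le> j" for i j
    using assms that unfolding is_partition_def sorted_wrt_iff_nth_less
    by (cases "i = j") (auto simp: nth_default_def)
  then show "antimono (fn lam)" by (rule antimonoI)
  show "\<exists>n. fn lam n = 0" by (rule exI[of _ "length lam"]) (simp add: nth_default_def)
qed

lemma fn_pos_iff: "is_partition lam \<Longrightarrow> 0 < fn lam i \<longleftrightarrow> i < length lam"
  unfolding is_partition_def by (auto simp: nth_default_def)

lemma mem_skew_iff: "(i, j) \<in> skew_diagram lam mu \<longleftrightarrow> fn mu i \<le> j \<and> j < fn lam i"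
  unfolding skew_diagram_def diagram_def by auto

lemma finite_skew: "finite (skew_diagram lam mu)"
proof (rule finite_subset)
  show "skew_diagram lam mu \<subseteq> (SIGMA i:{..<length lam}. {..<fn lam i})"
    by (auto simp: mem_skew_iff nth_default_def split: if_splits)
qed auto

definition row_count :: "nat list \<Rightarrow> nat list \<Rightarrow> (nat \<times> nat \<Rightarrow> nat) \<Rightarrow> nat \<Rightarrow> nat \<Rightarrow> nat" where
  "row_count lam mu T i v = card {c. fn mu i \<le> c \<and> c < fn lam i \<and> T (i, c) = v}"

definition row_word :: "nat list \<Rightarrow> nat list \<Rightarrow> (nat \<times> nat \<Rightarrow> nat) \<Rightarrow> nat \<Rightarrow> nat list" where
  "row_word lam mu T i = map (\<lambda>j. T (i, j)) (rev [fn mu i..<fn lam i])"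

lemma card_skew_eq_sum:
  "card {x \<in> skew_diagram lam mu. T x = v} = (\<Sum>i<length lam. row_count lam mu T i v)"
proof -
  have "{x \<in> skew_diagram lam mu. T x = v} =
      (SIGMA i:{..<length lam}. {c. fn mu i \<le> c \<and> c < fn lam i \<and> T (i, c) = v})"
    by (auto simp: mem_skew_iff nth_default_def split: if_splits)
  then show ?thesis unfolding row_count_def by (simp add: card_SigmaI)
qed

lemma count_list_map_rev: "count_list (map h (rev [m..<l])) v = card {c. m \<le> c \<and> c < l \<and> h c = v}"
proof -
  have "count_list (map h (rev [m..<l])) v = length (filter (\<lambda>c. h c = v) [m..<l])"
    by (induction l) (auto simp: count_list_eq_length_filter filter_map o_def eq_commute)
  also have "\<dots> = card (set (filter (\<lambda>c. h c = v) [m..<l]))"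
    by (rule distinct_card[symmetric]) simp
  also have "set (filter (\<lambda>c. h c = v) [m..<l]) = {c. m \<le> c \<and> c < l \<and> h c = v}" by auto
  finally show ?thesis .
qed

lemma count_row_word: "count_list (row_word lam mu T i) v = row_count lam mu T i v"
  unfolding row_word_def row_count_def by (rule count_list_map_rev)

lemma count_rows:
  "count_list (concat (map (row_word lam mu T) [0..<i])) v = (\<Sum>r<i. row_count lam mu T r v)"
  by (induction i) (simp_all add: count_row_word)

lemma word_split:
  assumes "i < length lam"
  shows "\<exists>rest. reverse_row_word lam mu T =
    concat (map (row_word lam mu T) [0..<i]) @ row_word lam mu T i @ rest"
proof -
  have "[0..<length lam] = [0..<i] @ i # [Suc i..<length lam]"
    using assms by (metis le_add_diff_inverse less_imp_le_nat upt_add_eq_append upt_conv_Cons zero_le)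
  then have "map (row_word lam mu T) [0..<length lam] =
      map (row_word lam mu T) [0..<i] @ row_word lam mu T i # map (row_word lam mu T) [Suc i..<length lam]"
    by simp
  then show ?thesis unfolding reverse_row_word_def row_word_def by auto
qed

lemma word_all: "reverse_row_word lam mu T = concat (map (row_word lam mu T) [0..<length lam])"
  unfolding reverse_row_word_def row_word_def ..

lemma threshold:
  assumes "m \<le> (l :: nat)" "\<And>c c'. m \<le> c \<Longrightarrow> c \<le> c' \<Longrightarrow> c' < l \<Longrightarrow> P c \<Longrightarrow> P c'"
  obtains d where "m \<le> d" "d \<le> l" "\<And>c. m \<le> c \<Longrightarrow> c < l \<Longrightarrow> P c \<longleftrightarrow> d \<le> c"
proof -
  let ?Q = "\<lambda>c. m \<le> c \<and> (c = l \<or> P c)"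
  define d where "d = (LEAST c. ?Q c)"
  have Q: "?Q d" unfolding d_def by (rule LeastI[of ?Q l]) (use assms in auto)
  have le: "d \<le> c" if "?Q c" for c unfolding d_def by (rule Least_le) (rule that)
  show ?thesis
  proof (rule that)
    show "m \<le> d" using Q by blast
    show "d \<le> l" using le assms(1) by blast
    show "P c \<longleftrightarrow> d \<le> c" if "m \<le> c" "c < l" for c
      using le[of c] Q assms(2)[of d c] that by auto
  qed
qed

lemma lattice_wordD:
  "lattice_word w \<Longrightarrow> count_list (take p w) (Suc (Suc k)) \<le> count_list (take p w) (Suc k)"
  unfolding lattice_word_def by simp

lemma LR_of_tableau:
  assumes lam: "is_partition lam" and mu: "is_partition mu" and sub: "\<And>i. fn mu i \<le> fn lam i"
    and T: "semistandard lam mu T" "has_content lam mu T nu" "lattice_word (reverse_row_word lam mu T)"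
  shows "LR (fn lam) (fn mu) (fn nu)"
proof -
  let ?n = "length lam"
  define rc where "rc i k = row_count lam mu T i (Suc k)" for i k
  define a where "a i k = (\<Sum>r<i. rc r k)" for i k
  define below where "below i K = card {c. fn mu i \<le> c \<and> c < fn lam i \<and> T (i, c) \<le> K}" for i K
  have row: "T (i, c) \<le> T (i, c')" if "fn mu i \<le> c" "c \<le> c'" "c' < fn lam i" for i c c'
  proof (cases "c = c'")
    case False
    then show ?thesis using T(1) that unfolding semistandard_def by (auto simp: mem_skew_iff)
  qed simp
  have col: "T (i, c) < T (Suc i, c)" if "fn mu i \<le> c" "c < fn lam (Suc i)" for i c
  proof -
    have "fn mu (Suc i) \<le> c" "c < fn lam i"
      using that youngD[OF young_fn[OF mu], of i "Suc i"] youngD[OF young_fn[OF lam], of i "Suc i"] by simp_all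
    then show ?thesis using T(1) that unfolding semistandard_def by (simp add: mem_skew_iff)
  qed
  have pos: "1 \<le> T (i, c)" if "fn mu i \<le> c" "c < fn lam i" for i c
  proof -
    have "T \<in> skew_diagram lam mu \<rightarrow>\<^sub>E {1..}" using T(1) unfolding semistandard_def by blast
    moreover have "(i, c) \<in> skew_diagram lam mu" using that by (simp add: mem_skew_iff)
    ultimately show ?thesis by (auto dest: PiE_mem)
  qed
  have rc_0: "rc i k = 0" if "i \<ge> ?n" for i k
    using that unfolding rc_def row_count_def by (simp add: nth_default_def)
  have count_rows': "count_list (concat (map (row_word lam mu T) [0..<i])) (Suc k) = a i k" for i k
    unfolding count_rows a_def rc_def ..
  have lattice: "a (Suc i) (Suc k) \<le> a i k" for i k
  proof (cases "i < ?n")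
    case False
    have a_n: "a j l = a ?n l" if "j \<ge> ?n" for j l
      unfolding a_def by (rule sum.mono_neutral_right) (use that rc_0 in auto)
    have "count_list (take (length (reverse_row_word lam mu T)) (reverse_row_word lam mu T)) (Suc (Suc k))
      \<le> count_list (take (length (reverse_row_word lam mu T)) (reverse_row_word lam mu T)) (Suc k)"
      by (rule lattice_wordD[OF T(3)])
    then have "a ?n (Suc k) \<le> a ?n k" by (simp add: word_all count_rows')
    then show ?thesis using False a_n[of i k] a_n[of "Suc i" "Suc k"] by simp
  next
    case True
    \<comment> \<open>Read from right to left, row \<open>i\<close> begins with its entries above
      \<open>k + 1\<close>. If the word is cut right after them, all entries \<open>k + 2\<close> of
      this row have been counted, but none of its entries \<open>k + 1\<close>; this is why the
      bound compares \<open>i + 1\<close> rows with \<open>i\<close> rows.\<close>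
    obtain d where d: "fn mu i \<le> d" "d \<le> fn lam i"
      "\<And>c. fn mu i \<le> c \<Longrightarrow> c < fn lam i \<Longrightarrow> Suc (Suc k) \<le> T (i, c) \<longleftrightarrow> d \<le> c"
      by (rule threshold[OF sub[of i], where P = "\<lambda>c. Suc (Suc k) \<le> T (i, c)"])
        (use row order_trans in blast)+
    obtain rest where rest: "reverse_row_word lam mu T =
        concat (map (row_word lam mu T) [0..<i]) @ row_word lam mu T i @ rest"
      using word_split[OF True] by blast
    have "rev [fn mu i..<fn lam i] = rev [d..<fn lam i] @ rev [fn mu i..<d]"
      using d(1,2) by (metis le_add_diff_inverse rev_append upt_add_eq_append)
    then have w: "row_word lam mu T i = map (\<lambda>j. T (i, j)) (rev [d..<fn lam i]) @ map (\<lambda>j. T (i, j)) (rev [fn mu i..<d])"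
      unfolding row_word_def by simp
    define pre where "pre = concat (map (row_word lam mu T) [0..<i]) @ map (\<lambda>j. T (i, j)) (rev [d..<fn lam i])"
    have "take (length pre) (reverse_row_word lam mu T) = pre" unfolding rest w pre_def by simp
    then have "count_list pre (Suc (Suc k)) \<le> count_list pre (Suc k)"
      using lattice_wordD[OF T(3)] by metis
    moreover have "count_list pre (Suc (Suc k)) = a (Suc i) (Suc k)"
    proof -
      have "{c. d \<le> c \<and> c < fn lam i \<and> T (i, c) = Suc (Suc k)} =
          {c. fn mu i \<le> c \<and> c < fn lam i \<and> T (i, c) = Suc (Suc k)}"
      proof (intro Collect_cong)
        fix c
        show "(d \<le> c \<and> c < fn lam i \<and> T (i, c) = Suc (Suc k)) =
            (fn mu i \<le> c \<and> c < fn lam i \<and> T (i, c) = Suc (Suc k))"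
          using d(1) d(3)[of c] by (cases "fn mu i \<le> c") auto
      qed
      then have "card {c. d \<le> c \<and> c < fn lam i \<and> T (i, c) = Suc (Suc k)} = rc i (Suc k)"
        unfolding rc_def row_count_def by simp
      then show ?thesis unfolding pre_def by (simp add: count_rows' count_list_map_rev a_def)
    qed
    moreover have "count_list pre (Suc k) = a i k"
    proof -
      have "{c. d \<le> c \<and> c < fn lam i \<and> T (i, c) = Suc k} = {}"
      proof (rule ccontr)
        assume "{c. d \<le> c \<and> c < fn lam i \<and> T (i, c) = Suc k} \<noteq> {}"
        then obtain c where "d \<le> c" "c < fn lam i" "T (i, c) = Suc k" by blast
        then show False using d(1) d(3)[of c] by simp
      qed
      then show ?thesis unfolding pre_def by (simp add: count_rows' count_list_map_rev)
    qed
    ultimately show ?thesis by simp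
  qed
  have zero: "a i k = 0" if "i \<le> k" for i k
    using that
  proof (induction i arbitrary: k)
    case (Suc i)
    then obtain k' where "k = Suc k'" by (cases k) auto
    then show ?case using Suc lattice[of i k'] by simp
  qed (simp add: a_def)
  have fin: "finite {c. fn mu i \<le> c \<and> c < fn lam i \<and> Q c}" for i Q
    by (rule finite_subset[of _ "{..<fn lam i}"]) auto
  have psum: "sum (a (Suc i)) {..<K} = sum (a i) {..<K} + below i K" for i K
  proof -
    have "sum (rc i) {..<K} = below i K"
    proof (induction K)
      case 0
      have "{c. fn mu i \<le> c \<and> c < fn lam i \<and> T (i, c) \<le> 0} = {}" using pos by fastforce
      then show ?case unfolding below_def by simp
    next
      case (Suc K)
      have "{c. fn mu i \<le> c \<and> c < fn lam i \<and> T (i, c) \<le> Suc K} =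
        {c. fn mu i \<le> c \<and> c < fn lam i \<and> T (i, c) \<le> K} \<union> {c. fn mu i \<le> c \<and> c < fn lam i \<and> T (i, c) = Suc K}"
        by auto
      moreover have "card ({c. fn mu i \<le> c \<and> c < fn lam i \<and> T (i, c) \<le> K} \<union>
          {c. fn mu i \<le> c \<and> c < fn lam i \<and> T (i, c) = Suc K}) = below i K + rc i K"
        unfolding below_def rc_def row_count_def by (rule card_Un_disjoint[OF fin fin]) auto
      ultimately have "below i (Suc K) = below i K + rc i K" unfolding below_def by simp
      then show ?case using Suc by simp
    qed
    then show ?thesis by (simp add: a_def sum.distrib)
  qed
  have T_le: "T (i, c) \<le> Suc i" if "fn mu i \<le> c" "c < fn lam i" for i c
  proof -
    have "1 \<le> T (i, c)" by (rule pos[OF that])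
    then obtain k where k: "T (i, c) = Suc k" by (cases "T (i, c)") auto
    then have "c \<in> {c. fn mu i \<le> c \<and> c < fn lam i \<and> T (i, c) = Suc k}" using that by simp
    then have "{c. fn mu i \<le> c \<and> c < fn lam i \<and> T (i, c) = Suc k} \<noteq> {}" by blast
    with fin have "0 < rc i k" unfolding rc_def row_count_def card_gt_0_iff by (intro conjI)
    then have "a (Suc i) k \<noteq> 0" by (simp add: a_def)
    then have "k < Suc i" using zero[of "Suc i" k] by (meson not_le)
    then show ?thesis using k by simp
  qed
  have below_thr: "\<exists>d. fn mu i \<le> d \<and> d \<le> fn lam i \<and> fn mu i + below i K = d \<and>
      (\<forall>c. fn mu i \<le> c \<longrightarrow> c < fn lam i \<longrightarrow> (T (i, c) \<le> K \<longleftrightarrow> c < d))" for i K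
  proof -
    obtain d where d: "fn mu i \<le> d" "d \<le> fn lam i"
      "\<And>c. fn mu i \<le> c \<Longrightarrow> c < fn lam i \<Longrightarrow> \<not> T (i, c) \<le> K \<longleftrightarrow> d \<le> c"
      by (rule threshold[OF sub[of i], where P = "\<lambda>c. \<not> T (i, c) \<le> K"])
        (use row order_trans in blast)+
    have "{c. fn mu i \<le> c \<and> c < fn lam i \<and> T (i, c) \<le> K} = {fn mu i..<d}"
      using d by (force simp: not_le)
    then have "below i K = d - fn mu i" unfolding below_def by simp
    then have "fn mu i + below i K = d" using d(1) by simp
    then show ?thesis using d by (metis not_le)
  qed
  have "lr_array (fn mu) a"
    unfolding lr_array_def
  proof (intro conjI allI)
    show "a 0 k = 0" for k by (simp add: a_def)
    show "a i k \<le> a (Suc i) k" for i k by (simp add: a_def)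
    show "a (Suc i) (Suc k) \<le> a i k" for i k by (rule lattice)
    show "fn mu (Suc i) + sum (a (Suc (Suc i))) {..<Suc k} + sum (a i) {..<k}
        \<le> fn mu i + sum (a (Suc i)) {..<k} + sum (a (Suc i)) {..<Suc k}" for i k
    proof -
      obtain d where d: "fn mu i \<le> d" "d \<le> fn lam i" "fn mu i + below i k = d"
        "\<And>c. fn mu i \<le> c \<Longrightarrow> c < fn lam i \<Longrightarrow> T (i, c) \<le> k \<longleftrightarrow> c < d"
        using below_thr[of i k] by blast
      obtain e where e: "fn mu (Suc i) \<le> e" "e \<le> fn lam (Suc i)" "fn mu (Suc i) + below (Suc i) (Suc k) = e"
        "\<And>c. fn mu (Suc i) \<le> c \<Longrightarrow> c < fn lam (Suc i) \<Longrightarrow> T (Suc i, c) \<le> Suc k \<longleftrightarrow> c < e"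
        using below_thr[of "Suc i" "Suc k"] by blast
      have "e \<le> d"
      proof (rule ccontr)
        assume "\<not> e \<le> d"
        then have c: "fn mu i \<le> e - 1" "e - 1 < fn lam (Suc i)" "e - 1 < e" "d \<le> e - 1"
          using d(1) e(2) by simp_all
        have "fn mu (Suc i) \<le> e - 1" "e - 1 < fn lam i"
          using c youngD[OF young_fn[OF mu], of i "Suc i"] youngD[OF young_fn[OF lam], of i "Suc i"] by simp_all
        then have "T (Suc i, e - 1) \<le> Suc k" "\<not> T (i, e - 1) \<le> k"
          using e(4)[of "e - 1"] d(4)[of "e - 1"] c by simp_all
        then show False using col[OF c(1,2)] by simp
      qed
      then show ?thesis using d(3) e(3) psum[of "Suc i" "Suc k"] psum[of i k] by linarith
    qed
  qed
  moreover have "sum (a (Suc i)) {..<Suc i} + fn mu i = sum (a i) {..<i} + fn lam i" for i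
  proof -
    have "{c. fn mu i \<le> c \<and> c < fn lam i \<and> T (i, c) \<le> Suc i} = {fn mu i..<fn lam i}"
      using T_le by auto
    then have "below i (Suc i) + fn mu i = fn lam i" unfolding below_def using sub[of i] by simp
    then show ?thesis using psum[of i "Suc i"] zero[of i i] by simp
  qed
  moreover have "a i = fn nu" if "i \<ge> ?n" for i
  proof
    fix k
    have "a i k = a ?n k"
      unfolding a_def by (rule sum.mono_neutral_right) (use that rc_0 in auto)
    also have "\<dots> = card {x \<in> skew_diagram lam mu. T x = Suc k}"
      unfolding a_def rc_def card_skew_eq_sum ..
    also have "\<dots> = fn nu k" using T(2) unfolding has_content_def by blast
    finally show "a i k = fn nu k" .
  qed
  ultimately show ?thesis unfolding LR_def by blast
qed

lemma take_concat:
  "p \<ge> length (concat xss) \<or> (\<exists>i q. i < length xss \<and> q \<le> length (xss ! i) \<and>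
     take p (concat xss) = concat (take i xss) @ take q (xss ! i))"
proof (induction xss arbitrary: p)
  case (Cons xs xss)
  show ?case
  proof (cases "p \<le> length xs")
    case True
    then show ?thesis by (intro disjI2 exI[of _ 0] exI[of _ p]) simp
  next
    case False
    show ?thesis using Cons.IH[of "p - length xs"]
    proof (elim disjE exE conjE)
      fix i q
      assume "i < length xss" "q \<le> length (xss ! i)"
        "take (p - length xs) (concat xss) = concat (take i xss) @ take q (xss ! i)"
      then show ?thesis using False by (intro disjI2 exI[of _ "Suc i"] exI[of _ q]) simp
    qed (use False in auto)
  qed
qed simp

lemma tableau_of_LR:
  assumes lam: "is_partition lam" and mu: "is_partition mu" and sub: "\<And>i. fn mu i \<le> fn lam i"
    and LR: "LR (fn lam) (fn mu) (fn nu)"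
  shows "\<exists>T. semistandard lam mu T \<and> has_content lam mu T nu \<and> lattice_word (reverse_row_word lam mu T)"
proof -
  let ?n = "length lam"
  obtain a N where a: "lr_array (fn mu) a"
    and s: "\<And>i. sum (a (Suc i)) {..<Suc i} + fn mu i = sum (a i) {..<i} + fn lam i"
    and N: "\<And>i. i \<ge> N \<Longrightarrow> a i = fn nu"
    using LR unfolding LR_def by blast
  have m1: "a i k \<le> a (Suc i) k" and m2: "a (Suc i) (Suc k) \<le> a i k"
    and m3: "fn mu (Suc i) + sum (a (Suc (Suc i))) {..<Suc k} + sum (a i) {..<k}
        \<le> fn mu i + sum (a (Suc i)) {..<k} + sum (a (Suc i)) {..<Suc k}" and a0: "a 0 k = 0" for i k
    using a unfolding lr_array_def by blast+
  have zero: "a i k = 0" if "i \<le> k" for i k using lr_array_zero[OF a that] .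
  define R where "R i K = (\<Sum>k<K. a (Suc i) k - a i k)" for i K
  have R: "sum (a (Suc i)) {..<K} = sum (a i) {..<K} + R i K" for i K
    unfolding R_def by (simp add: m1 flip: sum.distrib)
  have R_mono: "R i K \<le> R i L" if "K \<le> L" for i K L
    unfolding R_def by (rule sum_mono2) (use that in auto)
  have R_tot: "R i K = fn lam i - fn mu i" if "Suc i \<le> K" for i K
  proof -
    have "R i K = R i (Suc i)"
      unfolding R_def by (rule sum.mono_neutral_right) (use that in \<open>auto simp: zero\<close>)
    then show ?thesis using R[of i "Suc i"] s[of i] zero[of i i] by simp
  qed
  have R_le: "fn mu i + R i K \<le> fn lam i" for i K
    using R_mono[of K "max K (Suc i)" i] R_tot[of i "max K (Suc i)"] sub[of i] by simp
  \<comment> \<open>Row \<open>i\<close> is filled in increasing order with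
    \<open>a (Suc i) k - a i k\<close> entries \<open>k + 1\<close>. As \<open>R i K\<close> counts
    its entries up to \<open>K\<close>, this is the entry in column \<open>c\<close>.\<close>
  define t where "t i c = (LEAST K. c < fn mu i + R i K)" for i c
  have t_le: "t i c \<le> K \<longleftrightarrow> c < fn mu i + R i K" if "fn mu i \<le> c" "c < fn lam i" for i c K
  proof
    have "c < fn mu i + R i (Suc i)" using R_tot[of i "Suc i"] that by simp
    then have "c < fn mu i + R i (t i c)" unfolding t_def by (rule LeastI)
    then show "t i c \<le> K \<Longrightarrow> c < fn mu i + R i K" using R_mono[of "t i c" K i] by simp
    show "c < fn mu i + R i K \<Longrightarrow> t i c \<le> K" unfolding t_def by (rule Least_le)
  qed
  define T where "T = (\<lambda>x. if x \<in> skew_diagram lam mu then t (fst x) (snd x) else undefined)"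
  have T: "T (i, c) = t i c" if "fn mu i \<le> c" "c < fn lam i" for i c
    using that unfolding T_def by (simp add: mem_skew_iff)
  have pos: "1 \<le> t i c" if "fn mu i \<le> c" "c < fn lam i" for i c
    using t_le[OF that, of 0] that unfolding R_def by (simp add: Suc_le_eq)
  have row: "t i c \<le> t i c'" if "fn mu i \<le> c" "c \<le> c'" "c' < fn lam i" for i c c'
  proof -
    have "c' < fn mu i + R i (t i c')" using t_le[of i c' "t i c'"] that by simp
    then show ?thesis using t_le[of i c "t i c'"] that by simp
  qed
  have col: "t i c < t (Suc i) c" if "fn mu i \<le> c" "c < fn lam (Suc i)" for i c
  proof -
    have c: "fn mu (Suc i) \<le> c" "c < fn lam i"
      using that youngD[OF young_fn[OF mu], of i "Suc i"] youngD[OF young_fn[OF lam], of i "Suc i"] by simp_all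
    have "1 \<le> t (Suc i) c" by (rule pos[OF c(1) that(2)])
    then obtain K where K: "t (Suc i) c = Suc K" by (cases "t (Suc i) c") auto
    have "c < fn mu (Suc i) + R (Suc i) (Suc K)" using t_le[of "Suc i" c "Suc K"] c that K by simp
    also have "\<dots> \<le> fn mu i + R i K" using m3[of i K] R[of "Suc i" "Suc K"] R[of i K] by linarith
    finally have "t i c \<le> K" using t_le[of i c K] c that by simp
    then show ?thesis using K by simp
  qed
  have col': "t i c < t i' c" if "i < i'" "fn mu i \<le> c" "c < fn lam i'" for i i' c
    using that
  proof (induction rule: strict_inc_induct)
    case (base i)
    then show ?case using col by blast
  next
    case (step i)
    have "fn mu (Suc i) \<le> c" "c < fn lam (Suc i)"
      using step youngD[OF young_fn[OF mu], of i "Suc i"] youngD[OF young_fn[OF lam], of "Suc i" i'] by simp_all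
    then show ?case using step col[of i c] by simp
  qed
  have ss: "semistandard lam mu T"
    unfolding semistandard_def
  proof (intro conjI allI impI)
    show "T \<in> skew_diagram lam mu \<rightarrow>\<^sub>E {1..}"
      using pos by (auto simp: T_def mem_skew_iff PiE_iff extensional_def)
  qed (auto simp: mem_skew_iff T intro: row col')
  have rc: "row_count lam mu T i (Suc k) = a (Suc i) k - a i k" for i k
  proof -
    have "{c. fn mu i \<le> c \<and> c < fn lam i \<and> T (i, c) = Suc k} = {fn mu i + R i k..<fn mu i + R i (Suc k)}"
      (is "?L = ?R")
    proof (intro set_eqI iffI)
      fix c assume "c \<in> ?L"
      then have c: "fn mu i \<le> c" "c < fn lam i" "t i c = Suc k" using T by auto
      then show "c \<in> ?R" using t_le[OF c(1,2), of k] t_le[OF c(1,2), of "Suc k"] by simp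
    next
      fix c assume "c \<in> ?R"
      then have c: "fn mu i \<le> c" "c < fn lam i" "\<not> c < fn mu i + R i k" "c < fn mu i + R i (Suc k)"
        using R_le[of i "Suc k"] by auto
      then show "c \<in> ?L" using t_le[OF c(1,2), of k] t_le[OF c(1,2), of "Suc k"] T[OF c(1,2)] by simp
    qed
    then show ?thesis unfolding row_count_def by (simp add: R_def)
  qed
  have sum_rc: "(\<Sum>r<i. row_count lam mu T r (Suc k)) = a i k" for i k
  proof (induction i)
    case (Suc i)
    then show ?case using m1[of i k] by (simp add: rc)
  qed (simp add: a0)
  have final: "a ?n = fn nu"
  proof
    fix k
    have "a (?n + j) k = a ?n k" for j
    proof (induction j)
      case (Suc j)
      have "row_count lam mu T (?n + j) (Suc k) = 0" unfolding row_count_def by (simp add: nth_default_def)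
      then show ?case using Suc m1[of "?n + j" k] by (simp add: rc)
    qed simp
    from this[of N] show "a ?n k = fn nu k" using N[of "?n + N"] by simp
  qed
  have cont: "has_content lam mu T nu"
    unfolding has_content_def card_skew_eq_sum sum_rc final by simp
  have rows: "count_list (concat (map (row_word lam mu T) [0..<i])) (Suc k) = a i k" for i k
    unfolding count_rows sum_rc ..
  have "lattice_word (reverse_row_word lam mu T)"
    unfolding lattice_word_def
  proof (intro allI impI)
    fix p k :: nat assume "1 \<le> k"
    then obtain l where k: "k = Suc l" by (cases k) auto
    let ?w = "map (row_word lam mu T) [0..<?n]"
    show "count_list (take p (reverse_row_word lam mu T)) (Suc k)
       \<le> count_list (take p (reverse_row_word lam mu T)) k"
      using take_concat[of ?w p]
    proof (elim disjE exE conjE)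
      assume "length (concat ?w) \<le> p"
      then have "take p (reverse_row_word lam mu T) = concat ?w" unfolding word_all by simp
      then show ?thesis using antimonoD[OF lr_array_antimono[OF a], of l "Suc l"] by (simp add: rows k)
    next
      fix i q
      assume i: "i < length ?w" and "take p (concat ?w) = concat (take i ?w) @ take q (?w ! i)"
      then have w: "take p (reverse_row_word lam mu T) =
          concat (map (row_word lam mu T) [0..<i]) @ take q (row_word lam mu T i)"
        unfolding word_all by (simp add: take_map)
      \<comment> \<open>A prefix that ends inside row \<open>i\<close> contains at most the entries
        \<open>k + 1\<close> of the first \<open>i + 1\<close> rows and at least the entries
        \<open>k\<close> of the first \<open>i\<close> rows. The array condition compares exactly
        these two numbers.\<close>
      have "count_list (take q (row_word lam mu T i)) (Suc k) \<le> count_list (row_word lam mu T i) (Suc k)"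
        by (metis append_take_drop_id count_list_append le_add1)
      then have "count_list (take p (reverse_row_word lam mu T)) (Suc k)
          \<le> count_list (concat (map (row_word lam mu T) [0..<Suc i])) (Suc k)"
        unfolding w by simp
      also have "\<dots> \<le> a i l" unfolding k rows by (rule m2)
      also have "\<dots> \<le> count_list (take p (reverse_row_word lam mu T)) k"
        unfolding w k by (simp add: rows)
      finally show ?thesis .
    qed
  qed
  then show ?thesis using ss cont by blast
qed

text \<open>Infinite sets have cardinality 0, so the existence of a tableau gives a nonzero
  coefficient only together with finiteness. The content bounds the entries by
  \<open>length nu\<close>.\<close>

lemma finite_tableaux:
  "finite {T. semistandard lam mu T \<and> has_content lam mu T nu \<and> lattice_word (reverse_row_word lam mu T)}"
proof (rule finite_subset)
  show "{T. semistandard lam mu T \<and> has_content lam mu T nu \<and> lattice_word (reverse_row_word lam mu T)}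
    \<subseteq> skew_diagram lam mu \<rightarrow>\<^sub>E {..length nu}"
  proof clarify
    fix T
    assume ss: "semistandard lam mu T" and hc: "has_content lam mu T nu"
    have T: "T \<in> skew_diagram lam mu \<rightarrow>\<^sub>E {1..}" using ss unfolding semistandard_def by blast
    have "T x \<le> length nu" if "x \<in> skew_diagram lam mu" for x
    proof (cases "T x")
      case (Suc k)
      then have "0 < card {x \<in> skew_diagram lam mu. T x = Suc k}"
      proof -
        have "x \<in> {x \<in> skew_diagram lam mu. T x = Suc k}" using that Suc by simp
        moreover have "finite {x \<in> skew_diagram lam mu. T x = Suc k}"
          by (rule finite_subset[OF _ finite_skew[of lam mu]]) blast
        ultimately show ?thesis using card_gt_0_iff by blast
      qed
      then have "0 < fn nu k" using hc unfolding has_content_def by simp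
      then show ?thesis using Suc by (auto simp: nth_default_def split: if_splits)
    qed simp
    then show "T \<in> skew_diagram lam mu \<rightarrow>\<^sub>E {..length nu}" using T by (auto simp: PiE_iff)
  qed
  show "finite (skew_diagram lam mu \<rightarrow>\<^sub>E {..length nu})"
    by (intro finite_PiE finite_skew) simp
qed

theorem components_iff:
  assumes "is_partition lam" "is_partition mu" "\<And>i. fn mu i \<le> fn lam i"
  shows "nu \<in> components lam mu \<longleftrightarrow> is_partition nu \<and> LR (fn lam) (fn mu) (fn nu)"
  unfolding components_def lr_coeff_def
  using LR_of_tableau[OF assms, of _ nu] tableau_of_LR[OF assms, of nu] finite_tableaux[of lam mu nu]
  unfolding mem_Collect_eq card_eq_0_iff by blast

section \<open>Reduction to single boxes\<close>

definition cover :: "(nat \<Rightarrow> nat) \<Rightarrow> (nat \<Rightarrow> nat) \<Rightarrow> bool" where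
  "cover f f' \<longleftrightarrow> (\<exists>r. f' = f(r := Suc (f r)))"

text \<open>If \<open>c\<close> exceeds \<open>f r\<close>, the inserted part pushes row
  \<open>r\<close> down, and the additional box appears in row \<open>r + 1\<close> instead of row
  \<open>r\<close>.\<close>

lemma cover_ins:
  assumes "young f" "young f'" "cover f f'"
  shows "cover (ins c f) (ins c f')"
proof -
  obtain r where f': "f' = f(r := Suc (f r))" using assms(3) unfolding cover_def by blast
  have dec: "f (Suc i) \<le> f i" for i using youngD[OF assms(1)] by simp
  have up: "Suc (f (Suc i)) \<le> f i" if "r = Suc i" for i
    using youngD[OF assms(2), of i r] that unfolding f' by simp
  show ?thesis
  proof (cases "c \<le> f r")
    case True
    have "ins c f' k = ((ins c f)(r := Suc (ins c f r))) k" for k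
      using True dec[of r] up unfolding f' by (cases k) auto
    then show ?thesis unfolding cover_def by blast
  next
    case False
    have "ins c f' k = ((ins c f)(Suc r := Suc (ins c f (Suc r)))) k" for k
      using False dec[of r] up unfolding f' by (cases k) (auto simp: min_def max_def)
    then show ?thesis unfolding cover_def by blast
  qed
qed

lemma cover_plus: "cover f f' \<Longrightarrow> cover (\<lambda>k. f k + h k) (\<lambda>k. f' k + h k)"
  unfolding cover_def by (auto simp: fun_eq_iff)

lemma young_plus: assumes "young f" "young h" shows "young (\<lambda>k. f k + h k)"
proof -
  obtain m n where mn: "f m = 0" "h n = 0" using assms unfolding young_def by blast
  have "f (max m n) + h (max m n) = 0"
    using mn youngD[OF assms(1), of m "max m n"] youngD[OF assms(2), of n "max m n"] by simp
  then show ?thesis unfolding young_def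
    by (auto intro!: antimonoI add_mono youngD[OF assms(1)] youngD[OF assms(2)])
qed

text \<open>Preserving covers is what keeps pairs together: two partitions that cover a common one
  are mapped to two that cover its image.\<close>

definition embedding :: "((nat \<Rightarrow> nat) \<Rightarrow> nat \<Rightarrow> nat) \<Rightarrow> bool" where
  "embedding \<phi> \<longleftrightarrow> (\<forall>f. young f \<longrightarrow> young (\<phi> f)) \<and> inj_on \<phi> {f. young f} \<and>
     (\<forall>f f'. young f \<longrightarrow> young f' \<longrightarrow> cover f f' \<longrightarrow> cover (\<phi> f) (\<phi> f'))"

lemma embedding_id: "embedding (\<lambda>f. f)"
  unfolding embedding_def by auto

lemma embedding_ins: "embedding \<phi> \<Longrightarrow> embedding (\<lambda>f. ins c (\<phi> f))"
  unfolding embedding_def inj_on_def using young_ins inj_ins cover_ins by (metis mem_Collect_eq)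

lemma embedding_plus: "embedding \<phi> \<Longrightarrow> young h \<Longrightarrow> embedding (\<lambda>f k. \<phi> f k + h k)"
  unfolding embedding_def inj_on_def using young_plus cover_plus by (simp add: fun_eq_iff)

text \<open>The partitions of \<open>n\<close>, grown box by box to match an induction on the number
  of isolated boxes.\<close>

fun shapes :: "nat \<Rightarrow> (nat \<Rightarrow> nat) set" where
  "shapes 0 = {\<lambda>_. 0}"
| "shapes (Suc n) = {f. young f \<and> (\<exists>f'\<in>shapes n. cover f' f)}"

lemma young_zero: "young (\<lambda>_. 0)"
  unfolding young_def by (simp add: antimonoI)

lemma young_shapes: "f \<in> shapes n \<Longrightarrow> young f"
  by (cases n) (auto simp: young_zero)

text \<open>In \<open>red_box\<close> the box \<open>(t, mu t)\<close> is alone in its row and in its column, and the rest of the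
  skew diagram lies strictly above and to the right or strictly below and to the left of it.\<close>

inductive red :: "nat \<Rightarrow> (nat \<Rightarrow> nat) \<Rightarrow> (nat \<Rightarrow> nat) \<Rightarrow> bool" where
  red_empty: "red 0 (\<lambda>_. 0) (\<lambda>_. 0)"
| red_row: "young lam \<Longrightarrow> young mu \<Longrightarrow> mu j \<le> lam i \<Longrightarrow> red n (del i lam) (del j mu) \<Longrightarrow> red n lam mu"
| red_col: "young lam \<Longrightarrow> young mu \<Longrightarrow> conjugate mu j \<le> conjugate lam i \<Longrightarrow> red n (cdel i lam) (cdel j mu) \<Longrightarrow>
    red n lam mu"
| red_box: "young lam \<Longrightarrow> young mu \<Longrightarrow> lam t = Suc (mu t) \<Longrightarrow> (\<And>k. k < t \<Longrightarrow> lam t \<le> mu k) \<Longrightarrow>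
    lam (Suc t) \<le> mu t \<Longrightarrow> red n (cdel (mu t) (del t lam)) (cdel (mu t) (del t mu)) \<Longrightarrow>
    red (Suc n) lam mu"

lemma red_embedding:
  assumes "red n lam mu"
  shows "\<exists>\<phi>. embedding \<phi> \<and> (\<forall>nu\<in>shapes n. LR lam mu (\<phi> nu))"
  using assms
proof induction
  case red_empty
  then show ?case using embedding_id LR_zero by auto
next
  case (red_row lam mu j i n)
  then obtain \<phi> where "embedding \<phi>" "\<forall>nu\<in>shapes n. LR (del i lam) (del j mu) (\<phi> nu)" by blast
  then show ?case using red_row.hyps LR_add_row embedding_ins by blast
next
  case (red_col lam mu j i n)
  then obtain \<phi> where "embedding \<phi>" "\<forall>nu\<in>shapes n. LR (cdel i lam) (cdel j mu) (\<phi> nu)" by blast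
  then show ?case using red_col.hyps LR_add_column embedding_plus[OF _ young_column]
    by (intro exI[of _ "\<lambda>f k. \<phi> f k + column (conjugate lam i - conjugate mu j) k"]) blast
next
  case (red_box lam mu t n)
  let ?h = "mu t" 
  let ?lam = "cdel ?h (del t lam)" and ?mu = "cdel ?h (del t mu)"
  obtain \<phi> where \<phi>: "embedding \<phi>" "\<forall>nu\<in>shapes n. LR ?lam ?mu (\<phi> nu)" using red_box by blast
  have lam: "(\<lambda>i. if i < t then Suc (?lam i) else if i = t then Suc ?h else ?lam (i - 1)) = lam"
  proof
    fix i
    have "i < t \<Longrightarrow> ?h < lam i" "t < i \<Longrightarrow> lam i \<le> ?h"
      using youngD[OF red_box.hyps(1), of i t] youngD[OF red_box.hyps(1), of "Suc t" i]
        red_box.hyps(3,5) by simp_all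
    then show "(if i < t then Suc (?lam i) else if i = t then Suc ?h else ?lam (i - 1)) = lam i"
      using red_box.hyps(3) by (auto simp: del_def cdel_def)
  qed
  have mu: "(\<lambda>i. if i < t then Suc (?mu i) else if i = t then ?h else ?mu (i - 1)) = mu"
  proof
    fix i
    have "i < t \<Longrightarrow> ?h < mu i" "t < i \<Longrightarrow> mu i \<le> ?h"
      using youngD[OF red_box.hyps(2), of t i] red_box.hyps(3) red_box.hyps(4)[of i] by simp_all
    then show "(if i < t then Suc (?mu i) else if i = t then ?h else ?mu (i - 1)) = mu i"
      by (auto simp: del_def cdel_def)
  qed
  \<comment> \<open>The map does not change in this step. As \<open>nu\<close> covers some
    \<open>f\<close> with \<open>n\<close> boxes, \<open>\<phi> nu\<close> is
    \<open>\<phi> f\<close> with one more box in some row \<open>r\<close>. Since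
    \<open>\<phi> f\<close> occurs in the smaller diagram and the isolated box allows every addable
    row, \<open>\<phi> nu\<close> occurs in the larger one.\<close>
  have "LR lam mu (\<phi> nu)" if nu: "nu \<in> shapes (Suc n)" for nu
  proof -
    obtain f where f: "f \<in> shapes n" "cover f nu" "young nu" using nu by auto
    then have "cover (\<phi> f) (\<phi> nu)" "young (\<phi> nu)"
      using \<phi>(1) young_shapes unfolding embedding_def by blast+
    then obtain r where r: "\<phi> nu = (\<phi> f)(r := Suc (\<phi> f r))" "young (\<phi> nu)" unfolding cover_def by blast
    have "r = 0 \<or> \<phi> f r < \<phi> f (r - 1)"
      using youngD[OF r(2), of "r - 1" r] unfolding r(1) by (cases r) auto
    moreover have "?h \<le> ?mu i" if "i < t" for i
      using red_box.hyps(3) red_box.hyps(4)[OF that] that by (auto simp: del_def cdel_def)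
    moreover have "?lam t \<le> ?h" using red_box.hyps(5) by (simp add: del_def cdel_def)
    moreover have "LR ?lam ?mu (\<phi> f)" using \<phi>(2) f(1) by blast
    ultimately have "LR lam mu ((\<phi> f)(r := Suc (\<phi> f r)))"
      using LR_insert_box[of ?lam ?mu "\<phi> f" r t ?h] young_cdel[OF young_del[OF red_box.hyps(1)]]
      unfolding lam mu by blast
    then show ?thesis using r(1) by simp
  qed
  then show ?case using \<phi>(1) by blast
qed

lemma del_cdel_commute: "cdel h (del t f) = del t (cdel h f)"
  by (auto simp: del_def cdel_def)

text \<open>Deletions of rows and of columns are exchanged, and an isolated box stays isolated, with
  its coordinates swapped. Steps found for rows are thereby available for columns.\<close>

lemma red_conjugate:
  assumes "red n lam mu"
  shows "red n (conjugate lam) (conjugate mu)"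
  using assms
proof induction
  case red_empty
  have "conjugate (\<lambda>_. 0) = (\<lambda>_. 0)" by (auto simp: conjugate_def)
  then show ?case using red.red_empty by simp
next
  case (red_row lam mu j i n)
  then show ?case by (intro red_col[of "conjugate lam" "conjugate mu" j i]) (simp_all add: young_conjugate conjugate_del)
next
  case (red_col lam mu j i n)
  then show ?case by (intro red_row[of "conjugate lam" "conjugate mu" j i]) (simp_all add: young_conjugate conjugate_cdel)
next
  case (red_box lam mu t n)
  note y = red_box.hyps(1,2)
  have mu: "conjugate mu (mu t) = t"
    using red_box.hyps(3) red_box.hyps(4) youngD[OF y(2), of t]
    by (intro conjugate_eqI[OF y(2)]) (metis Suc_le_eq not_le)
  have lam: "conjugate lam (mu t) = Suc t"
    using red_box.hyps(3,5) youngD[OF y(1), of _ t] youngD[OF y(1), of "Suc t"]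
    by (intro conjugate_eqI[OF y(1)]) (metis Suc_leI le_trans lessI not_less not_less_eq)
  have *: "cdel t (del (mu t) (conjugate f)) = conjugate (cdel (mu t) (del t f))" if "young f" for f
    using that by (simp add: del_cdel_commute conjugate_del conjugate_cdel young_cdel young_del)
  show ?case
  proof (rule red.red_box[of "conjugate lam" "conjugate mu" "mu t"])
    show "conjugate lam (mu t) \<le> conjugate mu k" if "k < mu t" for k
      using that less_conjugate_iff[OF y(2), of t k] lam by simp
    show "conjugate lam (Suc (mu t)) \<le> conjugate mu (mu t)"
      using conjugate_le_iff[OF y(1), of "Suc (mu t)" t] red_box.hyps(3) mu by simp
    show "red n (cdel (conjugate mu (mu t)) (del (mu t) (conjugate lam))) (cdel (conjugate mu (mu t)) (del (mu t) (conjugate mu)))"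
      unfolding mu using red_box.IH * y by simp
  qed (use y lam mu in \<open>simp_all add: young_conjugate\<close>)
qed

lemma red_conjugate_iff: "young lam \<Longrightarrow> young mu \<Longrightarrow> red n (conjugate lam) (conjugate mu) \<longleftrightarrow> red n lam mu"
  using red_conjugate by (metis conjugate_conjugate)

section \<open>Lists, diagrams and pairs that differ by one box\<close>

definition to_list :: "(nat \<Rightarrow> nat) \<Rightarrow> nat list" where
  "to_list f = map f [0..<conjugate f 0]"

lemma fn_to_list: "young f \<Longrightarrow> fn (to_list f) = f"
  unfolding to_list_def nth_default_def using less_conjugate_iff by (auto simp: fun_eq_iff)

lemma is_partition_to_list:
  assumes "young f"
  shows "is_partition (to_list f)"
  unfolding is_partition_def
proof
  show "sorted_wrt (\<ge>) (to_list f)"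
    unfolding sorted_wrt_iff_nth_less to_list_def using youngD[OF assms] by auto
  show "\<forall>x\<in>set (to_list f). 0 < x"
    unfolding to_list_def using less_conjugate_iff[OF assms] by auto
qed

lemma inj_fn: "is_partition nu \<Longrightarrow> is_partition nu' \<Longrightarrow> fn nu = fn nu' \<longleftrightarrow> nu = nu'"
proof
  assume p: "is_partition nu" "is_partition nu'" and eq: "fn nu = fn nu'"
  have "length nu = length nu'" using fn_pos_iff p eq by (metis linorder_neqE_nat less_irrefl)
  then show "nu = nu'" using eq by (metis nth_default_nth nth_equalityI)
qed simp

definition boxes :: "(nat \<Rightarrow> nat) \<Rightarrow> (nat \<times> nat) set" where
  "boxes f = {(i, j). j < f i}"

lemma diagram_eq_boxes: "diagram nu = boxes (fn nu)"
  unfolding diagram_def boxes_def ..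

lemma finite_boxes: assumes "young f" shows "finite (boxes f)"
proof (rule finite_subset)
  show "boxes f \<subseteq> {..<conjugate f 0} \<times> {..<f 0}"
  proof
    fix x assume "x \<in> boxes f"
    then obtain i j where "x = (i, j)" "j < f i" unfolding boxes_def by blast
    then show "x \<in> {..<conjugate f 0} \<times> {..<f 0}"
      using less_conjugate_iff[OF assms, of i 0] youngD[OF assms, of 0 i] by simp
  qed
qed auto

lemma card_diagram: "card (diagram nu) = sum_list nu"
proof -
  have "diagram nu = (SIGMA i:{..<length nu}. {..<nu ! i})"
    unfolding diagram_def by (auto simp: nth_default_def split: if_splits)
  then show ?thesis by (simp add: sum_list_sum_nth card_SigmaI atLeast0LessThan)
qed

lemma boxes_upd: "boxes (f(r := Suc (f r))) = insert (r, f r) (boxes f)"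
  unfolding boxes_def by (auto split: if_splits)

lemma card_boxes_cover: "young f \<Longrightarrow> cover f f' \<Longrightarrow> card (boxes f') = Suc (card (boxes f))"
  unfolding cover_def using finite_boxes by (auto simp: boxes_upd) (simp add: boxes_def)

lemma coverI:
  assumes "young f'" "\<And>i. f i \<le> f' i" "card (boxes f') = Suc (card (boxes f))"
  shows "cover f f'"
proof -
  have sub: "boxes f \<subseteq> boxes f'" using assms(2) unfolding boxes_def by (auto intro: less_le_trans)
  have fin: "finite (boxes f')" using finite_boxes assms(1) .
  then have "card (boxes f' - boxes f) = 1"
    using assms(3) sub by (simp add: card_Diff_subset finite_subset)
  then obtain x where "boxes f' - boxes f = {x}" using card_1_singletonE by blast
  moreover obtain r c where "x = (r, c)" by (cases x)
  ultimately have rc: "boxes f' - boxes f = {(r, c)}" by simp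
  have 1: "i = r \<and> j = c" if "f i \<le> j" "j < f' i" for i j
  proof -
    have "(i, j) \<in> boxes f' - boxes f" using that unfolding boxes_def by simp
    then show ?thesis using rc by simp
  qed
  have "(r, c) \<in> boxes f' - boxes f" using rc by blast
  then have r: "f r \<le> c" "c < f' r" unfolding boxes_def by auto
  have "f' i = f i" if "i \<noteq> r" for i
    using 1[of i "f i"] assms(2)[of i] that by (metis le_eq_less_or_eq order_refl)
  moreover have "f' r = Suc (f r)"
    using 1[of r "f r"] 1[of r "Suc (f r)"] r by (metis Suc_leI Suc_n_not_le_n le_eq_less_or_eq le_less_trans le_SucI order_refl)
  ultimately show ?thesis unfolding cover_def by (intro exI[of _ r]) auto
qed

lemma mem_shapes:
  assumes "young f"
  shows "f \<in> shapes (card (boxes f))"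
  using assms
proof (induction "card (boxes f)" arbitrary: f)
  case 0
  then have "boxes f = {}" using finite_boxes by auto
  then have "f i = 0" for i unfolding boxes_def by (auto simp: set_eq_iff)
  then show ?case using 0(1) by (auto simp flip: 0(1))
next
  case (Suc n)
  have "conjugate f 0 \<noteq> 0"
  proof
    assume "conjugate f 0 = 0"
    then have "boxes f = {}" using less_conjugate_iff[OF Suc.prems, of _ 0] unfolding boxes_def by fastforce
    then show False using Suc.hyps(2) by simp
  qed
  then obtain i where i: "conjugate f 0 = Suc i" by (cases "conjugate f 0") auto
  then obtain m where m: "f i = Suc m" using less_conjugate_iff[OF Suc.prems, of i 0] by (cases "f i") auto
  have z: "f k = 0" if "i < k" for k using less_conjugate_iff[OF Suc.prems, of k 0] i that by auto
  let ?f = "f(i := m)"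
  have "young ?f"
    unfolding young_def
  proof
    show "antimono ?f"
    proof (rule antimonoI)
      fix k l :: nat assume "k \<le> l"
      then show "?f l \<le> ?f k" using youngD[OF Suc.prems, of k l] z[of l] m by auto
    qed
    show "\<exists>n. ?f n = 0" using z[of "Suc i"] by (intro exI[of _ "Suc i"]) simp
  qed
  moreover have "cover ?f f" unfolding cover_def by (rule exI[of _ i]) (simp add: m fun_upd_idem)
  ultimately have "?f \<in> shapes n" using Suc.hyps card_boxes_cover[of ?f f] by simp
  then show ?case using \<open>cover ?f f\<close> Suc.prems Suc.hyps(2) by (auto simp flip: Suc.hyps(2))
qed

text \<open>The common lower neighbour is the intersection, that is, the pointwise minimum of the
  parts. In this form the relation is carried along by every map that preserves covers and is
  injective.\<close>

lemma differ_by_one_box_iff: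
  assumes "is_partition nu1" "is_partition nu2"
  shows "differ_by_one_box nu1 nu2 \<longleftrightarrow>
    nu1 \<noteq> nu2 \<and> (\<exists>f. young f \<and> cover f (fn nu1) \<and> cover f (fn nu2))"
proof
  let ?f = "\<lambda>i. min (fn nu1 i) (fn nu2 i)"
  have y: "young (fn nu1)" "young (fn nu2)" using assms young_fn by blast+
  assume d: "differ_by_one_box nu1 nu2"
  have "young ?f"
    unfolding young_def
  proof
    show "antimono ?f"
      using youngD[OF y(1)] youngD[OF y(2)] by (intro antimonoI) (auto simp: min_le_iff_disj)
    show "\<exists>n. ?f n = 0" by (rule exI[of _ "length nu1"]) (simp add: nth_default_def)
  qed
  moreover have b: "boxes ?f = diagram nu1 \<inter> diagram nu2" unfolding boxes_def diagram_def by auto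
  moreover have "card (boxes (fn nu1)) = Suc (card (boxes ?f))" "card (boxes (fn nu2)) = Suc (card (boxes ?f))"
    using d unfolding differ_by_one_box_def b by (simp_all add: card_diagram flip: diagram_eq_boxes)
  then have "cover ?f (fn nu1)" "cover ?f (fn nu2)"
    using coverI y by simp_all
  moreover have "nu1 \<noteq> nu2" using d unfolding differ_by_one_box_def by (auto simp: card_diagram)
  ultimately show "nu1 \<noteq> nu2 \<and> (\<exists>f. young f \<and> cover f (fn nu1) \<and> cover f (fn nu2))" by blast
next
  assume "nu1 \<noteq> nu2 \<and> (\<exists>f. young f \<and> cover f (fn nu1) \<and> cover f (fn nu2))"
  then obtain f where f: "nu1 \<noteq> nu2" "young f" "cover f (fn nu1)" "cover f (fn nu2)" by blast
  obtain r s where rs: "fn nu1 = f(r := Suc (f r))" "fn nu2 = f(s := Suc (f s))"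
    using f(3,4) unfolding cover_def by blast
  have "r \<noteq> s" using rs f(1) inj_fn[OF assms] by auto
  then have "diagram nu1 \<inter> diagram nu2 = boxes f"
    unfolding diagram_eq_boxes rs boxes_upd by (auto simp: boxes_def)
  then show "differ_by_one_box nu1 nu2"
    unfolding differ_by_one_box_def
    using card_boxes_cover[OF f(2,3)] card_boxes_cover[OF f(2,4)]
    by (simp add: card_diagram flip: diagram_eq_boxes)
qed

lemma finite_components: "finite (components lam mu)"
proof (rule finite_subset)
  let ?N = "card (skew_diagram lam mu)"
  show "components lam mu \<subseteq> {xs. set xs \<subseteq> {..?N} \<and> length xs \<le> ?N}"
  proof
    fix nu assume "nu \<in> components lam mu"
    then have nu: "is_partition nu" "lr_coeff lam mu nu \<noteq> 0" unfolding components_def by auto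
    then obtain T where T: "has_content lam mu T nu"
      unfolding lr_coeff_def by (metis (mono_tags, lifting) card.empty empty_Collect_eq)
    have c: "card {x \<in> skew_diagram lam mu. T x = Suc k} = fn nu k" for k
      using T unfolding has_content_def by blast
    have "set nu \<subseteq> {..?N}"
    proof
      fix x assume "x \<in> set nu"
      then obtain k where "k < length nu" "x = nu ! k" by (auto simp: in_set_conv_nth)
      then have "x = card {x \<in> skew_diagram lam mu. T x = Suc k}" unfolding c by (simp add: nth_default_def)
      also have "\<dots> \<le> ?N" by (rule card_mono[OF finite_skew]) auto
      finally show "x \<in> {..?N}" by simp
    qed
    moreover have "length nu \<le> ?N"
    proof -
      have "Suc ` {..<length nu} \<subseteq> T ` skew_diagram lam mu"
      proof
        fix v assume "v \<in> Suc ` {..<length nu}"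
        then obtain k where k: "k < length nu" "v = Suc k" by auto
        then have "card {x \<in> skew_diagram lam mu. T x = Suc k} \<noteq> 0"
          using c[of k] fn_pos_iff[OF nu(1), of k] by simp
        then have "{x \<in> skew_diagram lam mu. T x = Suc k} \<noteq> {}" by (metis card.empty)
        then obtain x where "x \<in> skew_diagram lam mu" "T x = v" using k by blast
        then show "v \<in> T ` skew_diagram lam mu" by blast
      qed
      then have "card (Suc ` {..<length nu}) \<le> ?N"
        by (meson card_image_le card_mono finite_imageI finite_skew le_trans)
      then show ?thesis by (simp add: card_image)
    qed
    ultimately show "nu \<in> {xs. set xs \<subseteq> {..?N} \<and> length xs \<le> ?N}" by simp
  qed
  show "finite {xs :: nat list. set xs \<subseteq> {..?N} \<and> length xs \<le> ?N}"
    by (rule finite_lists_length_le) simp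
qed

lemma finite_neighbour_pairs: "finite P \<Longrightarrow> finite (neighbour_pairs P)"
  by (rule finite_subset[of _ "Pow P"]) (auto simp: neighbour_pairs_def)

lemma card_neighbour_pairs_mono:
  assumes "finite Q" "inj_on \<Phi> P" "\<And>x. x \<in> P \<Longrightarrow> \<Phi> x \<in> Q"
    and "\<And>x y. x \<in> P \<Longrightarrow> y \<in> P \<Longrightarrow> differ_by_one_box x y \<Longrightarrow> differ_by_one_box (\<Phi> x) (\<Phi> y)"
  shows "card (neighbour_pairs P) \<le> card (neighbour_pairs Q)"
proof (rule card_inj_on_le)
  show "inj_on ((`) \<Phi>) (neighbour_pairs P)"
    by (rule inj_on_subset[OF inj_on_image_Pow[OF assms(2)]]) (auto simp: neighbour_pairs_def)
  show "(`) \<Phi> ` neighbour_pairs P \<subseteq> neighbour_pairs Q"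
  proof
    fix A assume "A \<in> (`) \<Phi> ` neighbour_pairs P"
    then obtain x y where "A = {\<Phi> x, \<Phi> y}" "x \<in> P" "y \<in> P" "differ_by_one_box x y"
      unfolding neighbour_pairs_def by auto
    then show "A \<in> neighbour_pairs Q" unfolding neighbour_pairs_def using assms(3,4) by blast
  qed
qed (rule finite_neighbour_pairs[OF assms(1)])

theorem g_le_if_red:
  assumes "is_partition lam" "is_partition mu" "\<And>i. fn mu i \<le> fn lam i" "red n (fn lam) (fn mu)"
  shows "g n \<le> card (neighbour_pairs (components lam mu))"
proof -
  obtain \<phi> where \<phi>: "embedding \<phi>" "\<And>nu. nu \<in> shapes n \<Longrightarrow> LR (fn lam) (fn mu) (\<phi> nu)"
    using red_embedding[OF assms(4)] by blast
  have young: "young (\<phi> f)" if "young f" for f using \<phi>(1) that unfolding embedding_def by blast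
  have inj: "\<phi> f = \<phi> f' \<longleftrightarrow> f = f'" if "young f" "young f'" for f f'
    using \<phi>(1) that unfolding embedding_def inj_on_def by blast
  let ?\<Phi> = "\<lambda>nu. to_list (\<phi> (fn nu))"
  have fn: "fn (?\<Phi> nu) = \<phi> (fn nu)" "is_partition (?\<Phi> nu)" if "is_partition nu" for nu
    using that young young_fn fn_to_list is_partition_to_list by blast+
  have inj': "?\<Phi> nu = ?\<Phi> nu' \<longleftrightarrow> nu = nu'" if "is_partition nu" "is_partition nu'" for nu nu'
    using that fn inj inj_fn young_fn by metis
  show ?thesis
    unfolding g_def
  proof (rule card_neighbour_pairs_mono[where \<Phi> = ?\<Phi>])
    show "inj_on ?\<Phi> {nu. is_partition nu \<and> sum_list nu = n}"
      using inj' by (auto simp: inj_on_def)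
    fix x assume x: "x \<in> {nu. is_partition nu \<and> sum_list nu = n}"
    then have "fn x \<in> shapes n" using mem_shapes[OF young_fn, of x]
      by (simp add: card_diagram flip: diagram_eq_boxes)
    then show "?\<Phi> x \<in> components lam mu"
      using components_iff[OF assms(1-3)] fn x \<phi>(2) by simp
    fix y assume y: "y \<in> {nu. is_partition nu \<and> sum_list nu = n}" and d: "differ_by_one_box x y"
    have p: "is_partition x" "is_partition y" using x y by auto
    obtain f where "x \<noteq> y" "young f" "cover f (fn x)" "cover f (fn y)"
      using d differ_by_one_box_iff[OF p] by blast
    then have "young (\<phi> f)" "cover (\<phi> f) (\<phi> (fn x))" "cover (\<phi> f) (\<phi> (fn y))" "?\<Phi> x \<noteq> ?\<Phi> y"
      using \<phi>(1) young_fn p inj'[OF p] unfolding embedding_def by blast+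
    then show "differ_by_one_box (?\<Phi> x) (?\<Phi> y)"
      using differ_by_one_box_iff[OF fn(2)[OF p(1)] fn(2)[OF p(2)]] fn(1) p by auto
  qed (rule finite_components)
qed

section \<open>Every basic skew diagram can be reduced\<close>

definition basic_shape :: "(nat \<Rightarrow> nat) \<Rightarrow> (nat \<Rightarrow> nat) \<Rightarrow> bool" where
  "basic_shape lam mu \<longleftrightarrow> (\<forall>i. mu i \<le> lam (Suc i) \<and> (0 < lam i \<longrightarrow> mu i < lam i))"

lemma basic_shapeD: "basic_shape lam mu \<Longrightarrow> mu i \<le> lam (Suc i)" "basic_shape lam mu \<Longrightarrow> 0 < lam i \<Longrightarrow> mu i < lam i"
  unfolding basic_shape_def by auto

lemma basic_shape_le: "young lam \<Longrightarrow> basic_shape lam mu \<Longrightarrow> mu i \<le> lam i"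
  using basic_shapeD(1)[of lam mu i] youngD[of lam i "Suc i"] by simp

text \<open>One condition excludes empty columns, the other empty rows; conjugation exchanges
  them.\<close>

lemma basic_shape_conjugate:
  assumes y: "young lam" "young mu" and b: "basic_shape lam mu"
  shows "basic_shape (conjugate lam) (conjugate mu)"
  unfolding basic_shape_def
proof (intro allI conjI impI)
  fix j
  show "conjugate mu j \<le> conjugate lam (Suc j)"
  proof (rule ccontr)
    assume "\<not> conjugate mu j \<le> conjugate lam (Suc j)"
    then have "j < mu (conjugate lam (Suc j))" "lam (conjugate lam (Suc j)) \<le> Suc j"
      using less_conjugate_iff[OF y(2)] conjugate_le_iff[OF y(1)] by (metis not_le, blast)
    then show False using basic_shapeD[OF b, of "conjugate lam (Suc j)"] basic_shape_le[OF y(1) b, of "conjugate lam (Suc j)"] by linarith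
  qed
  assume pos: "0 < conjugate lam j"
  show "conjugate mu j < conjugate lam j"
  proof (cases "conjugate mu j")
    case 0
    then show ?thesis using pos by simp
  next
    case (Suc i)
    then have "j < mu i" using less_conjugate_iff[OF y(2), of i j] by simp
    then show ?thesis using Suc basic_shapeD(1)[OF b, of i] less_conjugate_iff[OF y(1), of "Suc i" j] by simp
  qed
qed

section \<open>Corners and repeated parts\<close>

definition corners :: "(nat \<Rightarrow> nat) \<Rightarrow> nat set" where
  "corners f = {i. f (Suc i) < f i}"

lemma corners_subset: "young f \<Longrightarrow> corners f \<subseteq> {..<conjugate f 0}"
  using less_conjugate_iff unfolding corners_def by fastforce

lemma finite_corners: "young f \<Longrightarrow> finite (corners f)"
  using corners_subset finite_subset by blast

text \<open>A corner at the end of row \<open>i\<close> is also the one at the bottom of column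
  \<open>f i - 1\<close>.\<close>

lemma card_corners_conjugate:
  assumes "young f"
  shows "card (corners (conjugate f)) = card (corners f)"
proof -
  have le: "card (corners f) \<le> card (corners (conjugate f))" if y: "young f" for f
  proof (rule card_inj_on_le)
    show "inj_on (\<lambda>i. f i - 1) (corners f)"
    proof (rule linorder_inj_onI)
      fix i k assume "i < k" "i \<in> corners f" "k \<in> corners f"
      then have "f k \<le> f (Suc i)" "f (Suc i) < f i" "0 < f k"
        using youngD[OF y, of "Suc i" k] unfolding corners_def by auto
      then show "f i - 1 \<noteq> f k - 1" by simp
    qed (rule linear)
    show "(\<lambda>i. f i - 1) ` corners f \<subseteq> corners (conjugate f)"
    proof
      fix j assume "j \<in> (\<lambda>i. f i - 1) ` corners f"
      then obtain i where "f (Suc i) < f i" "j = f i - 1" unfolding corners_def by auto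
      then have "i < conjugate f j" "conjugate f (Suc j) \<le> i"
        using less_conjugate_iff[OF y, of i j] conjugate_le_iff[OF y, of "Suc j" i] by auto
      then show "j \<in> corners (conjugate f)" unfolding corners_def by simp
    qed
  qed (rule finite_corners[OF young_conjugate[OF y]])
  show ?thesis using le[OF assms] le[OF young_conjugate[OF assms]] assms by simp
qed

text \<open>The number in \<open>f\<close> of row \<open>k\<close> of
  \<open>del i f\<close>.\<close>

definition skip :: "nat \<Rightarrow> nat \<Rightarrow> nat" where
  "skip i k = (if k < i then k else Suc k)"

lemma inj_skip: "inj (skip i)"
  by (rule injI) (auto simp: skip_def split: if_splits)

lemma card_corners_del_flat:
  assumes "young f" "f (Suc i) = f i"
  shows "card (corners (del i f)) = card (corners f)"
proof -
  have "corners f = skip i ` corners (del i f)"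
  proof (intro set_eqI iffI)
    fix k assume k: "k \<in> corners f"
    then have "k \<noteq> i" using assms(2) unfolding corners_def by auto
    then consider "k < i" | "i < k" by linarith
    then show "k \<in> skip i ` corners (del i f)"
    proof cases
      case 1
      then show ?thesis using k assms(2)
        by (intro image_eqI[of _ _ k]) (auto simp: skip_def corners_def del_def not_less less_Suc_eq le_less)
    next
      case 2
      then show ?thesis using k
        by (intro image_eqI[of _ _ "k - 1"]) (auto simp: skip_def corners_def del_def)
    qed
  next
    fix k assume "k \<in> skip i ` corners (del i f)"
    then obtain l where l: "l \<in> corners (del i f)" "k = skip i l" by blast
    consider "Suc l < i" | "Suc l = i" | "i \<le> l" by linarith
    then show "k \<in> corners f"
      by cases (use l assms(2) in \<open>auto simp: corners_def del_def skip_def\<close>)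
  qed
  then show ?thesis by (metis card_image inj_on_subset inj_skip subset_UNIV)
qed

lemma card_corners_del_ge:
  assumes "young f"
  shows "card (corners f) \<le> Suc (card (corners (del i f)))"
proof -
  have "corners f - {i} \<subseteq> skip i ` corners (del i f)"
  proof
    fix k assume k: "k \<in> corners f - {i}"
    then consider "Suc k < i" | "Suc k = i" | "i < k" by fastforce
    then show "k \<in> skip i ` corners (del i f)"
    proof cases
      case 3
      then show ?thesis using k
        by (intro image_eqI[of _ _ "k - 1"]) (auto simp: skip_def corners_def del_def)
    next
      case 2
      then show ?thesis using k youngD[OF assms, of i "Suc i"]
        by (intro image_eqI[of _ _ k]) (auto simp: skip_def corners_def del_def)
    qed (use k in \<open>auto simp: skip_def corners_def del_def intro!: image_eqI[of _ _ k]\<close>)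
  qed
  then have "card (corners f - {i}) \<le> card (skip i ` corners (del i f))"
    by (rule card_mono[OF finite_imageI[OF finite_corners[OF young_del[OF assms]]]])
  also have "\<dots> = card (corners (del i f))" by (metis card_image inj_on_subset inj_skip subset_UNIV)
  finally show ?thesis using finite_corners[OF assms] by (simp add: card_Diff_singleton_if split: if_splits)
qed

text \<open>Rows of \<open>mu\<close> of length 0 count as repeated, too, as long as they belong to nonempty rows of \<open>lam\<close>.\<close>

definition outer_dup :: "(nat \<Rightarrow> nat) \<Rightarrow> nat set" where
  "outer_dup lam = {i. 0 < lam i \<and> lam (Suc i) = lam i}"

definition inner_dup :: "(nat \<Rightarrow> nat) \<Rightarrow> (nat \<Rightarrow> nat) \<Rightarrow> nat set" where
  "inner_dup lam mu = {i. 0 < lam (Suc i) \<and> mu (Suc i) = mu i}"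

lemma card_outer_dup:
  assumes "young lam"
  shows "finite (outer_dup lam)" "card (outer_dup lam) + card (corners lam) = conjugate lam 0"
proof -
  have eq: "outer_dup lam \<union> corners lam = {..<conjugate lam 0}"
    using less_conjugate_iff[OF assms, of _ 0] youngD[OF assms, of i "Suc i" for i]
    by (auto simp: outer_dup_def corners_def le_less)
  then show fin: "finite (outer_dup lam)" by (metis finite_Un finite_lessThan)
  have "outer_dup lam \<inter> corners lam = {}" by (auto simp: outer_dup_def corners_def)
  then show "card (outer_dup lam) + card (corners lam) = conjugate lam 0"
    using card_Un_disjoint[OF fin finite_corners[OF assms]] eq by simp
qed

text \<open>With \<open>l\<close> rows in \<open>lam\<close>, only the first \<open>l - 1\<close>
  rows can be corners of \<open>mu\<close>, since below a nonempty row of \<open>mu\<close> there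
  must be a nonempty row of \<open>lam\<close>.\<close>

lemma card_inner_dup:
  assumes "young lam" "young mu" "basic_shape lam mu"
  shows "finite (inner_dup lam mu)" "card (inner_dup lam mu) + card (corners mu) = conjugate lam 0 - 1"
proof -
  have "i \<in> inner_dup lam mu \<union> corners mu \<longleftrightarrow> i < conjugate lam 0 - 1" for i
  proof -
    have "i < conjugate lam 0 - 1 \<longleftrightarrow> 0 < lam (Suc i)" using less_conjugate_iff[OF assms(1), of "Suc i" 0] by auto
    moreover have "mu (Suc i) \<le> mu i" using youngD[OF assms(2)] by simp
    moreover have "mu i \<le> lam (Suc i)" using basic_shapeD(1)[OF assms(3)] .
    ultimately show ?thesis by (auto simp: inner_dup_def corners_def)
  qed
  then have eq: "inner_dup lam mu \<union> corners mu = {..<conjugate lam 0 - 1}" by blast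
  then show fin: "finite (inner_dup lam mu)" by (metis finite_Un finite_lessThan)
  have "inner_dup lam mu \<inter> corners mu = {}" by (auto simp: inner_dup_def corners_def)
  then show "card (inner_dup lam mu) + card (corners mu) = conjugate lam 0 - 1"
    using card_Un_disjoint[OF fin finite_corners[OF assms(2)]] eq by simp
qed

text \<open>Between the two deleted rows \<open>mu\<close> moves up relative to \<open>lam\<close>,
  so the rows of the skew diagram there only grow: deletion in this order is always
  harmless.\<close>

lemma basic_shape_del_less:
  assumes "young lam" "basic_shape lam mu" "i' < i"
  shows "basic_shape (del i lam) (del i' mu)"
  unfolding basic_shape_def
proof (intro allI)
  fix k
  have b: "mu k \<le> lam (Suc k)" "0 < lam k \<longrightarrow> mu k < lam k" "mu (Suc k) \<le> lam (Suc (Suc k))"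
    "0 < lam (Suc k) \<longrightarrow> mu (Suc k) < lam (Suc k)"
    using basic_shapeD[OF assms(2)] by blast+
  have d: "lam (Suc k) \<le> lam k" "lam (Suc (Suc k)) \<le> lam (Suc k)" using youngD[OF assms(1)] by simp_all
  show "del i' mu k \<le> del i lam (Suc k) \<and> (0 < del i lam k \<longrightarrow> del i' mu k < del i lam k)"
    using assms(3) b d unfolding del_def by auto
qed

lemma basic_shape_del_same:
  assumes "young lam" "basic_shape lam mu" "lam (Suc i) = lam i"
  shows "basic_shape (del i lam) (del i mu)"
  unfolding basic_shape_def
proof (intro allI)
  fix k
  have b: "mu k \<le> lam (Suc k)" "0 < lam k \<longrightarrow> mu k < lam k" "mu (Suc k) \<le> lam (Suc (Suc k))"
    "0 < lam (Suc k) \<longrightarrow> mu (Suc k) < lam (Suc k)"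
    using basic_shapeD[OF assms(2)] by blast+
  consider "Suc k < i" | "Suc k = i" | "i \<le> k" by linarith
  then show "del i mu k \<le> del i lam (Suc k) \<and> (0 < del i lam k \<longrightarrow> del i mu k < del i lam k)"
    by cases (use b assms(3) in \<open>auto simp: del_def\<close>)
qed

text \<open>Between \<open>i\<close> and \<open>i'\<close> the partition \<open>lam\<close> moves up
  relative to \<open>mu\<close>. Row \<open>j\<close> then ends at \<open>lam (j + 1)\<close> and
  the next one at \<open>lam (j + 2)\<close>, and the last assumption prevents empty rows and
  columns there.\<close>

lemma basic_shape_del_greater:
  assumes "basic_shape lam mu" "lam (Suc i) = lam i" "i < i'"
    and "\<And>j. i \<le> j \<Longrightarrow> j < i' \<Longrightarrow> mu j < lam (Suc j) \<and> mu j \<le> lam (Suc (Suc j))"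
  shows "basic_shape (del i lam) (del i' mu)"
  unfolding basic_shape_def
proof (intro allI)
  fix k
  have b: "mu k \<le> lam (Suc k)" "0 < lam k \<longrightarrow> mu k < lam k" "mu (Suc k) \<le> lam (Suc (Suc k))"
    "0 < lam (Suc k) \<longrightarrow> mu (Suc k) < lam (Suc k)"
    using basic_shapeD[OF assms(1)] by blast+
  consider "Suc k < i" | "Suc k = i" | "i \<le> k" "k < i'" | "i' \<le> k" by linarith
  then show "del i' mu k \<le> del i lam (Suc k) \<and> (0 < del i lam k \<longrightarrow> del i' mu k < del i lam k)"
    by cases (use b assms(2-4) in \<open>auto simp: del_def\<close>)
qed

section \<open>One step of the dismantling, measured by a quantity invariant under
  conjugation\<close>

definition semiperimeter :: "(nat \<Rightarrow> nat) \<Rightarrow> nat" where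
  "semiperimeter f = f 0 + conjugate f 0"

lemma semiperimeter_conjugate: "young f \<Longrightarrow> semiperimeter (conjugate f) = semiperimeter f"
  unfolding semiperimeter_def by simp

lemma semiperimeter_del:
  assumes "young f" "0 < f i"
  shows "semiperimeter (del i f) < semiperimeter f"
proof -
  have "i < conjugate f 0" using assms less_conjugate_iff by blast
  moreover have "del i f 0 \<le> f 0" using youngD[OF assms(1), of 0 1] by (simp add: del_def)
  ultimately show ?thesis unfolding semiperimeter_def by (simp add: conjugate_del assms(1) cdel_def)
qed

text \<open>Either both corner numbers are kept, or both fall by one together with an isolated box,
  so their difference is preserved. The first alternative is there for the last box, when
  \<open>mu\<close> has no corner left to lose.\<close>

definition reducible :: "(nat \<Rightarrow> nat) \<Rightarrow> (nat \<Rightarrow> nat) \<Rightarrow> bool" where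
  "reducible lam mu \<longleftrightarrow> (card (corners lam) = 1 \<and> card (corners mu) = 0 \<and> red 1 lam mu) \<or>
     (\<exists>lam' mu'. young lam' \<and> young mu' \<and> basic_shape lam' mu' \<and> semiperimeter lam' < semiperimeter lam \<and>
       (card (corners lam') = card (corners lam) \<and> card (corners mu') = card (corners mu) \<and>
          (\<forall>n. red n lam' mu' \<longrightarrow> red n lam mu) \<or>
        Suc (card (corners lam')) = card (corners lam) \<and> Suc (card (corners mu')) = card (corners mu) \<and>
          (\<forall>n. red n lam' mu' \<longrightarrow> red (Suc n) lam mu)))"

lemma reducible_conjugate:
  assumes "young lam" "young mu" "reducible (conjugate lam) (conjugate mu)"
  shows "reducible lam mu"
  using assms(3) unfolding reducible_def
proof (elim disjE exE conjE, goal_cases)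
  case 1
  then show ?case using assms(1,2) by (simp add: card_corners_conjugate red_conjugate_iff)
next
  case (2 lam' mu')
  then show ?case using assms(1,2) red_conjugate[of _ "conjugate lam'" "conjugate mu'"]
    by (intro disjI2 exI[of _ "conjugate lam'"] exI[of _ "conjugate mu'"])
      (simp add: card_corners_conjugate red_conjugate_iff young_conjugate basic_shape_conjugate semiperimeter_conjugate)
next
  case (3 lam' mu')
  then show ?case using assms(1,2) red_conjugate[of _ "conjugate lam'" "conjugate mu'"]
    by (intro disjI2 exI[of _ "conjugate lam'"] exI[of _ "conjugate mu'"])
      (simp add: card_corners_conjugate red_conjugate_iff young_conjugate basic_shape_conjugate semiperimeter_conjugate)
qed

lemma reducible_del:
  assumes "young lam" "young mu" "i \<in> outer_dup lam" "i' \<in> inner_dup lam mu" "mu i' \<le> lam i"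
    and "basic_shape (del i lam) (del i' mu)"
  shows "reducible lam mu"
  unfolding reducible_def
  using assms red_row[OF assms(1,2,5)] young_del[OF assms(1), of i] young_del[OF assms(2), of i']
    semiperimeter_del[OF assms(1), of i] card_corners_del_flat[OF assms(1), of i] card_corners_del_flat[OF assms(2), of i']
  by (intro disjI2 exI[of _ "del i lam"] exI[of _ "del i' mu"]) (auto simp: outer_dup_def inner_dup_def)

lemma reducible_ge:
  assumes "young lam" "young mu" "basic_shape lam mu" "i \<in> outer_dup lam" "i' \<in> inner_dup lam mu"
    "i' \<le> i" "mu i' \<le> lam i"
  shows "reducible lam mu"
proof (rule reducible_del[OF assms(1,2,4,5,7)])
  show "basic_shape (del i lam) (del i' mu)"
    using basic_shape_del_less[OF assms(1,3)] basic_shape_del_same[OF assms(1,3), of i] assms(4,6)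
    by (cases "i' = i") (auto simp: outer_dup_def)
qed

lemma conjugate_eq:
  assumes "young f" "f n \<le> j" "n = 0 \<or> j < f (n - 1)"
  shows "conjugate f j = n"
proof (rule antisym)
  show "conjugate f j \<le> n" using conjugate_le_iff[OF assms(1)] assms(2) by blast
  show "n \<le> conjugate f j" using less_conjugate_iff[OF assms(1), of "n - 1" j] assms(3) by auto
qed

lemma reducible_conjugate_ge:
  assumes "young lam" "young mu" "basic_shape lam mu" "c \<in> outer_dup (conjugate lam)"
    "c' \<in> inner_dup (conjugate lam) (conjugate mu)" "c' \<le> c" "conjugate mu c' \<le> conjugate lam c"
  shows "reducible lam mu"
  using reducible_ge[OF young_conjugate[OF assms(1)] young_conjugate[OF assms(2)] basic_shape_conjugate[OF assms(1-3)] assms(4-7)]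
    reducible_conjugate[OF assms(1,2)] by blast

text \<open>If the diagram is connected between a repeated row of \<open>lam\<close> and a repeated row of \<open>mu\<close> below it
  (no \<open>j\<close> with \<open>mu j = lam (Suc j)\<close>), then a closest such pair can be deleted, unless this leaves an
  empty column; in that case there are repeated columns that can be deleted.\<close>

lemma reducible_less_untied:
  assumes y: "young lam" "young mu" and b: "basic_shape lam mu"
    and "i \<in> outer_dup lam" "i' \<in> inner_dup lam mu" "i < i'"
    and "\<And>j. i \<le> j \<Longrightarrow> j < i' \<Longrightarrow> mu j < lam (Suc j)"
  shows "reducible lam mu"
  using assms(4-7)
proof (induction "i' - i" arbitrary: i i' rule: less_induct)
  case less
  note L = less.prems(1) and M = less.prems(2)
  have le: "mu k \<le> lam k" for k using basic_shape_le[OF y(1) b] .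
  consider (L) k where "k \<in> outer_dup lam" "i < k" "k \<le> i'" | (M) k where "k \<in> inner_dup lam mu" "i \<le> k" "k < i'"
    | (none) "\<And>k. i < k \<Longrightarrow> k \<le> i' \<Longrightarrow> k \<notin> outer_dup lam" "\<And>k. i \<le> k \<Longrightarrow> k < i' \<Longrightarrow> k \<notin> inner_dup lam mu"
    by blast
  then show ?case
  proof cases
    case (L k)
    show ?thesis
    proof (cases "k = i'")
      case True
      then show ?thesis using reducible_ge[OF y b L(1) M] le[of i'] by simp
    next
      case False
      have "i' - k < i' - i" "k < i'" using L(2,3) False by simp_all
      then show ?thesis using less.hyps[of i' k] L M less.prems(4) by simp
    qed
  next
    case (M k)
    show ?thesis
    proof (cases "k = i")
      case True
      then show ?thesis using reducible_ge[OF y b less.prems(1) M(1)] le[of i] by simp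
    next
      case False
      have "k - i < i' - i" "i < k" using M(2,3) False by simp_all
      then show ?thesis using less.hyps[of k i] less.prems(1,4) M by simp
    qed
  next
    case none
    have pos: "0 < lam k" if "k \<le> Suc i'" for k
      using M youngD[OF y(1) that] by (simp add: inner_dup_def)
    have strict: "lam (Suc k) < lam k" if "i < k" "k \<le> i'" for k
      using none(1)[OF that] pos[of k] that youngD[OF y(1), of k "Suc k"] by (simp add: outer_dup_def)
    have flat: "lam (Suc i) = lam i" "mu (Suc i') = mu i'"
      using L M by (simp_all add: outer_dup_def inner_dup_def)
    show ?thesis
    proof (cases "\<exists>j. i \<le> j \<and> j < i' \<and> lam (Suc (Suc j)) < mu j")
      case False
      then have "basic_shape (del i lam) (del i' mu)"
        using basic_shape_del_greater[OF b flat(1) less.prems(3)] less.prems(4) by (metis not_le)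
      moreover have "mu i' \<le> lam i" using le[of i] youngD[OF y(2), of i i'] less.prems(3) by simp
      ultimately show ?thesis using reducible_del[OF y L M] by blast
    next
      case True
      then obtain j where j: "i \<le> j" "j < i'" "lam (Suc (Suc j)) < mu j" by blast
      \<comment> \<open>At the obstruction, columns \<open>?c\<close> and \<open>?c + 1\<close> of
        \<open>lam\<close> both have length \<open>j + 2\<close>, and columns \<open>?c - 1\<close>
        and \<open>?c\<close> of \<open>mu\<close> both have length \<open>j + 1\<close>. These are
        repeated columns in the harmless order.\<close>
      let ?c = "lam (Suc (Suc j))"
      have "mu j < lam (Suc j)" using less.prems(4) j by blast
      then have c: "Suc (Suc ?c) \<le> lam (Suc j)" using j(3) by simp
      have "mu (Suc j) < ?c"
      proof (cases "Suc j < i'")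
        case True
        then show ?thesis using less.prems(4)[of "Suc j"] j(1) by simp
      next
        case False
        then have "Suc j = i'" using j(2) by simp
        then show ?thesis using basic_shapeD(2)[OF b, of "Suc i'"] pos[of "Suc i'"] flat(2) by simp
      qed
      then obtain c' where c': "?c = Suc c'" "mu (Suc j) \<le> c'" by (cases ?c) auto
      have "conjugate lam ?c = Suc (Suc j)" "conjugate lam (Suc ?c) = Suc (Suc j)"
        using conjugate_eq[OF y(1), of "Suc (Suc j)"] c by simp_all
      moreover have "conjugate mu c' = Suc j" "conjugate mu (Suc c') = Suc j"
        using conjugate_eq[OF y(2), of "Suc j"] c' j(3) by simp_all
      ultimately show ?thesis using c'
        by (intro reducible_conjugate_ge[OF y b, of ?c c']) (simp_all add: outer_dup_def inner_dup_def)
    qed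
  qed
qed

lemma reducible_conjugate_less_untied:
  assumes "young lam" "young mu" "basic_shape lam mu" "c \<in> outer_dup (conjugate lam)"
    "c' \<in> inner_dup (conjugate lam) (conjugate mu)" "c < c'"
    "\<And>d. c \<le> d \<Longrightarrow> d < c' \<Longrightarrow> conjugate mu d < conjugate lam (Suc d)"
  shows "reducible lam mu"
  using reducible_less_untied[OF young_conjugate[OF assms(1)] young_conjugate[OF assms(2)] basic_shape_conjugate[OF assms(1-3)] assms(4-7)]
    reducible_conjugate[OF assms(1,2)] by blast

lemma reducible_box:
  assumes y: "young lam" "young mu" and b: "basic_shape lam mu"
    and t: "lam t = Suc (mu t)" "\<And>k. k < t \<Longrightarrow> lam t \<le> mu k" "lam (Suc t) \<le> mu t"
  shows "reducible lam mu"
proof -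
  define h where "h = mu t"
  let ?lam = "cdel h (del t lam)" and ?mu = "cdel h (del t mu)"
  have lam_t: "lam t = Suc h" using t(1) unfolding h_def .
  have lam_Suc: "lam (Suc t) = h" using t(3) basic_shapeD(1)[OF b, of t] unfolding h_def by simp
  have above: "h < mu k" "mu k < lam k" if "k < t" for k
    using t(2)[OF that] lam_t basic_shapeD(2)[OF b, of k] basic_shape_le[OF y(1) b, of k] by simp_all
  have below: "lam k \<le> h" "mu k \<le> h" if "t < k" for k
    using youngD[OF y(1), of "Suc t" k] basic_shape_le[OF y(1) b, of k] lam_Suc that by simp_all
  have lam': "?lam k = (if k < t then lam k - 1 else lam (Suc k))" for k
    using above[of k] below[of "Suc k"] by (auto simp: cdel_def del_def)
  have mu': "?mu k = (if k < t then mu k - 1 else mu (Suc k))" for k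
    using above[of k] below[of "Suc k"] by (auto simp: cdel_def del_def)
  have y': "young ?lam" "young ?mu" using y by (simp_all add: young_cdel young_del)
  have red: "red n ?lam ?mu \<Longrightarrow> red (Suc n) lam mu" for n
    using red_box[OF y t] unfolding h_def by blast
  have b': "basic_shape ?lam ?mu"
    unfolding basic_shape_def
  proof (intro allI)
    fix k
    have bk: "mu k \<le> lam (Suc k)" "mu (Suc k) \<le> lam (Suc (Suc k))"
      "0 < lam (Suc k) \<longrightarrow> mu (Suc k) < lam (Suc k)" using basic_shapeD[OF b] by blast+
    consider "Suc k < t" | "Suc k = t" | "t \<le> k" by linarith
    then show "?mu k \<le> ?lam (Suc k) \<and> (0 < ?lam k \<longrightarrow> ?mu k < ?lam k)"
    proof cases
      case 2
      then show ?thesis unfolding lam' mu' using bk above[of k] lam_t lam_Suc by auto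
    qed (use bk above[of k] in \<open>auto simp: lam' mu'\<close>)
  qed
  have sm: "semiperimeter ?lam < semiperimeter lam"
  proof -
    have "conjugate ?lam 0 \<le> conjugate (del t lam) 0"
      by (rule conjugate_mono[OF y'(1) young_del[OF y(1)]]) (simp add: cdel_def)
    moreover have "?lam 0 \<le> del t lam 0" by (simp add: cdel_def)
    ultimately show ?thesis
      using semiperimeter_del[OF y(1), of t] lam_t unfolding semiperimeter_def by simp
  qed
  have card_skip: "card (insert t (skip t ` A)) = Suc (card A)" if "finite A" for A
  proof -
    have "t \<notin> skip t ` A" by (auto simp: skip_def split: if_splits)
    then show ?thesis using that by (simp add: card_image[OF inj_on_subset[OF inj_skip subset_UNIV]])
  qed
  have skipD: "k \<in> skip t ` A \<longleftrightarrow> (k < t \<and> k \<in> A) \<or> (t < k \<and> k - 1 \<in> A)" for k A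
    by (force simp: skip_def image_iff split: if_splits)
  \<comment> \<open>The fourth assumption ensures that row \<open>t - 1\<close> is still a corner
    once row \<open>t\<close> and column \<open>h\<close> are gone and the old row
    \<open>t + 1\<close> follows it.\<close>
  have corners_eq: "corners f = insert t (skip t ` corners (cdel h (del t f)))"
    if f: "f (Suc t) < f t" "\<And>k. k < t \<Longrightarrow> f t < f k" "\<And>k. k < t \<Longrightarrow> h < f k" "f (Suc t) < h \<or> t = 0 \<or> f (Suc t) \<le> h \<and> h < f (t - 1) - 1"
      "\<And>k. cdel h (del t f) k = (if k < t then f k - 1 else f (Suc k))" for f
  proof (rule set_eqI)
    fix k
    consider "Suc k < t" | "Suc k = t" | "k = t" | "t < k" by linarith
    then show "k \<in> corners f \<longleftrightarrow> k \<in> insert t (skip t ` corners (cdel h (del t f)))"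
    proof cases
      case 1
      then have "f k - 1 > f (Suc k) - 1 \<longleftrightarrow> f k > f (Suc k)" using f(3)[of k] f(3)[of "Suc k"] by linarith
      then show ?thesis using 1 unfolding insert_iff skipD unfolding corners_def mem_Collect_eq f(5) by simp
    next
      case 2
      then have "k < t" by simp
      then have "f (Suc k) < f k" "f (Suc t) < f k - 1" using f(2,3)[of k] f(4) 2 by auto
      then show ?thesis using 2 unfolding insert_iff skipD unfolding corners_def mem_Collect_eq f(5) by simp
    next
      case 3
      then show ?thesis using f(1) by (simp add: corners_def)
    next
      case 4
      then show ?thesis unfolding insert_iff skipD unfolding corners_def mem_Collect_eq f(5) by auto
    qed
  qed
  have "corners lam = insert t (skip t ` corners ?lam)"
  proof (rule corners_eq)
    show "lam (Suc t) < lam t" using lam_t lam_Suc by simp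
    show "lam t < lam k" if "k < t" for k using above[OF that] lam_t by simp
    show "h < lam k" if "k < t" for k using above[OF that] by simp
    show "lam (Suc t) < h \<or> t = 0 \<or> lam (Suc t) \<le> h \<and> h < lam (t - 1) - 1"
      using above[of "t - 1"] lam_Suc by (cases t) auto
  qed (rule lam')
  then have c_lam: "card (corners lam) = Suc (card (corners ?lam))"
    using card_skip finite_corners[OF y'(1)] by metis
  \<comment> \<open>For \<open>h > 0\<close>, \<open>mu\<close> loses its corner in row
    \<open>t\<close>. For \<open>h = 0\<close>, row \<open>t\<close> of \<open>mu\<close> is empty,
    and the corner lost is that of row \<open>t - 1\<close>, which has length 1 because the diagram
    is basic. If also \<open>t = 0\<close>, the box is the whole diagram.\<close>
  consider "0 < h" | "h = 0" "t = 0" | "h = 0" "0 < t" by linarith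
  then show ?thesis
  proof cases
    case 1
    have lt: "mu (Suc t) < h" using basic_shapeD(2)[OF b, of "Suc t"] lam_Suc 1 by simp
    have "corners mu = insert t (skip t ` corners ?mu)"
      by (rule corners_eq) (use lt above mu' in \<open>auto simp: h_def\<close>)
    then have "card (corners mu) = Suc (card (corners ?mu))"
      using card_skip finite_corners[OF y'(2)] by metis
    then show ?thesis unfolding reducible_def using y' b' sm c_lam red
      by (intro disjI2 exI[of _ ?lam] exI[of _ ?mu]) simp
  next
    case 2
    have "?lam = (\<lambda>_. 0)" "?mu = (\<lambda>_. 0)" "mu = (\<lambda>_. 0)"
      using young_eq_zero[OF y'(1)] young_eq_zero[OF y'(2)] young_eq_zero[OF y(2)] 2 lam_Suc below(2)[of 1]
      unfolding lam' mu' by (simp_all add: h_def)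
    then show ?thesis unfolding reducible_def using c_lam red[of 0] red_empty by (simp add: corners_def)
  next
    case 3
    have z: "mu k = 0" if "t \<le> k" for k using below(2)[of k] that 3 by (cases "k = t") (auto simp: h_def)
    have 1: "mu (t - 1) = 1" using above(1)[of "t - 1"] basic_shapeD(1)[OF b, of "t - 1"] lam_t 3 by simp
    have "corners mu = insert (t - 1) (corners ?mu)"
    proof (rule set_eqI)
      fix k
      consider "Suc k < t" | "Suc k = t" | "t \<le> k" by linarith
      then show "k \<in> corners mu \<longleftrightarrow> k \<in> insert (t - 1) (corners ?mu)"
      proof cases
        case 1
        then have "mu k - 1 > mu (Suc k) - 1 \<longleftrightarrow> mu k > mu (Suc k)"
          using above(1)[of k] above(1)[of "Suc k"] by linarith
        then show ?thesis using 1 unfolding insert_iff corners_def mem_Collect_eq mu' by auto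
      next
        case 2
        then show ?thesis using 1 z[of t] by (auto simp: corners_def)
      next
        case 3
        then show ?thesis using z[of k] z[of "Suc k"] z[of "Suc (Suc k)"] \<open>0 < t\<close>
          unfolding insert_iff corners_def mem_Collect_eq mu' by auto
      qed
    qed
    moreover have "t - 1 \<notin> corners ?mu"
      unfolding corners_def mem_Collect_eq mu' using 1 3 by simp
    ultimately have "card (corners mu) = Suc (card (corners ?mu))"
      using finite_corners[OF y'(2)] by simp
    then show ?thesis unfolding reducible_def using y' b' sm c_lam red
      by (intro disjI2 exI[of _ ?lam] exI[of _ ?mu]) simp
  qed
qed

text \<open>Take a closest pair. If it is separated by a single tie \<open>mu j = lam (Suc j)\<close>, then the columns on
  both sides of the tie are repeated. Otherwise the part between two consecutive ties has no repeated
  rows; it is an isolated box, or it contains repeated columns of both kinds and has no ties.\<close>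

lemma reducible_less:
  assumes y: "young lam" "young mu" and b: "basic_shape lam mu"
    and "i \<in> outer_dup lam" "i' \<in> inner_dup lam mu" "i < i'"
  shows "reducible lam mu"
  using assms(4-6)
proof (induction "i' - i" arbitrary: i i' rule: less_induct)
  case less
  note L = less.prems(1) and M = less.prems(2)
  have le: "mu k \<le> lam k" for k using basic_shape_le[OF y(1) b] .
  consider (L) k where "k \<in> outer_dup lam" "i < k" "k \<le> i'" | (M) k where "k \<in> inner_dup lam mu" "i \<le> k" "k < i'"
    | (none) "\<And>k. i < k \<Longrightarrow> k \<le> i' \<Longrightarrow> k \<notin> outer_dup lam" "\<And>k. i \<le> k \<Longrightarrow> k < i' \<Longrightarrow> k \<notin> inner_dup lam mu"
    by blast
  then show ?case
  proof cases
    case (L k)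
    show ?thesis
    proof (cases "k = i'")
      case True
      then show ?thesis using reducible_ge[OF y b L(1) M] le[of i'] by simp
    next
      case False
      have "i' - k < i' - i" "k < i'" using L(2,3) False by simp_all
      then show ?thesis using less.hyps[of i' k] L M by simp
    qed
  next
    case (M k)
    show ?thesis
    proof (cases "k = i")
      case True
      then show ?thesis using reducible_ge[OF y b less.prems(1) M(1)] le[of i] by simp
    next
      case False
      have "k - i < i' - i" "i < k" using M(2,3) False by simp_all
      then show ?thesis using less.hyps[of k i] less.prems(1) M by simp
    qed
  next
    case none
    have pos: "0 < lam k" if "k \<le> Suc i'" for k
      using M youngD[OF y(1) that] by (simp add: inner_dup_def)
    have strict: "lam (Suc k) < lam k" if "i < k" "k \<le> i'" for k
      using none(1)[OF that] pos[of k] that youngD[OF y(1), of k "Suc k"] by (simp add: outer_dup_def)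
    have strict': "mu (Suc k) < mu k" if "i \<le> k" "k < i'" for k
      using none(2)[OF that] pos[of "Suc k"] that youngD[OF y(2), of k "Suc k"] by (simp add: inner_dup_def)
    have flat: "lam (Suc i) = lam i" "mu (Suc i') = mu i'"
      using L M by (simp_all add: outer_dup_def inner_dup_def)
    have mu_le: "mu k \<le> lam (Suc k)" for k using basic_shapeD(1)[OF b] .
    define tie where "tie j \<longleftrightarrow> i \<le> j \<and> j < i' \<and> mu j = lam (Suc j)" for j
    have no_tie: "mu j < lam (Suc j)" if "\<not> tie j" "i \<le> j" "j < i'" for j
      using that mu_le[of j] unfolding tie_def by simp
    have last: "mu i' < lam (Suc i')" using basic_shapeD(2)[OF b, of "Suc i'"] pos[of "Suc i'"] flat(2) by simp
    show ?thesis
    proof (cases "\<exists>j. tie j")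
      case False
      then show ?thesis using reducible_less_untied[OF y b L M less.prems(3)] no_tie by blast
    next
      case True
      define p where "p = (LEAST j. tie j)"
      have p: "tie p" unfolding p_def using True by (rule LeastI_ex)
      have p_least: "\<not> tie j" if "j < p" for j using that not_less_Least unfolding p_def by blast
      define h1 where "h1 = lam (Suc p)"
      have mu_p: "mu p = h1" and pi': "p < i'" using p unfolding tie_def h1_def by simp_all
      \<comment> \<open>Row \<open>i\<close> of \<open>lam\<close> is repeated, so a tie at
        \<open>i\<close> would give \<open>mu i = lam i\<close>, an empty row.\<close>
      have "p \<noteq> i" using p basic_shapeD(2)[OF b, of i] pos[of i] flat(1) less.prems(3) unfolding tie_def by auto
      then have ip: "i < p" using p unfolding tie_def by simp
      have lam_p: "Suc (Suc h1) \<le> lam p"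
      proof -
        have "\<not> tie (p - 1)" using p_least[of "p - 1"] ip by simp
        then have "mu (p - 1) < lam p" using no_tie[of "p - 1"] ip pi' by simp
        moreover have "mu p < mu (p - 1)" using strict'[of "p - 1"] ip pi' by simp
        ultimately show ?thesis using mu_p by simp
      qed
      show ?thesis
      proof (cases "\<exists>j. tie j \<and> p < j")
        case False
        have "Suc (Suc (mu (Suc p))) \<le> h1"
        proof -
          have "lam (Suc (Suc p)) < h1" unfolding h1_def using strict[of "Suc p"] ip pi' by simp
          moreover have "mu (Suc p) < lam (Suc (Suc p))"
          proof (cases "Suc p = i'")
            case True
            then show ?thesis using last by simp
          next
            case False
            then show ?thesis using no_tie[of "Suc p"] \<open>\<not> (\<exists>j. tie j \<and> p < j)\<close> ip pi' by auto
          qed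
          ultimately show ?thesis by simp
        qed
        \<comment> \<open>The repeated columns are \<open>h1\<close> and \<open>h1 + 1\<close> for
          \<open>lam\<close>, and \<open>h1 - 2\<close> and \<open>h1 - 1\<close> for
          \<open>mu\<close>; all have length \<open>p + 1\<close>.\<close>
        then obtain c' where c': "h1 = Suc (Suc c')" "mu (Suc p) \<le> c'"
          by (metis Suc_le_D Suc_le_mono)
        have "conjugate lam h1 = Suc p" "conjugate lam (Suc h1) = Suc p"
          using conjugate_eq[OF y(1), of "Suc p"] lam_p by (simp_all add: h1_def)
        moreover have "conjugate mu c' = Suc p" "conjugate mu (Suc c') = Suc p"
          using conjugate_eq[OF y(2), of "Suc p"] c' mu_p by simp_all
        moreover have "0 < conjugate lam (Suc c')"
          using less_conjugate_iff[OF y(1), of "Suc p" "Suc c'"] c' by (simp add: h1_def)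
        ultimately show ?thesis using c'(1)
          by (intro reducible_conjugate_ge[OF y b, of h1 c']) (simp_all add: outer_dup_def inner_dup_def)
      next
        case True
        define q where "q = (LEAST j. tie j \<and> p < j)"
        have q: "tie q" "p < q" unfolding q_def using LeastI_ex[OF True] by blast+
        have q_least: "\<not> tie j" if "p < j" "j < q" for j
          using that not_less_Least[of j "\<lambda>j. tie j \<and> p < j"] unfolding q_def by blast
        define r where "r = Suc p"
        define h2 where "h2 = mu q"
        have lam_Sq: "lam (Suc q) = h2" and qi': "q < i'" using q unfolding tie_def h2_def by simp_all
        have lam_r: "lam r = h1" unfolding r_def h1_def ..
        have rq: "r \<le> q" using q(2) unfolding r_def by simp
        show ?thesis
        proof (cases "r = q")
          case True
          \<comment> \<open>A single row of \<open>h1 - h2\<close> boxes lies between the two ties.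
            If it has more than one box, its first two columns are repeated in \<open>lam\<close>
            and in \<open>mu\<close>.\<close>
          have lt: "h2 < h1" using basic_shapeD(2)[OF b, of r] pos[of r] lam_r True qi' unfolding h2_def by simp
          show ?thesis
          proof (cases "h1 = Suc h2")
            case True
            show ?thesis
            proof (rule reducible_box[OF y b, of r])
              show "lam r = Suc (mu r)" using True \<open>r = q\<close> lam_r unfolding h2_def by simp
              show "lam r \<le> mu k" if "k < r" for k
                using youngD[OF y(2), of k p] that mu_p lam_r unfolding r_def by simp
              show "lam (Suc r) \<le> mu r" using lam_Sq \<open>r = q\<close> unfolding h2_def by simp
            qed
          next
            case False
            then have lt: "Suc (Suc h2) \<le> h1" using lt by simp
            have "conjugate lam h2 = Suc r" "conjugate lam (Suc h2) = Suc r"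
              using conjugate_eq[OF y(1), of "Suc r"] lt lam_r lam_Sq True by simp_all
            moreover have "conjugate mu h2 = r" "conjugate mu (Suc h2) = r"
              using conjugate_eq[OF y(2), of r] lt mu_p True by (simp_all add: r_def h2_def)
            ultimately show ?thesis
              by (intro reducible_conjugate_ge[OF y b, of h2 h2]) (simp_all add: outer_dup_def inner_dup_def)
          qed
        next
          case False
          then have rq: "r < q" using rq by simp
          have "mu r < lam (Suc r)" using no_tie[of r] q_least[of r] rq ip qi' unfolding r_def by simp
          moreover have "lam (Suc r) < h1" using strict[of r] rq qi' ip lam_r unfolding r_def by simp
          ultimately obtain c' where c': "h1 = Suc (Suc c')" "mu r \<le> c'"
            by (cases h1; cases "h1 - 1") auto
          have M': "conjugate mu c' = r" "conjugate mu (Suc c') = r"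
            using conjugate_eq[OF y(2), of r] c' mu_p by (simp_all add: r_def)
          have "0 < conjugate lam (Suc c')" using less_conjugate_iff[OF y(1), of r "Suc c'"] lam_r c' by simp
          then have M'': "c' \<in> inner_dup (conjugate lam) (conjugate mu)" using M' by (simp add: inner_dup_def)
          have lam_q: "Suc (Suc h2) \<le> lam q"
          proof -
            have "\<not> tie (q - 1)" using q_least[of "q - 1"] rq unfolding r_def by simp
            then have "mu (q - 1) < lam q" using no_tie[of "q - 1"] ip qi' rq unfolding r_def by simp
            moreover have "mu q < mu (q - 1)" using strict'[of "q - 1"] ip qi' rq unfolding r_def by simp
            ultimately show ?thesis unfolding h2_def by simp
          qed
          have L': "conjugate lam h2 = Suc q" "conjugate lam (Suc h2) = Suc q"
            using conjugate_eq[OF y(1), of "Suc q"] lam_q lam_Sq by simp_all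
          then have L'': "h2 \<in> outer_dup (conjugate lam)" by (simp add: outer_dup_def)
          have "lam q < lam r"
            using strict[of r] youngD[OF y(1), of "Suc r" q] rq qi' ip unfolding r_def by simp
          then have "h2 < c'" using lam_q lam_r c' by simp
          \<comment> \<open>A tie between columns \<open>d\<close> and \<open>d + 1\<close> would
            also be one between rows: \<open>mu m' = lam (m' + 1) = d + 1\<close> with
            \<open>m'\<close> strictly between the consecutive ties \<open>p\<close> and
            \<open>q\<close>.\<close>
          moreover have "conjugate mu d < conjugate lam (Suc d)" if d: "h2 \<le> d" "d < c'" for d
          proof (rule ccontr)
            assume "\<not> conjugate mu d < conjugate lam (Suc d)"
            define m where "m = conjugate lam (Suc d)"
            have le_m: "r < m"
              unfolding m_def using less_conjugate_iff[OF y(1), of r "Suc d"] lam_r c' d by simp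
            have m_le: "m \<le> Suc q"
              unfolding m_def using conjugate_le_iff[OF y(1), of "Suc d" "Suc q"] lam_Sq d by simp
            obtain m' where m': "m = Suc m'" using le_m by (cases m) auto
            have "m' < conjugate mu d" using \<open>\<not> conjugate mu d < conjugate lam (Suc d)\<close> m' unfolding m_def by simp
            then have 1: "d < mu m'" using less_conjugate_iff[OF y(2)] by blast
            have 2: "lam (Suc m') \<le> Suc d"
              using conjugate_le_iff[OF y(1), of "Suc d" m] m' unfolding m_def by simp
            have eq: "mu m' = Suc d" "lam (Suc m') = Suc d" using 1 2 mu_le[of m'] by simp_all
            have "m' \<le> q" "p < m'" using m_le le_m m' unfolding r_def by simp_all
            moreover have "m' \<noteq> q" using eq(2) lam_Sq d by auto
            ultimately have "\<not> tie m'" using q_least[of m'] by simp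
            then show False using eq \<open>m' \<le> q\<close> \<open>p < m'\<close> ip qi' unfolding tie_def by simp
          qed
          ultimately show ?thesis using reducible_conjugate_less_untied[OF y b L'' M''] by blast
        qed
      qed
    qed
  qed
qed

lemma strict_chain:
  fixes f :: "nat \<Rightarrow> nat"
  assumes "m \<le> n" "\<And>k. m \<le> k \<Longrightarrow> k < n \<Longrightarrow> f (Suc k) < f k"
  shows "f n + (n - m) \<le> f m"
  using assms
proof (induction rule: dec_induct)
  case (step k)
  have "f (Suc k) < f k" by (rule step.prems) (use step.hyps in auto)
  moreover have "f k + (k - m) \<le> f m" by (rule step.IH) (use step.prems in auto)
  ultimately show ?case using step.hyps by simp
qed simp

text \<open>A repeated row of \<open>lam\<close> above one of \<open>mu\<close> is excluded by
  \<open>reducible_less\<close>. In the other order only one obstacle to \<open>reducible_ge\<close>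
  remains: the row of \<open>mu\<close> must be too long to be deleted with that of
  \<open>lam\<close>.\<close>

lemma dup_separated:
  assumes y: "young lam" "young mu" and b: "basic_shape lam mu" and "\<not> reducible lam mu"
    and "i \<in> outer_dup lam" "i' \<in> inner_dup lam mu"
  shows "i' < i" "lam i < mu i'"
proof -
  have "\<not> i < i'" using reducible_less[OF y b assms(5,6)] assms(4) by blast
  moreover have "i' \<le> i \<Longrightarrow> lam i < mu i'"
    using reducible_ge[OF y b assms(5,6)] assms(4) by (meson not_le)
  ultimately show "lam i < mu i'" by simp
  then show "i' < i" using \<open>\<not> i < i'\<close> basic_shape_le[OF y(1) b, of i] by (metis leD linorder_neqE_nat)
qed

lemma card_dups:
  assumes "young lam" "young mu" "basic_shape lam mu" "card (corners lam) = Suc (card (corners mu))"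
  shows "card (outer_dup lam) = card (inner_dup lam mu)"
  using card_outer_dup(2)[OF assms(1)] card_inner_dup(2)[OF assms(1-3)] assms(4) by linarith

text \<open>In an irreducible diagram the repeated columns of \<open>mu\<close> precede those of \<open>lam\<close>, and likewise for
  rows. Counting the strictly decreasing stretches in both directions then gives contradictory bounds
  on the first part of \<open>lam\<close>.\<close>

lemma outer_dup_conjugate_empty:
  assumes y: "young lam" "young mu" and b: "basic_shape lam mu" and irr: "\<not> reducible lam mu"
    and cc: "card (corners lam) = Suc (card (corners mu))"
  shows "outer_dup (conjugate lam) = {}"
proof (rule ccontr)
  let ?L = "outer_dup (conjugate lam)" and ?M = "inner_dup (conjugate lam) (conjugate mu)"
  assume ne: "?L \<noteq> {}"
  note y' = young_conjugate[OF y(1)] young_conjugate[OF y(2)] and b' = basic_shape_conjugate[OF y b]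
  have irr': "\<not> reducible (conjugate lam) (conjugate mu)" using reducible_conjugate[OF y] irr by blast
  have fin: "finite ?L" "finite ?M" using card_outer_dup(1)[OF y'(1)] card_inner_dup(1)[OF y' b'] by blast+
  have "card ?L = card ?M"
    by (rule card_dups[OF y' b']) (simp add: card_corners_conjugate y cc)
  then have neM: "?M \<noteq> {}" using ne fin by (metis card_0_eq)
  define c' where "c' = Max ?M"
  define c where "c = Min ?L"
  have c: "c \<in> ?L" "\<And>d. d \<in> ?L \<Longrightarrow> c \<le> d" unfolding c_def using Min_in[OF fin(1) ne] fin(1) by auto
  have c': "c' \<in> ?M" "\<And>d. d \<in> ?M \<Longrightarrow> d \<le> c'" unfolding c'_def using Max_in[OF fin(2) neM] fin(2) by auto
  define a where "a = conjugate lam c"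
  define bb where "bb = conjugate mu c'"
  have cc': "c' < c" and ab: "a < bb"
    unfolding a_def bb_def using dup_separated[OF y' b' irr' c(1) c'(1)] by auto
  have a: "0 < a" "conjugate lam (Suc c) = a" using c(1) unfolding a_def outer_dup_def by auto
  have bb: "conjugate mu (Suc c') = bb" "0 < conjugate lam (Suc c')" using c'(1) unfolding bb_def inner_dup_def by auto
  have mu_bb: "mu bb \<le> c'" using conjugate_le_iff[OF y(2), of c' bb] unfolding bb_def by simp
  have mu_bb': "Suc c' < mu (bb - 1)" using less_conjugate_iff[OF y(2), of "bb - 1" "Suc c'"] bb ab by simp
  have strict_L: "conjugate lam (Suc k) < conjugate lam k" if "k < c" for k
  proof -
    have "k \<notin> ?L" using c(2)[of k] that by auto
    moreover have "0 < conjugate lam k" using youngD[OF y'(1), of k c] that a(1) unfolding a_def by simp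
    ultimately show ?thesis using youngD[OF y'(1), of k "Suc k"] unfolding outer_dup_def by simp
  qed
  have strict_M: "conjugate mu (Suc k) < conjugate mu k" if "c' < k" "0 < conjugate lam (Suc k)" for k
  proof -
    have "k \<notin> ?M" using c'(2)[of k] that(1) by auto
    then show ?thesis using that(2) youngD[OF y'(2), of k "Suc k"] unfolding inner_dup_def by simp
  qed
  define l where "l = conjugate lam 0"
  have l: "bb + 2 + c' \<le> l"
  proof -
    have "conjugate lam (Suc c') + (Suc c' - 0) \<le> conjugate lam 0"
      by (rule strict_chain) (use strict_L cc' in auto)
    moreover have "bb < conjugate lam (Suc c')" using basic_shapeD(2)[OF b' bb(2)] bb(1) by simp
    ultimately show ?thesis unfolding l_def by simp
  qed
  have pos: "0 < lam k \<longleftrightarrow> k < l" for k unfolding l_def using less_conjugate_iff[OF y(1), of k 0] by simp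
  \<comment> \<open>Otherwise \<open>mu\<close> decreases strictly from row \<open>bb\<close> to row
    \<open>l - 1\<close>, which requires \<open>mu bb >= l - 1 - bb > c'\<close>.\<close>
  obtain i' where i': "i' \<in> inner_dup lam mu" "bb \<le> i'"
  proof (rule ccontr)
    assume "\<not> thesis"
    then have no: "i' \<notin> inner_dup lam mu" if "bb \<le> i'" for i' using that \<open>\<And>i'. i' \<in> inner_dup lam mu \<Longrightarrow> bb \<le> i' \<Longrightarrow> thesis\<close> by blast
    have "mu (l - 1) + (l - 1 - bb) \<le> mu bb"
    proof (rule strict_chain)
      show "bb \<le> l - 1" using l by simp
      fix k assume k: "bb \<le> k" "k < l - 1"
      then have "Suc k < l" by simp
      then show "mu (Suc k) < mu k"
        using no[of k] k pos[of "Suc k"] youngD[OF y(2), of k "Suc k"] unfolding inner_dup_def by simp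
    qed
    then show False using l mu_bb by simp
  qed
  have strict_lam: "lam (Suc k) < lam k" if "k \<le> bb" for k
  proof -
    have "k \<notin> outer_dup lam" using dup_separated(1)[OF y b irr _ i'(1), of k] i'(2) that by auto
    moreover have "0 < lam k" using pos[of k] l that by simp
    ultimately show ?thesis using youngD[OF y(1), of k "Suc k"] unfolding outer_dup_def by simp
  qed
  define w where "w = lam 0"
  have posc: "0 < conjugate lam k \<longleftrightarrow> k < w" for k
    unfolding w_def using less_conjugate_iff[OF y'(1), of k 0] y(1) less_conjugate_iff[OF y(1), of 0 k] by simp
  have "w \<le> bb + c' + 2"
  proof -
    have "conjugate mu (w - 1) + (w - 1 - Suc c') \<le> conjugate mu (Suc c')"
    proof (rule strict_chain)
      show "Suc c' \<le> w - 1" using posc[of "Suc c'"] bb(2) by simp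
      fix k assume "Suc c' \<le> k" "k < w - 1"
      then show "conjugate mu (Suc k) < conjugate mu k" using strict_M[of k] posc[of "Suc k"] by simp
    qed
    then show ?thesis using bb(1) by simp
  qed
  \<comment> \<open>The rows of \<open>lam\<close> decrease strictly down to row
    \<open>bb - 1\<close>, which still has at least \<open>c' + 3\<close> boxes. As column
    \<open>c\<close> is repeated, the drop from row \<open>a - 1\<close> to row \<open>a\<close> is
    at least 2, and this extra unit violates the upper bound on \<open>w\<close>.\<close>
  moreover have "c' + 3 + bb \<le> w"
  proof -
    have 1: "lam (a - 1) + (a - 1 - 0) \<le> lam 0"
      by (rule strict_chain) (use strict_lam ab in auto)
    have 2: "lam (bb - 1) + (bb - 1 - a) \<le> lam a"
      by (rule strict_chain) (use strict_lam ab in auto)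
    have 3: "Suc c < lam (a - 1)" using less_conjugate_iff[OF y(1), of "a - 1" "Suc c"] a by simp
    have 4: "lam a \<le> c" using conjugate_le_iff[OF y(1), of c a] unfolding a_def by simp
    have 5: "mu (bb - 1) < lam (bb - 1)" using basic_shapeD(2)[OF b, of "bb - 1"] pos[of "bb - 1"] l by simp
    show ?thesis unfolding w_def using 1 2 3 4 5 mu_bb' ab a(1) by linarith
  qed
  ultimately show False by simp
qed

text \<open>In an irreducible diagram all repetitions are excluded. Then \<open>lam\<close> drops by
  at most one per row, so \<open>lam 0 <= l\<close>, whereas \<open>mu\<close> decreases strictly,
  so \<open>mu 0 >= l - 1\<close>. The first row is therefore a single isolated box, and removing it
  is a step after all.\<close>

lemma reducible_balanced:
  assumes y: "young lam" "young mu" and b: "basic_shape lam mu" and pos: "0 < lam 0"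
    and cc: "card (corners lam) = Suc (card (corners mu))"
  shows "reducible lam mu"
proof (rule ccontr)
  assume irr: "\<not> reducible lam mu"
  note y' = young_conjugate[OF y(1)] young_conjugate[OF y(2)] and b' = basic_shape_conjugate[OF y b]
  have Lc: "outer_dup (conjugate lam) = {}" by (rule outer_dup_conjugate_empty[OF y b irr cc])
  have "outer_dup (conjugate (conjugate lam)) = {}"
    by (rule outer_dup_conjugate_empty[OF y' b'])
      (use reducible_conjugate[OF y] irr cc y in \<open>auto simp: card_corners_conjugate\<close>)
  then have "outer_dup lam = {}" using y by simp
  then have M: "inner_dup lam mu = {}"
    using card_dups[OF y b cc] card_inner_dup(1)[OF y b] by simp
  define l where "l = conjugate lam 0"
  have posl: "0 < lam k \<longleftrightarrow> k < l" for k unfolding l_def using less_conjugate_iff[OF y(1), of k 0] by simp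
  have l: "0 < l" using posl[of 0] pos by simp
  have "mu (l - 1) + (l - 1 - 0) \<le> mu 0"
  proof (rule strict_chain)
    fix k assume "k < l - 1"
    then show "mu (Suc k) < mu k"
      using M posl[of "Suc k"] youngD[OF y(2), of k "Suc k"] unfolding inner_dup_def by fastforce
  qed simp
  moreover have "lam k \<le> Suc (lam (Suc k))" for k
  proof (rule ccontr)
    assume "\<not> lam k \<le> Suc (lam (Suc k))"
    then have "conjugate lam (lam (Suc k)) = Suc k" "conjugate lam (Suc (lam (Suc k))) = Suc k"
      using conjugate_eq[OF y(1), of "Suc k"] by simp_all
    then have "lam (Suc k) \<in> outer_dup (conjugate lam)" by (simp add: outer_dup_def)
    then show False using Lc by blast
  qed
  then have "lam 0 \<le> lam k + k" for k
    by (induction k) (auto intro: order_trans)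
  then have "lam 0 \<le> l" using posl[of l] by (metis add_0 less_irrefl not_gr_zero)
  moreover have "mu 0 < lam 0" using basic_shapeD(2)[OF b pos] .
  ultimately have "lam 0 = Suc (mu 0)" by linarith
  moreover have "lam 1 \<le> mu 0"
  proof -
    have "0 \<notin> outer_dup lam" using \<open>outer_dup lam = {}\<close> by blast
    then have "lam 1 < lam 0" using pos youngD[OF y(1), of 0 1] unfolding outer_dup_def by simp
    then show ?thesis using \<open>lam 0 = Suc (mu 0)\<close> by simp
  qed
  ultimately show False using reducible_box[OF y b, of 0] irr by simp
qed

text \<open>If the two numbers in the minimum differ, counting yields a repeated row in the
  partition that attains the minimum, and its deletion costs that partition no corner. The row
  deleted with it may cost the other partition one corner, which leaves the minimum unchanged. For
  \<open>mu\<close> the partner is the next row of \<open>lam\<close>, for \<open>lam\<close> it is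
  the same row of \<open>mu\<close>.\<close>

theorem red_min_corners:
  assumes "young lam" "young mu" "basic_shape lam mu" "0 < lam 0"
  shows "red (min (card (corners lam)) (Suc (card (corners mu)))) lam mu"
  using assms
proof (induction "semiperimeter lam" arbitrary: lam mu rule: less_induct)
  case less
  note y = less.prems(1,2) and b = less.prems(3)
  have ne: "0 < f 0" if "card (corners f) \<noteq> 0" "young f" for f
    using that young_eq_zero[OF that(2)] by (cases "f 0") (auto simp: corners_def)
  have "0 < conjugate lam 0" using less_conjugate_iff[OF y(1), of 0 0] less.prems(4) by simp
  then have counts: "card (outer_dup lam) + card (corners lam) = Suc (card (inner_dup lam mu) + card (corners mu))"
    using card_outer_dup(2)[OF y(1)] card_inner_dup(2)[OF y b] by simp
  consider "Suc (card (corners mu)) < card (corners lam)" | "card (corners lam) < Suc (card (corners mu))"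
    | "card (corners lam) = Suc (card (corners mu))" by linarith
  then show ?case
  proof cases
    case 1
    then have "card (inner_dup lam mu) \<noteq> 0" using counts by linarith
    then obtain i where i: "i \<in> inner_dup lam mu" by fastforce
    have i': "0 < lam (Suc i)" "mu (Suc i) = mu i" using i by (auto simp: inner_dup_def)
    let ?lam = "del (Suc i) lam" and ?mu = "del i mu"
    have c: "card (corners lam) \<le> Suc (card (corners ?lam))" "card (corners ?mu) = card (corners mu)"
      using card_corners_del_ge[OF y(1)] card_corners_del_flat[OF y(2)] i' by auto
    have "red (min (card (corners ?lam)) (Suc (card (corners ?mu)))) ?lam ?mu"
      by (rule less.hyps)
        (use y c 1 ne[of ?lam] i' in \<open>auto simp: young_del semiperimeter_del intro!: basic_shape_del_less[OF y(1) b]\<close>)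
    moreover have "min (card (corners ?lam)) (Suc (card (corners ?mu))) = min (card (corners lam)) (Suc (card (corners mu)))"
      using c 1 by simp
    ultimately show ?thesis using red_row[OF y basic_shapeD(1)[OF b, of i]] by simp
  next
    case 2
    then have "card (outer_dup lam) \<noteq> 0" using counts by linarith
    then obtain i where i: "i \<in> outer_dup lam" by fastforce
    have i': "0 < lam i" "lam (Suc i) = lam i" using i by (auto simp: outer_dup_def)
    let ?lam = "del i lam" and ?mu = "del i mu"
    have c: "card (corners mu) \<le> Suc (card (corners ?mu))" "card (corners ?lam) = card (corners lam)"
      using card_corners_del_ge[OF y(2)] card_corners_del_flat[OF y(1)] i' by auto
    have "0 < ?lam 0" using i' less.prems(4) by (cases i) (auto simp: del_def)
    then have "red (min (card (corners ?lam)) (Suc (card (corners ?mu)))) ?lam ?mu"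
      by (intro less.hyps)
        (use y c 2 i' in \<open>auto simp: young_del semiperimeter_del intro!: basic_shape_del_same[OF y(1) b]\<close>)
    moreover have "min (card (corners ?lam)) (Suc (card (corners ?mu))) = min (card (corners lam)) (Suc (card (corners mu)))"
      using c 2 by simp
    ultimately show ?thesis using red_row[OF y basic_shape_le[OF y(1) b, of i]] by simp
  next
    case 3
    have "reducible lam mu" by (rule reducible_balanced[OF y b less.prems(4) 3])
    then show ?thesis
      unfolding reducible_def
    proof (elim disjE exE conjE)
      assume "card (corners lam) = 1" "card (corners mu) = 0" "red 1 lam mu"
      then show ?thesis by simp
    next
      fix lam' mu'
      assume *: "young lam'" "young mu'" "basic_shape lam' mu'" "semiperimeter lam' < semiperimeter lam"
        "card (corners lam') = card (corners lam)" "card (corners mu') = card (corners mu)"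
        "\<forall>n. red n lam' mu' \<longrightarrow> red n lam mu"
      have "0 < lam' 0" using ne[OF _ *(1)] *(5) 3 by simp
      then have "red (min (card (corners lam')) (Suc (card (corners mu')))) lam' mu'"
        using less.hyps * by blast
      then show ?thesis using * by simp
    next
      fix lam' mu'
      assume *: "young lam'" "young mu'" "basic_shape lam' mu'" "semiperimeter lam' < semiperimeter lam"
        "Suc (card (corners lam')) = card (corners lam)" "Suc (card (corners mu')) = card (corners mu)"
        "\<forall>n. red n lam' mu' \<longrightarrow> red (Suc n) lam mu"
      have "0 < lam' 0" using ne[OF _ *(1)] *(5,6) 3 by simp
      then have "red (min (card (corners lam')) (Suc (card (corners mu')))) lam' mu'"
        using less.hyps * by blast
      then have "red (Suc (min (card (corners lam')) (Suc (card (corners mu'))))) lam mu" using * by blast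
      then show ?thesis unfolding *(5,6)[symmetric] by simp
    qed
  qed
qed

section \<open>Pairs from the outer rows and the middle rows\<close>

lemma card_corners_fn:
  assumes "is_partition lam"
  shows "card (corners (fn lam)) = dp lam"
proof -
  note y = young_fn[OF assms]
  have "bij_betw (fn lam) (corners (fn lam)) (set lam)"
    unfolding bij_betw_def
  proof
    show "inj_on (fn lam) (corners (fn lam))"
    proof (rule linorder_inj_onI)
      fix i k assume "i < k" "i \<in> corners (fn lam)" "k \<in> corners (fn lam)"
      then show "fn lam i \<noteq> fn lam k" using youngD[OF y, of "Suc i" k] unfolding corners_def by simp
    qed (rule linear)
    show "fn lam ` corners (fn lam) = set lam"
    proof (intro set_eqI iffI)
      fix x assume "x \<in> fn lam ` corners (fn lam)"
      then obtain i where "fn lam (Suc i) < fn lam i" "x = fn lam i" unfolding corners_def by blast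
      then show "x \<in> set lam" by (auto simp: nth_default_def split: if_splits)
    next
      fix x assume x: "x \<in> set lam"
      then obtain k where k: "k < length lam" "lam ! k = x" by (auto simp: in_set_conv_nth)
      then have fk: "fn lam k = x" by (simp add: nth_default_def)
      have "0 < x" using x assms unfolding is_partition_def by blast
      then have "k < conjugate (fn lam) (x - 1)" using less_conjugate_iff[OF y] fk by simp
      then obtain i where i: "conjugate (fn lam) (x - 1) = Suc i" "k \<le> i"
        by (cases "conjugate (fn lam) (x - 1)") auto
      have "x - 1 < fn lam i" "fn lam (Suc i) \<le> x - 1"
        using less_conjugate_iff[OF y, of i "x - 1"] conjugate_le_iff[OF y, of "x - 1" "Suc i"] i(1) by simp_all
      moreover have "fn lam i \<le> x" using youngD[OF y i(2)] fk by simp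
      ultimately have "fn lam i = x" "fn lam (Suc i) < x" using \<open>0 < x\<close> by linarith+
      then show "x \<in> fn lam ` corners (fn lam)" unfolding corners_def by force
    qed
  qed
  then show ?thesis unfolding dp_def by (rule bij_betw_same_card)
qed

lemma basic_le:
  assumes "basic lam mu" shows "fn mu i \<le> fn lam i"
proof (rule ccontr)
  assume "\<not> fn mu i \<le> fn lam i"
  then have "(i, fn lam i) \<in> diagram mu - diagram lam" by (simp add: diagram_def)
  then show False using assms unfolding basic_def by blast
qed

lemma basic_shape_if_basic:
  assumes "basic lam mu"
  shows "basic_shape (fn lam) (fn mu)"
  unfolding basic_shape_def
proof
  fix i
  show "fn mu i \<le> fn lam (Suc i) \<and> (0 < fn lam i \<longrightarrow> fn mu i < fn lam i)"
    using assms basic_le[OF assms, of i] unfolding basic_def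
    by (cases "i < length lam") (auto simp: nth_default_def)
qed

lemma fn_Cons_eq_ins: "is_partition lam \<Longrightarrow> lam \<noteq> [] \<Longrightarrow> fn lam = ins (hd lam) (fn (tl lam))"
proof -
  assume p: "is_partition lam" "lam \<noteq> []"
  have "del 0 (fn lam) = fn (tl lam)" "fn lam 0 = hd lam"
    using p(2) by (cases lam; auto simp: del_def fun_eq_iff)+
  then show ?thesis using ins_del[OF young_fn[OF p(1)], of 0] by simp
qed

lemma fn_snoc_eq_ins: "is_partition lam \<Longrightarrow> lam \<noteq> [] \<Longrightarrow> fn lam = ins (last lam) (fn (butlast lam))"
proof -
  assume p: "is_partition lam" "lam \<noteq> []"
  have "del (length lam - 1) (fn lam) = fn (butlast lam)" "fn lam (length lam - 1) = last lam"
    using p(2) by (auto simp: del_def fun_eq_iff nth_default_def nth_butlast last_conv_nth)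
  then show ?thesis using ins_del[OF young_fn[OF p(1)], of "length lam - 1"] by simp
qed

lemma is_partition_tl: "is_partition lam \<Longrightarrow> is_partition (tl lam)"
  by (cases lam) (auto simp: is_partition_def)

lemma is_partition_butlast: "is_partition lam \<Longrightarrow> is_partition (butlast lam)"
  by (cases lam rule: rev_cases) (auto simp: is_partition_def sorted_wrt_append)

text \<open>Empty rows leave the array constant from row \<open>l\<close> on, and
  \<open>a l k = 0\<close> for \<open>k >= l\<close>.\<close>

lemma LR_rows:
  assumes "LR lam mu nu" "\<And>i. l \<le> i \<Longrightarrow> lam i = 0" "l \<le> k"
  shows "nu k = 0"
proof -
  obtain a N where a: "lr_array mu a" and s: "\<And>i. sum (a (Suc i)) {..<Suc i} + mu i = sum (a i) {..<i} + lam i"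
    and N: "\<And>i. i \<ge> N \<Longrightarrow> a i = nu"
    using assms(1) unfolding LR_def by blast
  have "a (l + j) m = a l m" for j m
  proof (induction j)
    case (Suc j)
    let ?i = "l + j"
    have z: "a i k = 0" if "i \<le> k" for i k using lr_array_zero[OF a that] .
    have "sum (a ?i) {..<Suc ?i} = sum (a (Suc ?i)) {..<Suc ?i}"
    proof (rule antisym)
      show "sum (a ?i) {..<Suc ?i} \<le> sum (a (Suc ?i)) {..<Suc ?i}"
        by (rule sum_mono) (rule lr_array_mono[OF a], simp)
      show "sum (a (Suc ?i)) {..<Suc ?i} \<le> sum (a ?i) {..<Suc ?i}"
        using s[of ?i] assms(2)[of ?i] z[of ?i ?i] by simp
    qed
    then have "a ?i m = a (Suc ?i) m" if "m < Suc ?i"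
      by (rule sum_mono_inv) (use that lr_array_mono[OF a] in auto)
    then show ?case using Suc z[of ?i m] z[of "Suc ?i" m] by (cases "m < Suc ?i") auto
  qed simp
  from this[of N k] show ?thesis using N[of "l + N"] lr_array_zero[OF a assms(3)] by simp
qed

text \<open>The new box lies in row \<open>conjugate f c\<close>, right after the parts of
  \<open>f\<close> that exceed \<open>c\<close>.\<close>

lemma cover_ins_Suc:
  assumes "young f"
  shows "cover (ins c f) (ins (Suc c) f)"
proof -
  let ?r = "conjugate f c"
  have "ins (Suc c) f k = ((ins c f)(?r := Suc (ins c f ?r))) k" for k
  proof (cases k)
    case 0
    then show ?thesis using less_conjugate_iff[OF assms, of 0 c] by (auto simp: max_def)
  next
    case (Suc i)
    have iff: "i < ?r \<longleftrightarrow> c < f i" "Suc i < ?r \<longleftrightarrow> c < f (Suc i)" using less_conjugate_iff[OF assms] by blast+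
    have le: "f (Suc i) \<le> f i" using youngD[OF assms] by simp
    consider "Suc i < ?r" | "?r = Suc i" | "\<not> i < ?r" by linarith
    then show ?thesis
    proof cases
      case 1
      then show ?thesis using iff(2) le Suc by simp
    next
      case 2
      then have "c < f i" "\<not> c < f (Suc i)" using iff by simp_all
      then show ?thesis unfolding 2 Suc by simp
    next
      case 3
      then have "\<not> c < f i" "k \<noteq> ?r" using iff(1) Suc by simp_all
      then show ?thesis unfolding Suc by simp
    qed
  qed
  then show ?thesis unfolding cover_def by blast
qed

text \<open>Compared with \<open>f\<close>, column \<open>j\<close> has grown by the number of
  inserted parts that exceed \<open>j\<close>, and these numbers determine the two parts.\<close>

lemma ins_ins_inject:
  assumes "young f" "b \<le> a" "b' \<le> a'" "ins a (ins b f) = ins a' (ins b' f)"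
  shows "a = a' \<and> b = b'"
proof -
  have eq: "(if j < b then 1 else 0) + (if j < a then 1 else 0) =
      (if j < b' then 1 else 0) + (if j < a' then 1 else (0 :: nat))" for j
    using arg_cong[OF assms(4), of "\<lambda>f. conjugate f j"] assms(1) by (simp add: conjugate_ins young_ins)
  have "a = a'" using eq[of a] eq[of a'] assms(2,3) by (auto split: if_splits)
  then show ?thesis using eq[of b] eq[of b'] by (auto split: if_splits)
qed

text \<open>The components of \<open>(2, 1)/(1)\<close> are \<open>(2)\<close> and
  \<open>(1, 1)\<close>. Each is added to a component \<open>k\<close> of \<A>, and the sum is
  merged with a component \<open>h\<close> of \<B>.\<close>

definition pair :: "(nat \<Rightarrow> nat) \<Rightarrow> (nat \<Rightarrow> nat) \<Rightarrow> nat list set" where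
  "pair k h = {to_list (ins (k 0 + 2) (ins (k 1) h)), to_list (ins (k 0 + 1) (ins (k 1 + 1) h))}"

context
  fixes lam mu :: "nat list"
  assumes lam: "is_partition lam" and mu: "is_partition mu" and b: "basic lam mu"
    and d: "2 \<le> delta lam mu"
begin

lemma delta_facts:
  shows "mu \<noteq> []" "2 \<le> length lam" "last lam < hd lam" "0 < last lam" "0 < hd mu" "hd mu < hd lam"
proof -
  have dp: "1 \<le> dp mu" "2 \<le> dp lam" using d unfolding delta_def by auto
  show mu_ne: "mu \<noteq> []" using dp(1) unfolding dp_def by auto
  have "dp lam \<le> length lam" unfolding dp_def by (rule card_length)
  then show len: "2 \<le> length lam" using dp(2) by simp
  then have ne: "lam \<noteq> []" by auto
  show "0 < last lam" using lam last_in_set[OF ne] unfolding is_partition_def by blast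
  show "0 < hd mu" using mu hd_in_set[OF mu_ne] unfolding is_partition_def by blast
  have hd: "fn lam 0 = hd lam" "fn mu 0 = hd mu" using ne mu_ne by (simp_all add: nth_default_def hd_conv_nth)
  show "hd mu < hd lam" using b ne hd unfolding basic_def by force
  have ends: "x \<le> hd lam" "last lam \<le> x" if "x \<in> set lam" for x
  proof -
    obtain i where i: "i < length lam" "x = lam ! i" using \<open>x \<in> set lam\<close> by (metis in_set_conv_nth)
    then have "x = fn lam i" "last lam = fn lam (length lam - 1)" "i \<le> length lam - 1"
      using ne by (auto simp: nth_default_def last_conv_nth)
    then show "x \<le> hd lam" "last lam \<le> x" using youngD[OF young_fn[OF lam]] hd by (metis le0, metis)
  qed
  show "last lam < hd lam"
  proof (rule ccontr)
    assume "\<not> last lam < hd lam"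
    then have "set lam \<subseteq> {hd lam}" using ends by force
    then have "dp lam \<le> 1" unfolding dp_def by (metis card.empty card_insert_disjoint card_mono empty_iff finite.emptyI finite_insert One_nat_def)
    then show False using dp(2) by simp
  qed
qed

lemma A_facts:
  shows "is_partition (A_outer lam)" "is_partition (A_inner mu)"
    "fn (A_outer lam) = two_rows (hd lam - 2) (last lam - 1)" "fn (A_inner mu) = two_rows (hd mu - 1) 0"
  using delta_facts
  by (auto simp: A_outer_def A_inner_def is_partition_def two_rows_def fun_eq_iff nth_default_def
      strip_while_def nth_Cons split: nat.splits)

lemma B_facts:
  shows "is_partition (B_outer lam)" "is_partition (B_inner mu)" "fn (B_inner mu) i \<le> fn (B_outer lam) i"
    "fn lam = ins (hd lam) (ins (last lam) (fn (B_outer lam)))" "fn mu = ins (hd mu) (ins 0 (fn (B_inner mu)))"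
proof -
  have ne: "lam \<noteq> []" "tl lam \<noteq> []" "mu \<noteq> []" using delta_facts(1,2) by (auto simp: numeral_2_eq_2 Suc_le_length_iff)
  show p: "is_partition (B_outer lam)" "is_partition (B_inner mu)"
    unfolding B_outer_def B_inner_def using lam mu by (simp_all add: is_partition_tl is_partition_butlast)
  show "fn lam = ins (hd lam) (ins (last lam) (fn (B_outer lam)))"
    unfolding B_outer_def using fn_Cons_eq_ins[OF lam ne(1)] fn_snoc_eq_ins[OF is_partition_tl[OF lam] ne(2)] ne
    by (simp add: last_tl)
  show "fn mu = ins (hd mu) (ins 0 (fn (B_inner mu)))"
    using fn_Cons_eq_ins[OF mu ne(3)] ins_zero[OF young_fn[OF p(2)]] unfolding B_inner_def by simp
  have "fn (B_inner mu) i = fn mu (Suc i)"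
    unfolding B_inner_def using ne by (cases mu) (auto simp: nth_default_def)
  moreover have "fn (B_outer lam) i = (if Suc (Suc i) < length lam then fn lam (Suc i) else 0)"
    unfolding B_outer_def using ne by (auto simp: nth_default_def nth_butlast nth_tl)
  moreover have "fn mu (Suc i) \<le> fn lam (Suc (Suc i))" using basic_shapeD(1)[OF basic_shape_if_basic[OF b]] .
  ultimately show "fn (B_inner mu) i \<le> fn (B_outer lam) i"
    using basic_le[OF b, of "Suc i"] by (auto simp: nth_default_def)
qed

lemma pair_LR:
  assumes A: "LR (fn (A_outer lam)) (fn (A_inner mu)) k" and B: "LR (fn (B_outer lam)) (fn (B_inner mu)) h"
  shows "k = two_rows (k 0) (k 1)" "k 1 \<le> k 0"
    "LR (fn lam) (fn mu) (ins (k 0 + 2) (ins (k 1) h))"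
    "LR (fn lam) (fn mu) (ins (k 0 + 1) (ins (k 1 + 1) h))"
proof -
  note f = delta_facts
  show k1: "k 1 \<le> k 0" using youngD[OF LR_young[OF A]] by simp
  have "k i = 0" if "2 \<le> i" for i
    by (rule LR_rows[OF A _ that]) (simp add: A_facts two_rows_def)
  then show k: "k = two_rows (k 0) (k 1)"
    by (auto simp: two_rows_def fun_eq_iff)
  \<comment> \<open>The diagram \<open>(2, 1)/(1)\<close> arises from a single box by inserting an
    isolated box at row 1 and column 0; the two addable rows \<open>r\<close> give its two
    components.\<close>
  have box: "LR (two_rows 2 1) (two_rows 1 0) ((two_rows 1 0)(r := Suc (two_rows 1 0 r)))" if "r = 0 \<or> r = 1" for r
  proof -
    have 1: "(\<lambda>i. if i < 1 then Suc (two_rows 1 0 i) else if i = 1 then Suc 0 else two_rows 1 0 (i - 1)) = two_rows 2 1"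
      "(\<lambda>i. if i < 1 then Suc (two_rows 0 0 i) else if i = 1 then 0 else two_rows 0 0 (i - 1)) = two_rows 1 0"
      by (auto simp: two_rows_def fun_eq_iff)
    show ?thesis
      using LR_insert_box[OF LR_row[of 0 1] young_two_rows, of r 1 0] that unfolding 1 by (auto simp: two_rows_def)
  qed
  have r: "(two_rows 1 0)(0 := Suc (two_rows 1 0 0)) = two_rows 2 0"
    "(two_rows 1 0)(1 := Suc (two_rows 1 0 1)) = two_rows 1 1"
    by (auto simp: two_rows_def fun_eq_iff)
  have plus: "(\<lambda>i. two_rows a b i + two_rows c e i) = two_rows (a + c) (b + e)" for a b c e
    by (auto simp: two_rows_def fun_eq_iff)
  have "LR (two_rows (hd lam - 2) (last lam - 1)) (two_rows (hd mu - 1) 0) (two_rows (k 0) (k 1))"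
    using A k A_facts by simp
  note LR_plus[OF this box[of 0]] LR_plus[OF this box[of 1]]
  moreover have e: "hd lam - 2 + 2 = hd lam" "last lam - 1 + 1 = last lam" "hd mu - 1 + 1 = hd mu"
    using f by linarith+
  ultimately have two: "LR (two_rows (hd lam) (last lam)) (two_rows (hd mu) 0) (two_rows (k 0 + 2) (k 1))"
    "LR (two_rows (hd lam) (last lam)) (two_rows (hd mu) 0) (two_rows (k 0 + 1) (k 1 + 1))"
    unfolding r plus e by simp_all
  have "LR (fn lam) (fn mu) (ins p (ins q h))"
    if pq: "q \<le> p" and C: "LR (two_rows (hd lam) (last lam)) (two_rows (hd mu) 0) (two_rows p q)" for p q
  proof (rule LR_union[OF B C])
    note yB = young_fn[OF B_facts(1)] young_fn[OF B_facts(2)]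
    show "young (fn (B_inner mu))" "young (fn lam)" by (rule yB young_fn[OF lam])+
    show "young (two_rows (hd mu) 0)" by (rule young_two_rows) simp
    show "young (ins p (ins q h))" using LR_young[OF B] by (simp add: young_ins)
    show "is_union (fn (B_outer lam)) (two_rows (hd lam) (last lam)) (fn lam)"
      unfolding B_facts(4) by (rule is_union_two_rows[OF yB(1)]) (use f in simp)
    show "is_union (fn (B_inner mu)) (two_rows (hd mu) 0) (fn mu)"
      unfolding B_facts(5) by (rule is_union_two_rows[OF yB(2)]) simp
    show "is_union h (two_rows p q) (ins p (ins q h))" by (rule is_union_two_rows[OF LR_young[OF B] pq])
  qed
  from this[OF _ two(1)] this[OF _ two(2)] k1
  show "LR (fn lam) (fn mu) (ins (k 0 + 2) (ins (k 1) h))"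
    "LR (fn lam) (fn mu) (ins (k 0 + 1) (ins (k 1 + 1) h))" by simp_all
qed

lemma pair_mem:
  assumes "LR (fn (A_outer lam)) (fn (A_inner mu)) k" "LR (fn (B_outer lam)) (fn (B_inner mu)) h"
  shows "pair k h \<in> neighbour_pairs (components lam mu)"
proof -
  let ?u = "ins (k 0 + 2) (ins (k 1) h)" and ?v = "ins (k 0 + 1) (ins (k 1 + 1) h)"
  let ?f = "ins (k 0 + 1) (ins (k 1) h)"
  have h: "young h" using LR_young assms(2) .
  have y: "young ?u" "young ?v" "young ?f" using h by (simp_all add: young_ins)
  have comp: "to_list ?u \<in> components lam mu" "to_list ?v \<in> components lam mu"
    using components_iff[OF lam mu basic_le[OF b]] is_partition_to_list fn_to_list y pair_LR(3,4)[OF assms] by metis+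
  have "cover ?f ?u" using cover_ins_Suc[OF young_ins[OF h], of "k 0 + 1" "k 1"] by simp
  moreover have "cover ?f ?v"
    using cover_ins[OF young_ins[OF h] young_ins[OF h] cover_ins_Suc[OF h, of "k 1"], of "k 0 + 1"] by simp
  moreover have "?u \<noteq> ?v" using ins_ins_inject[OF h, of "k 1" "k 0 + 2" "k 1 + 1" "k 0 + 1"] pair_LR(2)[OF assms] by auto
  then have "to_list ?u \<noteq> to_list ?v" using fn_to_list y by metis
  ultimately have "differ_by_one_box (to_list ?u) (to_list ?v)"
    using differ_by_one_box_iff is_partition_to_list y fn_to_list by metis
  then show ?thesis unfolding pair_def neighbour_pairs_def using comp by blast
qed

lemma pair_eqD:
  assumes "young h" "young h'" "pair k h = pair k' h'"
  shows "ins (k 0 + 2) (ins (k 1) h) = ins (k' 0 + 2) (ins (k' 1) h') \<and>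
       ins (k 0 + 1) (ins (k 1 + 1) h) = ins (k' 0 + 1) (ins (k' 1 + 1) h') \<or>
     ins (k 0 + 2) (ins (k 1) h) = ins (k' 0 + 1) (ins (k' 1 + 1) h') \<and>
       ins (k 0 + 1) (ins (k 1 + 1) h) = ins (k' 0 + 2) (ins (k' 1) h')"
proof -
  have "to_list f = to_list f' \<longleftrightarrow> f = f'" if "young f" "young f'" for f f' using that fn_to_list by metis
  then show ?thesis using assms unfolding pair_def doubleton_eq_iff by (simp add: young_ins)
qed

lemma card_pairs_A: "card (components (A_outer lam) (A_inner mu)) \<le> card (neighbour_pairs (components lam mu))"
proof -
  note A = components_iff[OF A_facts(1,2)]
  have le: "fn (A_inner mu) i \<le> fn (A_outer lam) i" for i
    using delta_facts by (auto simp: A_facts two_rows_def)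
  obtain h where h: "LR (fn (B_outer lam)) (fn (B_inner mu)) h"
    using ex_LR[OF young_fn[OF B_facts(1)] young_fn[OF B_facts(2)] B_facts(3)] by blast
  note yh = LR_young[OF h]
  show ?thesis
  proof (rule card_inj_on_le)
    show "inj_on (\<lambda>nu. pair (fn nu) h) (components (A_outer lam) (A_inner mu))"
    proof (rule inj_onI)
      fix x y assume xy: "x \<in> components (A_outer lam) (A_inner mu)" "y \<in> components (A_outer lam) (A_inner mu)"
        "pair (fn x) h = pair (fn y) h"
      then have p: "is_partition x" "is_partition y" and
        L: "LR (fn (A_outer lam)) (fn (A_inner mu)) (fn x)" "LR (fn (A_outer lam)) (fn (A_inner mu)) (fn y)"
        using A le by auto
      note x = pair_LR(1,2)[OF L(1) h] and y = pair_LR(1,2)[OF L(2) h]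
      have "fn x 0 = fn y 0 \<and> fn x 1 = fn y 1"
        using pair_eqD[OF yh yh xy(3)]
      proof (elim disjE conjE)
        assume "ins (fn x 0 + 2) (ins (fn x 1) h) = ins (fn y 0 + 2) (ins (fn y 1) h)"
        from ins_ins_inject[OF yh _ _ this] show ?thesis using x(2) y(2) by simp
      next
        \<comment> \<open>The crossed identification would make each of the first parts of
          \<open>x\<close> and \<open>y\<close> larger by one than the other.\<close>
        assume e: "ins (fn x 0 + 2) (ins (fn x 1) h) = ins (fn y 0 + 1) (ins (fn y 1 + 1) h)"
          "ins (fn x 0 + 1) (ins (fn x 1 + 1) h) = ins (fn y 0 + 2) (ins (fn y 1) h)"
        from ins_ins_inject[OF yh _ _ e(1)] ins_ins_inject[OF yh _ _ e(2)] show ?thesis using x(2) y(2) by simp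
      qed
      then have "fn x = fn y" using x(1) y(1) by metis
      then show "x = y" using inj_fn[OF p] by blast
    qed
    show "(\<lambda>nu. pair (fn nu) h) ` components (A_outer lam) (A_inner mu) \<subseteq> neighbour_pairs (components lam mu)"
      using A le pair_mem h by auto
  qed (intro finite_neighbour_pairs finite_components)
qed

lemma card_pairs_B: "card (components (B_outer lam) (B_inner mu)) \<le> card (neighbour_pairs (components lam mu))"
proof -
  note B = components_iff[OF B_facts(1-3)]
  have "fn (A_inner mu) i \<le> fn (A_outer lam) i" for i
    using delta_facts by (auto simp: A_facts two_rows_def)
  then obtain k where k: "LR (fn (A_outer lam)) (fn (A_inner mu)) k"
    using ex_LR[OF young_fn[OF A_facts(1)] young_fn[OF A_facts(2)]] by blast
  have k1: "k 1 \<le> k 0" using youngD[OF LR_young[OF k]] by simp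
  show ?thesis
  proof (rule card_inj_on_le)
    show "inj_on (\<lambda>nu. pair k (fn nu)) (components (B_outer lam) (B_inner mu))"
    proof (rule inj_onI)
      fix x y assume xy: "x \<in> components (B_outer lam) (B_inner mu)" "y \<in> components (B_outer lam) (B_inner mu)"
        "pair k (fn x) = pair k (fn y)"
      then have p: "is_partition x" "is_partition y" using B by auto
      note yx = young_fn[OF p(1)] and yy = young_fn[OF p(2)]
      have "fn x = fn y"
        using pair_eqD[OF yx yy xy(3)]
      proof (elim disjE conjE)
        assume "ins (k 0 + 2) (ins (k 1) (fn x)) = ins (k 0 + 2) (ins (k 1) (fn y))"
        then show ?thesis using inj_ins yx yy young_ins by metis
      next
        assume e: "ins (k 0 + 2) (ins (k 1) (fn x)) = ins (k 0 + 1) (ins (k 1 + 1) (fn y))"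
          "ins (k 0 + 1) (ins (k 1 + 1) (fn x)) = ins (k 0 + 2) (ins (k 1) (fn y))"
        \<comment> \<open>Of the inserted parts only \<open>k 0 + 2\<close> reaches column
          \<open>k 0 + 1\<close>, so crossed equalities would make this column longer in
          \<open>x\<close> than in \<open>y\<close> and conversely.\<close>
        have "conjugate (fn x) (k 0 + 1) + 1 = conjugate (fn y) (k 0 + 1)" "conjugate (fn x) (k 0 + 1) = conjugate (fn y) (k 0 + 1) + 1"
          using arg_cong[OF e(1), of "\<lambda>f. conjugate f (k 0 + 1)"] arg_cong[OF e(2), of "\<lambda>f. conjugate f (k 0 + 1)"] k1
          by (simp_all add: conjugate_ins young_ins yx yy)
        then show ?thesis by simp
      qed
      then show "x = y" using inj_fn[OF p] by blast
    qed
    show "(\<lambda>nu. pair k (fn nu)) ` components (B_outer lam) (B_inner mu) \<subseteq> neighbour_pairs (components lam mu)"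
      using B pair_mem[OF k] by auto
  qed (intro finite_neighbour_pairs finite_components)
qed

end

theorem theorem3p9:
  fixes lam mu :: "nat list" and n :: nat
  assumes "is_partition lam" and "is_partition mu"
    and "basic lam mu"
    and "delta lam mu = n" and "n \<ge> 2"
  shows "card (neighbour_pairs (components lam mu)) \<ge> g n \<and>
         card (neighbour_pairs (components lam mu))
           \<ge> max (card (components (A_outer lam) (A_inner mu)))
                 (card (components (B_outer lam) (B_inner mu)))"
proof -
  have d: "2 \<le> delta lam mu" using assms(4,5) by simp
  have "2 \<le> length lam" by (rule delta_facts(2)[OF assms(1-3) d])
  then have "0 < fn lam 0" using fn_pos_iff[OF assms(1), of 0] by linarith
  then have "red (min (card (corners (fn lam))) (Suc (card (corners (fn mu))))) (fn lam) (fn mu)"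
    by (intro red_min_corners young_fn basic_shape_if_basic assms(1-3))
  moreover have "min (card (corners (fn lam))) (Suc (card (corners (fn mu)))) = n"
    using assms(4) by (simp add: card_corners_fn assms(1,2) delta_def min.commute)
  ultimately have "g n \<le> card (neighbour_pairs (components lam mu))"
    using g_le_if_red[OF assms(1,2) basic_le[OF assms(3)]] by simp
  then show ?thesis using card_pairs_A[OF assms(1-3) d] card_pairs_B[OF assms(1-3) d] by simp
qed

end
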